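(* For every sufficiently small $\delta>0$, every $E_{0,2},E_{0,3}\in C^\infty(\mathbb{T}^3)$ and every $v_0,B_0\in C^\infty(\mathbb{T}^3;\mathbb{R}^3)$ with $\operatorname{div}v_0=\operatorname{div}B_0=0$ and $\hat B_0(0)=0$, there exist $E_{0,1}\in X^1\setminus X^{1+\delta/2}$ and a unique solution $(v,B,E)$ of the full MHD system below on some interval $[0,T]$ with initial data $(v_0,B_0,E_0)$, $E_0=(E_{0,1},E_{0,2},E_{0,3})$, such that there is a time $t\in(0,T)$ with $v(t)\notin X^{5+\delta}(\mathbb{T}^3)$ or $B(t)\notin X^{5+\delta}(\mathbb{T}^3)$.
   Context: The system (full MHD / Navier–Stokes–Maxwell) for $v,E,B:\mathbb{R}^+\times\mathbb{T}^3\to\mathbb{R}^3$ and scalar pressure $p$, with viscosity $\nu>0$ and conductivity $\sigma=1$, is: $\partial_t v+v\cdot\nabla v-\nu\Delta v+\nabla p=j\times B$, $\partial_t E-\nabla\times B=-j$, $\partial_t B+\nabla\times E=0$, $\operatorname{div}v=\operatorname{div}B=0$, $j=\sigma(E+v\times B)$, with $v(0)=v_0$, $B(0)=B_0$, $E(0)=E_0$; solutions are understood in the mild (Duhamel) sense, with $v$ given via the heat semigroup and Leray projection, and $B$ and the divergence-free part of $E$ given via the damped-wave propagators for $\partial_{tt}w-\Delta w+\partial_t w$. Periodic functions are expanded as $f(x)=\sum_{n\in\mathbb{Z}^3}\hat f(n)e^{in\cdot x}$, and for $s\in\mathbb{R}$, $X^s:=\{u: \|u\|_{X^s}:=\sum_{n\in\mathbb{Z}^3}(1+|n|^2)^{s/2}|\hat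 u(n)|<\infty\}$. *)

theory Defs
  imports "HOL-Analysis.Analysis"
begin

type_synonym R3 = "real^3"
type_synonym Z3 = "int^3"

definition periodic3 :: "(R3 \<Rightarrow> 'a) \<Rightarrow> bool" where
  "periodic3 f \<longleftrightarrow> (\<forall>x i. f (x + (2*pi) *\<^sub>R axis i 1) = f x)"

definition ndot :: "Z3 \<Rightarrow> R3 \<Rightarrow> real" where
  "ndot n x = (\<Sum>i\<in>UNIV. of_int (n$i) * x$i)"

definition nsq :: "Z3 \<Rightarrow> real" where
  "nsq n = (\<Sum>i\<in>UNIV. (of_int (n$i))^2)"

definition fc :: "(R3 \<Rightarrow> real) \<Rightarrow> Z3 \<Rightarrow> complex" where
  "fc f n = integral (cbox 0 (\<chi> i. 2*pi)) (\<lambda>x. complex_of_real (f x) * cis (- ndot n x))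
            / complex_of_real ((2*pi)^3)"

definition fcv :: "(R3 \<Rightarrow> R3) \<Rightarrow> Z3 \<Rightarrow> complex^3" where
  "fcv u n = (\<chi> i. fc (\<lambda>x. u x $ i) n)"

definition wt :: "real \<Rightarrow> Z3 \<Rightarrow> real" where
  "wt s n = (1 + nsq n) powr (s/2)"

text \<open>Membership of a (real, periodic, pointwise defined) function in X^s.  For s >= 0
  elements of X^s have absolutely convergent Fourier series, hence are continuous;
  we take the continuous representative.\<close>
definition in_X :: "real \<Rightarrow> (R3 \<Rightarrow> real) \<Rightarrow> bool" where
  "in_X s f \<longleftrightarrow> periodic3 f \<and> continuous_on UNIV f \<and>
     (\<lambda>n. wt s n * cmod (fc f n)) summable_on UNIV"

definition Xnorm :: "real \<Rightarrow> (R3 \<Rightarrow> real) \<Rightarrow> real" where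
  "Xnorm s f = (\<Sum>\<^sub>\<infinity>n. wt s n * cmod (fc f n))"

definition in_Xv :: "real \<Rightarrow> (R3 \<Rightarrow> R3) \<Rightarrow> bool" where
  "in_Xv s u \<longleftrightarrow> (\<forall>i. in_X s (\<lambda>x. u x $ i))"

definition Xnormv :: "real \<Rightarrow> (R3 \<Rightarrow> R3) \<Rightarrow> real" where
  "Xnormv s u = (\<Sum>i\<in>UNIV. Xnorm s (\<lambda>x. u x $ i))"

definition pd :: "3 \<Rightarrow> (R3 \<Rightarrow> real) \<Rightarrow> (R3 \<Rightarrow> real)" where
  "pd i f x = frechet_derivative f (at x) (axis i 1)"

fun pdl :: "3 list \<Rightarrow> (R3 \<Rightarrow> real) \<Rightarrow> (R3 \<Rightarrow> real)" where
  "pdl [] f = f"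
| "pdl (i # is) f = pd i (pdl is f)"

definition smooth :: "(R3 \<Rightarrow> real) \<Rightarrow> bool" where
  "smooth f \<longleftrightarrow> (\<forall>is. pdl is f differentiable_on UNIV \<and> continuous_on UNIV (pdl is f))"

definition smooth_torus :: "(R3 \<Rightarrow> real) \<Rightarrow> bool" where
  "smooth_torus f \<longleftrightarrow> periodic3 f \<and> smooth f"

definition smooth_torus_v :: "(R3 \<Rightarrow> R3) \<Rightarrow> bool" where
  "smooth_torus_v u \<longleftrightarrow> (\<forall>i. smooth_torus (\<lambda>x. u x $ i))"

definition divg :: "(R3 \<Rightarrow> R3) \<Rightarrow> R3 \<Rightarrow> real" where
  "divg u x = (\<Sum>i\<in>UNIV. pd i (\<lambda>y. u y $ i) x)"

definition cross3 :: "'a::comm_ring^3 \<Rightarrow> 'a^3 \<Rightarrow> 'a^3" where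
  "cross3 a b = vector [a$2 * b$3 - a$3 * b$2, a$3 * b$1 - a$1 * b$3, a$1 * b$2 - a$2 * b$1]"

definition cvec :: "Z3 \<Rightarrow> complex^3" where
  "cvec n = (\<chi> i. of_int (n$i))"

definition cdot :: "complex^3 \<Rightarrow> complex^3 \<Rightarrow> complex" where
  "cdot a b = (\<Sum>i\<in>UNIV. a$i * b$i)"

definition curl_hat :: "Z3 \<Rightarrow> complex^3 \<Rightarrow> complex^3" where
  "curl_hat n a = \<i> *s cross3 (cvec n) a"

definition leray :: "Z3 \<Rightarrow> complex^3 \<Rightarrow> complex^3" where
  "leray n a = (if nsq n = 0 then a else a - (cdot (cvec n) a / complex_of_real (nsq n)) *s cvec n)"

definition leray_c :: "Z3 \<Rightarrow> complex^3 \<Rightarrow> complex^3" where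
  "leray_c n a = a - leray n a"

definition heat :: "real \<Rightarrow> real \<Rightarrow> Z3 \<Rightarrow> complex" where
  "heat \<nu> t n = complex_of_real (exp (- \<nu> * nsq n * t))"

text \<open>Damped-wave propagators for w'' - Delta w + w' = 0 on the n-th mode:
  roots of z^2 + z + |n|^2 = 0 (never double, since |n|^2 is an integer);
  dw_S solves with w(0)=0, w'(0)=1; dw_Sd is its time derivative.\<close>
definition lam_p :: "Z3 \<Rightarrow> complex" where
  "lam_p n = (-1 + csqrt (complex_of_real (1 - 4 * nsq n))) / 2"
definition lam_m :: "Z3 \<Rightarrow> complex" where
  "lam_m n = (-1 - csqrt (complex_of_real (1 - 4 * nsq n))) / 2"

definition dw_S :: "real \<Rightarrow> Z3 \<Rightarrow> complex" where
  "dw_S t n = (exp (lam_p n * complex_of_real t) - exp (lam_m n * complex_of_real t)) / (lam_p n - lam_m n)"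
definition dw_Sd :: "real \<Rightarrow> Z3 \<Rightarrow> complex" where
  "dw_Sd t n = (lam_p n * exp (lam_p n * complex_of_real t) - lam_m n * exp (lam_m n * complex_of_real t))
               / (lam_p n - lam_m n)"

section \<open>Mild solutions of the full MHD (Navier-Stokes-Maxwell) system, sigma = 1\<close>

definition mhd_mild :: "real \<Rightarrow> real \<Rightarrow> (R3 \<Rightarrow> R3) \<Rightarrow> (R3 \<Rightarrow> R3) \<Rightarrow> (R3 \<Rightarrow> R3)
     \<Rightarrow> (real \<Rightarrow> R3 \<Rightarrow> R3) \<Rightarrow> (real \<Rightarrow> R3 \<Rightarrow> R3) \<Rightarrow> (real \<Rightarrow> R3 \<Rightarrow> R3) \<Rightarrow> bool" where
  "mhd_mild \<nu> T v0 B0 E0 v B E \<longleftrightarrow>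
    (\<forall>t\<in>{0..T}. in_Xv 1 (v t) \<and> in_Xv 1 (B t) \<and> in_Xv 1 (E t)) \<and>
    (\<forall>t0\<in>{0..T}.
       ((\<lambda>t. Xnormv 1 (\<lambda>x. v t x - v t0 x)) \<longlongrightarrow> 0) (at t0 within {0..T}) \<and>
       ((\<lambda>t. Xnormv 1 (\<lambda>x. B t x - B t0 x)) \<longlongrightarrow> 0) (at t0 within {0..T}) \<and>
       ((\<lambda>t. Xnormv 1 (\<lambda>x. E t x - E t0 x)) \<longlongrightarrow> 0) (at t0 within {0..T})) \<and>
    (\<forall>t\<in>{0..T}. \<forall>n.
      fcv (v t) n =
        heat \<nu> t n *s fcv v0 n
        + integral {0..t} (\<lambda>s. heat \<nu> (t - s) n *s leray n
            (fcv (\<lambda>x. cross3 (E s x + cross3 (v s x) (B s x)) (B s x)) n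
             - (\<Sum>k\<in>UNIV. (\<i> * of_int (n$k)) *s fcv (\<lambda>x. (v s x $ k) *\<^sub>R v s x) n))) \<and>
      fcv (B t) n =
        (dw_Sd t n + dw_S t n) *s fcv B0 n
        + dw_S t n *s (- curl_hat n (fcv E0 n))
        + integral {0..t} (\<lambda>s. dw_S (t - s) n *s curl_hat n (fcv (\<lambda>x. cross3 (v s x) (B s x)) n)) \<and>
      leray n (fcv (E t) n) =
        dw_Sd t n *s leray n (fcv E0 n)
        + dw_S t n *s curl_hat n (fcv B0 n)
        - integral {0..t} (\<lambda>s. dw_Sd (t - s) n *s leray n (fcv (\<lambda>x. cross3 (v s x) (B s x)) n)) \<and>
      leray_c n (fcv (E t) n) =
        complex_of_real (exp (- t)) *s leray_c n (fcv E0 n)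
        - integral {0..t} (\<lambda>s. complex_of_real (exp (- (t - s))) *s
              leray_c n (fcv (\<lambda>x. cross3 (v s x) (B s x)) n)))"

end

(* The equations are solved in Fourier coefficients. The data E01 is a lacunary series in x_2 alone,
   so it is divergence free, with coefficients <n>^(-r), r = 1 + delta/2, at the frequencies
   n_k = (0, N_k, 0); it lies in X^1 but not in X^r. Its curl drives the damped wave equation for B, and
   the free part of B at n_k has size |sin(omega_k t)| <n_k>^(-r). Picard iteration in the algebra of
   sequences with sum <n>|u(n)| and sup <n>^r |u(n)| finite gives a solution whose Duhamel term is at
   most sqrt T times a constant times <n>^(-r) at every n. The existence time T depends only on these
   norms and not on the N_k, so for small T one may afterwards choose the N_k such that the phases
   satisfy |sin(omega_k T/2)| >= 1/2 for all k; then B(T/2) is not even in X^r. *)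
theory Submission
  imports Defs
begin

section \<open>Fourier coefficients on the torus\<close>

text \<open>The obstacle: a bound on the Duhamel term in X^1 controls single coefficients only up to
  <n>^(-1), which is larger than the <n>^(-r) to be detected, so an l^1 estimate alone cannot show
  that the free part survives. The sup norm with weight <n>^r repairs this. Since <m+k>^r <= 2^r
  (<m>^r + <k>^r), a product puts the weight on one factor only and measures the others in l^1, so
  the sup bound of the forcing is linear in that of the data. The wave propagator does not smooth:
  the factor N_k from the curl cancels against 1/omega_k, so B inherits the decay <n>^(-r) of E and
  no more. The rate sqrt T comes from the divergence of the tensor v v under the heat kernel, which
  costs 1/sqrt tau. In units of <n_k>^(-r) the budget at time T/2 is 1/4 from the free wave, less
  1/8 for Duhamel and 1/16 for the smooth B_0, which leaves 1/16. The iteration runs on complex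
  sequences; that its limit belongs to real functions follows from uniqueness, because conjugation
  combined with n -> -n maps solutions to solutions.\<close>

abbreviation tbox :: "R3 set" where
  "tbox \<equiv> cbox 0 (\<chi> i. 2*pi)"

abbreviation ec :: "Z3 \<Rightarrow> R3 \<Rightarrow> complex" where
  "ec n x \<equiv> cis (ndot n x)"

section \<open>Translation invariance and integration by parts on the period box\<close>

lemma axis_Basis: "axis j (1::real) \<in> (Basis :: R3 set)"
  by (simp add: axis_in_Basis_iff)

text \<open>Cut the shifted box at x_j = 2*pi. By periodicity the protruding slab moves back to the
  face x_j = 0, where it fills exactly the gap that the shift left.\<close>

lemma integral_tbox_shift:
  fixes g :: "R3 \<Rightarrow> 'a::banach"
  assumes per: "periodic3 g" and cont: "continuous_on UNIV g" and h: "0 \<le> h" "h \<le> 2*pi"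
  shows "integral tbox (\<lambda>x. g (x + h *\<^sub>R axis j 1)) = integral tbox g"
proof -
  let ?k = "axis j 1 :: R3"
  let ?b = "(\<chi> i. 2*pi) :: R3"
  let ?c = "h *\<^sub>R ?k"
  let ?d = "?b + ?c - (2*pi) *\<^sub>R ?k"
  have int: "g integrable_on cbox u v" for u v
    by (rule integrable_continuous) (rule continuous_on_subset[OF cont], simp)
  have in_k: "x \<bullet> ?k = x $ j" for x :: R3
    by (simp add: inner_axis)
  have "integral tbox (\<lambda>x. g (x + ?c)) = integral (cbox ?c (?b + ?c)) g"
    using integral_shift_cbox[of ?c ?c "?b + ?c" g] by simp
  also have "\<dots> = integral (cbox ?c (?b + ?c) \<inter> {x. x \<bullet> ?k \<le> 2*pi}) g
      + integral (cbox ?c (?b + ?c) \<inter> {x. x \<bullet> ?k \<ge> 2*pi}) g"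
    by (rule integral_split[OF int axis_Basis])
  also have "cbox ?c (?b + ?c) \<inter> {x. x \<bullet> ?k \<le> 2*pi} = cbox ?c ?b"
    unfolding in_k interval_split_cart[unfolded interval_cbox_cart]
    by (rule arg_cong[where f = "cbox _"]) (use h in \<open>auto simp: vec_eq_iff axis_def\<close>)
  also have "cbox ?c (?b + ?c) \<inter> {x. x \<bullet> ?k \<ge> 2*pi} = cbox ((2*pi) *\<^sub>R ?k) (?b + ?c)"
    unfolding in_k interval_split_cart[unfolded interval_cbox_cart]
    by (rule arg_cong[where f = "\<lambda>a. cbox a _"]) (use h in \<open>auto simp: vec_eq_iff axis_def\<close>)
  also have "integral (cbox ((2*pi) *\<^sub>R ?k) (?b + ?c)) g = integral (cbox 0 ?d) (\<lambda>x. g (x + (2*pi) *\<^sub>R ?k))"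
    using integral_shift_cbox[of "(2*pi) *\<^sub>R ?k" "(2*pi) *\<^sub>R ?k" "?b + ?c" g] by simp
  also have "\<dots> = integral (cbox 0 ?d) g"
    using per by (simp add: periodic3_def)
  also have "integral (cbox ?c ?b) g + integral (cbox 0 ?d) g =
     integral (tbox \<inter> {x. x \<bullet> ?k \<le> h}) g + integral (tbox \<inter> {x. x \<bullet> ?k \<ge> h}) g"
  proof -
    have 1: "tbox \<inter> {x. x \<bullet> ?k \<le> h} = cbox 0 ?d"
      unfolding in_k interval_split_cart[unfolded interval_cbox_cart]
      by (rule arg_cong[where f = "cbox _"]) (use h in \<open>auto simp: vec_eq_iff axis_def\<close>)
    have 2: "tbox \<inter> {x. x \<bullet> ?k \<ge> h} = cbox ?c ?b"
      unfolding in_k interval_split_cart[unfolded interval_cbox_cart]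
      by (rule arg_cong[where f = "\<lambda>a. cbox a _"]) (use h in \<open>auto simp: vec_eq_iff axis_def\<close>)
    show ?thesis unfolding 1 2 by simp
  qed
  also have "\<dots> = integral tbox g"
    by (rule integral_split[OF int axis_Basis, symmetric])
  finally show ?thesis .
qed

text \<open>The integral over a period box does not change under translations, so its derivative along an axis vanishes; this
  replaces Fubini in the orthogonality relations and in integration by parts.\<close>

lemma integral_tbox_deriv:
  fixes g :: "R3 \<Rightarrow> 'a::banach"
  assumes per: "periodic3 g" and cont: "continuous_on UNIV g" and contD: "continuous_on UNIV D"
    and D: "\<And>x. ((\<lambda>h. g (x + h *\<^sub>R axis j 1)) has_vector_derivative D x) (at 0)"
  shows "integral tbox D = 0"
proof -
  let ?k = "axis j 1 :: R3"
  \<comment> \<open>A one-sided derivative at 0 is enough, and the shift is available only for h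
    between 0 and 2*pi.\<close>
  let ?U = "{0..1::real}"
  define H where "H h = integral tbox (\<lambda>x. g (x + h *\<^sub>R ?k))" for h
  have Dh: "((\<lambda>h. g (x + h *\<^sub>R ?k)) has_vector_derivative D (x + h *\<^sub>R ?k)) (at h within ?U)" for x h
  proof -
    have "((\<lambda>h'. g (x + h *\<^sub>R ?k + h' *\<^sub>R ?k)) has_vector_derivative D (x + h *\<^sub>R ?k)) (at (h - h))"
      using D[of "x + h *\<^sub>R ?k"] by simp
    moreover have "((\<lambda>s. s - h) has_vector_derivative 1) (at h)"
      by (auto intro!: derivative_eq_intros)
    ultimately have "(((\<lambda>h'. g (x + h *\<^sub>R ?k + h' *\<^sub>R ?k)) \<circ> (\<lambda>s. s - h)) has_vector_derivative 1 *\<^sub>R D (x + h *\<^sub>R ?k)) (at h)"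
      by (intro vector_diff_chain_at)
    moreover have "(\<lambda>h'. g (x + h *\<^sub>R ?k + h' *\<^sub>R ?k)) \<circ> (\<lambda>s. s - h) = (\<lambda>h. g (x + h *\<^sub>R ?k))"
      by (auto simp: o_def algebra_simps)
    ultimately show ?thesis
      by (simp add: has_vector_derivative_at_within)
  qed
  have "(H has_vector_derivative integral tbox (\<lambda>x. D (x + 0 *\<^sub>R ?k))) (at 0 within ?U)"
    unfolding H_def
  proof (rule leibniz_rule_vector_derivative[where fx = "\<lambda>h x. D (x + h *\<^sub>R ?k)"])
    show "(\<lambda>x. g (x + h *\<^sub>R ?k)) integrable_on tbox" for h
      by (intro integrable_continuous continuous_on_compose2[OF cont] continuous_intros) auto
    show "continuous_on (?U \<times> tbox) (\<lambda>(h, x). D (x + h *\<^sub>R ?k))"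
      unfolding split_beta
      by (intro continuous_on_compose2[OF contD] continuous_intros) auto
  qed (use Dh in auto)
  moreover have "(H has_vector_derivative 0) (at 0 within ?U)"
  proof (rule has_vector_derivative_transform[where f = "\<lambda>_. integral tbox g"])
    show "H h = integral tbox g" if "h \<in> ?U" for h
      unfolding H_def using that pi_gt3 by (intro integral_tbox_shift per cont) auto
  qed auto
  ultimately show ?thesis
    using vector_derivative_unique_within[of 0 ?U H]
    by (simp add: trivial_limit_within islimpt_Icc)
qed

lemma ndot_add_left: "ndot (m + n) x = ndot m x + ndot n x"
  by (simp add: ndot_def algebra_simps sum.distrib)

lemma ndot_minus_left: "ndot (- n) x = - ndot n x"
  by (simp add: ndot_def sum_negf)

lemma ndot_add_right: "ndot n (x + y) = ndot n x + ndot n y"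
  by (simp add: ndot_def algebra_simps sum.distrib)

lemma ndot_zero_left [simp]: "ndot 0 x = 0"
  by (simp add: ndot_def)

lemma ndot_axis: "ndot n (h *\<^sub>R axis j 1) = of_int (n $ j) * h"
  by (simp add: ndot_def axis_def if_distrib sum.delta' cong: if_cong)

lemma continuous_ndot [continuous_intros]:
  "continuous_on S f \<Longrightarrow> continuous_on S (\<lambda>x. ndot n (f x))"
  unfolding ndot_def by (intro continuous_intros)

lemma continuous_cis [continuous_intros]:
  "continuous_on S f \<Longrightarrow> continuous_on S (\<lambda>x. cis (f x))"
  unfolding cis_conv_exp by (intro continuous_intros)

lemma periodic_ec: "periodic3 (ec n)"
proof -
  have "cis (ndot n x + of_int (n$i) * (2*pi)) = cis (ndot n x)" for x i
    using cis_multiple_2pi[of "of_int (n$i)"] by (simp flip: cis_mult add: algebra_simps)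
  then show ?thesis
    by (simp add: periodic3_def ndot_add_right ndot_axis)
qed

lemma periodic3_comp2:
  "periodic3 f \<Longrightarrow> periodic3 g \<Longrightarrow> periodic3 (\<lambda>x. F (f x) (g x))"
  by (simp add: periodic3_def)

lemma ec_deriv:
  "((\<lambda>h. ec n (x + h *\<^sub>R axis j 1)) has_vector_derivative (\<i> * of_int (n$j)) * ec n x) (at 0)"
proof -
  let ?f = "\<lambda>z. exp (\<i> * (of_real (ndot n x) + of_int (n$j) * z))"
  have "(?f has_field_derivative (\<i> * of_int (n$j)) * ec n x) (at (of_real 0))"
    by (auto intro!: derivative_eq_intros simp: cis_conv_exp)
  then have "((\<lambda>h. ?f (of_real h)) has_vector_derivative (\<i> * of_int (n$j)) * ec n x) (at 0)"
    by (rule has_vector_derivative_real_field)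
  then show ?thesis
    by (simp add: ndot_add_right ndot_axis cis_conv_exp)
qed

text \<open>Along an axis with n_j nonzero, \<open>ec n\<close> is a nonzero multiple of its own
  derivative, and derivatives integrate to zero.\<close>

lemma integral_ec_nonzero:
  assumes "n \<noteq> 0" shows "integral tbox (ec n) = 0"
proof -
  obtain j where j: "n $ j \<noteq> 0"
    using assms by (metis vec_eq_iff zero_index)
  have "integral tbox (\<lambda>x. (\<i> * of_int (n$j)) * ec n x) = 0"
    by (rule integral_tbox_deriv[OF periodic_ec _ _ ec_deriv]) (intro continuous_intros)+
  then show ?thesis using j by simp
qed

lemma content_tbox: "measure lborel tbox = (2*pi)^3"
proof -
  have "(0::R3) \<in> tbox" by (simp add: mem_box_cart)
  then have "tbox \<noteq> {}" by blast
  then show ?thesis by (simp add: content_cbox_cart)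
qed

lemma integral_ec: "integral tbox (ec n) = (if n = 0 then (2*pi)^3 else 0)"
proof (cases "n = 0")
  case True
  then have "integral tbox (ec n) = integral tbox (\<lambda>_. 1)" by simp
  also have "\<dots> = of_real ((2*pi)^3)"
    unfolding integral_const content_tbox by (simp add: scaleR_conv_of_real)
  finally show ?thesis using True by simp
qed (simp add: integral_ec_nonzero)

lemma fc_integrable:
  "continuous_on UNIV f \<Longrightarrow> (\<lambda>x. complex_of_real (f x) * cis (- ndot n x)) integrable_on tbox"
  by (intro integrable_continuous continuous_intros) (auto intro: continuous_on_subset)

lemma fc_diff:
  assumes "continuous_on UNIV f" "continuous_on UNIV g"
  shows "fc (\<lambda>x. f x - g x) n = fc f n - fc g n"
  unfolding fc_def using integral_diff[OF fc_integrable[OF assms(1), of n] fc_integrable[OF assms(2), of n]]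
  by (simp only: of_real_diff left_diff_distrib diff_divide_distrib)

lemma fc_add:
  assumes "continuous_on UNIV f" "continuous_on UNIV g"
  shows "fc (\<lambda>x. f x + g x) n = fc f n + fc g n"
  unfolding fc_def using integral_add[OF fc_integrable[OF assms(1), of n] fc_integrable[OF assms(2), of n]]
  by (simp only: of_real_add distrib_right add_divide_distrib)

lemma fc_bound:
  assumes "continuous_on UNIV f"
  obtains M where "\<And>n. cmod (fc f n) \<le> M"
proof -
  have "compact (f ` tbox)"
    by (intro compact_continuous_image continuous_on_subset[OF assms]) auto
  then obtain M where M: "\<And>x. x \<in> tbox \<Longrightarrow> \<bar>f x\<bar> \<le> M"
    by (metis bounded_real compact_imp_bounded imageI)
  have "(0::R3) \<in> tbox" by (simp add: mem_box_cart)
  then have M0: "0 \<le> M" using M[of 0] by linarith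
  have "cmod (fc f n) \<le> M" for n
  proof -
    have "cmod (integral tbox (\<lambda>x. complex_of_real (f x) * cis (- ndot n x))) \<le> M * measure lborel tbox"
      by (rule integrable_bound[OF M0 fc_integrable[OF assms]]) (use M in \<open>auto simp: norm_mult\<close>)
    then show ?thesis
      unfolding fc_def content_tbox by (simp add: norm_divide norm_mult norm_power divide_le_eq)
  qed
  then show ?thesis by (rule that)
qed

text \<open>Integration by parts: the axis derivative of the periodic product
  \<open>f x * ec (-n) x\<close> has integral zero, and the product rule splits it into the two
  sides.\<close>

lemma fc_pd:
  assumes per: "periodic3 f" and diff: "f differentiable_on UNIV"
    and cont: "continuous_on UNIV (pd j f)"
  shows "fc (pd j f) n = \<i> * of_int (n$j) * fc f n"
proof -
  have cf: "continuous_on UNIV f"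
    using diff by (rule differentiable_imp_continuous_on)
  have df: "((\<lambda>h. f (x + h *\<^sub>R axis j 1)) has_vector_derivative pd j f x) (at 0)" for x
  proof -
    have "f differentiable at x"
      using diff by (simp add: differentiable_on_def)
    then have 1: "(f has_derivative frechet_derivative f (at x)) (at (x + 0 *\<^sub>R axis j 1))"
      by (simp add: frechet_derivative_works)
    have 2: "((\<lambda>h. x + h *\<^sub>R axis j 1 :: R3) has_derivative (\<lambda>h. h *\<^sub>R axis j 1)) (at 0)"
      by (auto intro!: derivative_eq_intros)
    have "((f \<circ> (\<lambda>h. x + h *\<^sub>R axis j 1)) has_derivative
        (frechet_derivative f (at x) \<circ> (\<lambda>h. h *\<^sub>R axis j 1))) (at 0)"
      by (rule diff_chain_at[OF 2 1])
    moreover have "linear (frechet_derivative f (at x))"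
      using 1 has_derivative_linear by blast
    ultimately show ?thesis
      unfolding has_vector_derivative_def pd_def o_def by (simp add: linear_scale)
  qed
  let ?g = "\<lambda>x. complex_of_real (f x) * ec (-n) x"
  let ?D = "\<lambda>x. complex_of_real (f x) * ((\<i> * of_int ((-n)$j)) * ec (-n) x) + complex_of_real (pd j f x) * ec (-n) x"
  have "integral tbox ?D = 0"
  proof (rule integral_tbox_deriv[where g = ?g])
    show "periodic3 ?g"
      using periodic3_comp2[OF per periodic_ec] .
    show "((\<lambda>h. ?g (x + h *\<^sub>R axis j 1)) has_vector_derivative ?D x) (at 0)" for x
    proof -
      have "((\<lambda>h. complex_of_real (f (x + h *\<^sub>R axis j 1))) has_vector_derivative of_real (pd j f x)) (at 0)"
        using df[of x] bounded_linear.has_vector_derivative[OF bounded_linear_of_real] by blast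
      from has_vector_derivative_mult[OF this ec_deriv[of "-n" x j]]
      show ?thesis by simp
    qed
  qed (intro continuous_intros cf cont)+
  moreover have "integral tbox ?D = - (\<i> * of_int (n$j)) * integral tbox (\<lambda>x. complex_of_real (f x) * cis (- ndot n x))
     + integral tbox (\<lambda>x. complex_of_real (pd j f x) * cis (- ndot n x))"
  proof -
    let ?A = "\<lambda>x. complex_of_real (f x) * cis (- ndot n x)"
    let ?B = "\<lambda>x. complex_of_real (pd j f x) * cis (- ndot n x)"
    have "?D = (\<lambda>x. - (\<i> * of_int (n$j)) * ?A x + ?B x)"
      by (auto simp: ndot_minus_left fun_eq_iff algebra_simps)
    moreover
    have "(?A has_integral integral tbox ?A) tbox" "(?B has_integral integral tbox ?B) tbox"
      using fc_integrable[OF cf, of n] fc_integrable[OF cont, of n] by auto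
    then have "((\<lambda>x. - (\<i> * of_int (n$j)) * ?A x + ?B x) has_integral
        (- (\<i> * of_int (n$j)) * integral tbox ?A + integral tbox ?B)) tbox"
      by (intro has_integral_add has_integral_mult_right)
    ultimately show ?thesis
      by (simp add: integral_unique)
  qed
  ultimately show ?thesis
    unfolding fc_def by (simp add: divide_simps)
qed

lemma periodic3_pd:
  assumes per: "periodic3 f"
  shows "periodic3 (pd j f)"
proof -
  have "frechet_derivative f (at (x + (2*pi) *\<^sub>R axis i 1)) = frechet_derivative f (at x)" for x i
  proof -
    let ?p = "(2*pi) *\<^sub>R axis i 1 :: R3"
    have fp: "(\<lambda>y. f (y + ?p)) = f" "(\<lambda>y. f (y - ?p)) = f"
      using per unfolding periodic3_def by (auto simp: fun_eq_iff) (metis diff_add_cancel)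
    have "(f has_derivative D) (at (x + ?p)) \<longleftrightarrow> (f has_derivative D) (at x)" for D
    proof
      assume a: "(f has_derivative D) (at (x + ?p))"
      have "((\<lambda>y. y + ?p) has_derivative (\<lambda>y. y)) (at x)"
        by (auto intro!: derivative_eq_intros)
      from diff_chain_at[OF this a] show "(f has_derivative D) (at x)"
        using fp by (simp add: o_def)
    next
      assume a: "(f has_derivative D) (at x)"
      have b: "((\<lambda>y. y - ?p) has_derivative (\<lambda>y. y)) (at (x + ?p))"
        by (auto intro!: derivative_eq_intros)
      have "((f \<circ> (\<lambda>y. y - ?p)) has_derivative (D \<circ> (\<lambda>y. y))) (at (x + ?p))"
        by (rule diff_chain_at[OF b]) (use a in simp)
      then show "(f has_derivative D) (at (x + ?p))"
        using fp by (simp add: o_def)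
    qed
    then show ?thesis by (simp add: frechet_derivative_def)
  qed
  then show ?thesis by (simp add: periodic3_def pd_def)
qed

lemma fc_pdl_replicate:
  assumes "smooth_torus f"
  shows "periodic3 (pdl (replicate p j) f) \<and> fc (pdl (replicate p j) f) n = (\<i> * of_int (n$j))^p * fc f n"
proof (induction p)
  case 0
  then show ?case using assms by (simp add: smooth_torus_def)
next
  case (Suc p)
  have sm: "pdl is f differentiable_on UNIV" "continuous_on UNIV (pdl is f)" for "is"
    using assms by (auto simp: smooth_torus_def smooth_def)
  have "fc (pd j (pdl (replicate p j) f)) n = \<i> * of_int (n$j) * fc (pdl (replicate p j) f) n"
    using Suc sm(1)[of "replicate p j"] sm(2)[of "replicate (Suc p) j"] by (intro fc_pd) auto
  then show ?case using Suc periodic3_pd by (simp add: mult.assoc)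
qed

lemma smooth_torus_decay1:
  assumes "smooth_torus f"
  obtains M where "\<And>n. \<bar>of_int (n$j)\<bar>^p * cmod (fc f n) \<le> M"
proof -
  have "continuous_on UNIV (pdl (replicate p j) f)"
    using assms by (simp add: smooth_torus_def smooth_def)
  then obtain M where "\<And>n. cmod (fc (pdl (replicate p j) f) n) \<le> M"
    using fc_bound by blast
  moreover have "cmod (fc (pdl (replicate p j) f) n) = \<bar>of_int (n$j)\<bar>^p * cmod (fc f n)" for n
    using fc_pdl_replicate[OF assms, of p j n] by (simp add: norm_mult norm_power del: pdl.simps)
  ultimately show ?thesis
    using that by metis
qed

section \<open>Continuous periodic functions are determined by their Fourier coefficients\<close>

lemma ndot_axis_left: "ndot (axis j 1) x = x $ j"
proof -
  have "ndot (axis j 1) x = (\<Sum>i\<in>UNIV. if i = j then x $ i else 0)"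
    unfolding ndot_def by (rule sum.cong) (auto simp: axis_def)
  then show ?thesis by simp
qed

lemma integral_complex_of_real_tbox:
  assumes "continuous_on UNIV f"
  shows "integral tbox (\<lambda>x. complex_of_real (f x)) = complex_of_real (integral tbox f)"
proof -
  have "f integrable_on tbox"
    by (rule integrable_continuous) (rule continuous_on_subset[OF assms], simp)
  from integral_linear[OF this bounded_linear_of_real] show ?thesis by (simp add: o_def)
qed

text \<open>If \<open>h y > 0\<close>, the powers of the trigonometric polynomial \<open>K x = (3 + \<Sum>\<^sub>j cos (x\<^sub>j - y\<^sub>j)) / 6\<close> concentrate at \<open>y\<close> and
  cannot all be orthogonal to \<open>h\<close>.\<close>

lemma fc_zero_imp_nonpos:
  assumes cont: "continuous_on UNIV h" and zero: "\<And>n. fc h n = 0" and y: "y \<in> box 0 (\<chi> i. 2*pi)"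
  shows "h y \<le> 0"
proof (rule ccontr)
  assume "\<not> h y \<le> 0"
  then have hy: "h y > 0" by simp
  define K where "K x = (3 + (\<Sum>j\<in>UNIV. cos (x$j - y$j))) / 6" for x :: R3
  \<comment> \<open>\<open>V\<close> collects the continuous \<phi> such that all Fourier
    coefficients of h * \<phi> vanish. It is closed under sums and under multiplication by
    exponentials, so it contains 1 and with it every power of K.\<close>
  define V where "V \<phi> \<longleftrightarrow> continuous_on UNIV \<phi> \<and>
      (\<forall>n. integral tbox (\<lambda>x. of_real (h x) * \<phi> x * ec n x) = 0)" for \<phi> :: "R3 \<Rightarrow> complex"
  have V1: "V (\<lambda>_. 1)"
  proof -
    have "integral tbox (\<lambda>x. complex_of_real (h x) * ec n x) = 0" for n
      using zero[of "-n"] by (simp add: fc_def ndot_minus_left)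
    then show ?thesis by (simp add: V_def)
  qed
  have Vint: "(\<lambda>x. of_real (h x) * \<phi> x * ec n x) integrable_on tbox" if "continuous_on UNIV \<phi>" for \<phi> n
    by (rule integrable_continuous) (intro continuous_intros continuous_on_subset[OF cont] continuous_on_subset[OF that]; simp)
  have Vadd: "V (\<lambda>x. \<phi> x + \<psi> x)" if "V \<phi>" "V \<psi>" for \<phi> \<psi>
  proof -
    have "integral tbox (\<lambda>x. of_real (h x) * (\<phi> x + \<psi> x) * ec n x) = 0" for n
      using integral_add[OF Vint[of \<phi> n] Vint[of \<psi> n]] that
      by (simp add: V_def algebra_simps)
    then show ?thesis using that by (auto simp: V_def intro: continuous_intros)
  qed
  have Vmul: "V (\<lambda>x. c * ec m x * \<phi> x)" if "V \<phi>" for \<phi> m c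
  proof -
    have "integral tbox (\<lambda>x. of_real (h x) * (c * ec m x * \<phi> x) * ec n x) = 0" for n
    proof -
      have "(\<lambda>x. of_real (h x) * (c * ec m x * \<phi> x) * ec n x) =
          (\<lambda>x. c * (of_real (h x) * \<phi> x * ec (m + n) x))"
        by (auto simp: fun_eq_iff ndot_add_left simp flip: cis_mult)
      then show ?thesis using that by (simp add: V_def)
    qed
    then show ?thesis using that by (auto simp: V_def intro!: continuous_intros)
  qed
  have Vsum: "finite A \<Longrightarrow> (\<And>a. a \<in> A \<Longrightarrow> V (F a)) \<Longrightarrow> V (\<lambda>x. \<Sum>a\<in>A. F a x)" for A :: "3 set" and F
    by (induction A rule: finite_induct) (auto simp: V_def[of "\<lambda>_. 0"] intro!: Vadd)
  have Kc: "complex_of_real (K x) = 1/2 + (\<Sum>j\<in>UNIV. (cis (- (y$j)) / 12) * ec (axis j 1) x + (cis (y$j) / 12) * ec (- axis j 1) x)" for x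
  proof -
    have "complex_of_real (cos (x$j - y$j)) / 6 =
      (cis (- (y$j)) / 12) * ec (axis j 1) x + (cis (y$j) / 12) * ec (- axis j 1) x" for j
      by (simp add: ndot_axis_left ndot_minus_left cis_mult complex_eq_iff cos_diff sin_diff mult.commute flip: add_divide_distrib)
    then show ?thesis
      by (simp add: K_def add_divide_distrib sum_divide_distrib)
  qed
  have VK: "V (\<lambda>x. complex_of_real (K x) * \<phi> x)" if "V \<phi>" for \<phi>
  proof -
    have "V (\<lambda>x. (1/2) * ec 0 x * \<phi> x + (\<Sum>j\<in>UNIV. (cis (- (y$j)) / 12) * ec (axis j 1) x * \<phi> x + (cis (y$j) / 12) * ec (- axis j 1) x * \<phi> x))"
      by (intro Vadd Vsum Vmul that) simp
    then show ?thesis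
      by (simp add: Kc distrib_right sum_distrib_right)
  qed
  have VKN: "V (\<lambda>x. complex_of_real (K x ^ N))" for N
    by (induction N) (auto simp: V1 VK)
  have contK: "continuous_on S K" for S
    unfolding K_def by (intro continuous_intros) auto
  have int0: "integral tbox (\<lambda>x. h x * K x ^ N) = 0" for N
  proof -
    have "integral tbox (\<lambda>x. complex_of_real (h x * K x ^ N)) = 0"
      using VKN[of N] unfolding V_def by (auto dest!: spec[of _ 0])
    moreover have "continuous_on UNIV (\<lambda>x. h x * K x ^ N)"
      by (intro continuous_intros cont contK)
    ultimately show ?thesis
      by (simp only: integral_complex_of_real_tbox of_real_eq_0_iff)
  qed
  have K0: "0 \<le> K x" for x
    unfolding K_def sum_3 using cos_ge_minus_one[of "x$1 - y$1"] cos_ge_minus_one[of "x$2 - y$2"] cos_ge_minus_one[of "x$3 - y$3"]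
    by (intro divide_nonneg_nonneg) linarith+
  \<comment> \<open>Because y lies in the open box, |x_j - y_j| < 2*pi on the closed one, so the
    cosine reaches 1 only at x_j = y_j.\<close>
  have K1: "K x < 1" if xt: "x \<in> tbox" and xy: "x \<noteq> y" for x
  proof -
    obtain j where j: "x $ j \<noteq> y $ j" using xy by (auto simp: vec_eq_iff)
    have "\<bar>x $ j - y $ j\<bar> < 2*pi"
      using xt y unfolding mem_box_cart by (auto simp: abs_if dest!: spec[of _ j])
    have "cos (x$j - y$j) \<noteq> 1"
    proof
      assume "cos (x$j - y$j) = 1"
      then obtain m :: int where m: "x$j - y$j = of_int m * 2 * pi"
        unfolding cos_one_2pi_int by blast
      with \<open>\<bar>x $ j - y $ j\<bar> < 2*pi\<close> have "\<bar>of_int m :: real\<bar> * (2 * pi) < 1 * (2 * pi)"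
        by (simp add: abs_mult)
      then have "\<bar>of_int m :: real\<bar> < 1" by (rule mult_right_less_imp_less) simp
      then have "m = 0" by linarith
      then show False using m j by simp
    qed
    then have "(\<Sum>j\<in>UNIV. cos (x$j - y$j)) < (\<Sum>j\<in>(UNIV::3 set). 1)"
      by (intro sum_strict_mono_ex1) (auto intro!: bexI[of _ j] simp: less_le)
    then show ?thesis by (simp add: K_def)
  qed
  have Ky: "K y = 1" by (simp add: K_def)
  define \<eta> where "\<eta> = h y / 2"
  have \<eta>: "0 < \<eta>" "h y > \<eta>" using hy by (auto simp: \<eta>_def)
  have "open {x. h x > \<eta>}"
    using cont open_Collect_less[of "\<lambda>_. \<eta>" h] by auto
  then obtain \<rho> where \<rho>0: "\<rho> > 0" "ball y \<rho> \<subseteq> {x. h x > \<eta>}"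
    using \<eta> openE[of "{x. h x > \<eta>}" y] by auto
  then have \<rho>: "\<rho> > 0" "\<And>x. dist y x < \<rho> \<Longrightarrow> h x > \<eta>"
    by auto
  have "\<exists>q. 0 \<le> q \<and> q < 1 \<and> (\<forall>x\<in>tbox - ball y \<rho>. K x \<le> q)"
  proof (cases "tbox - ball y \<rho> = {}")
    case False
    have "compact (tbox - ball y \<rho>)" by (intro compact_diff) auto
    from continuous_attains_sup[OF this False contK]
    obtain z where z: "z \<in> tbox - ball y \<rho>" "\<forall>x\<in>tbox - ball y \<rho>. K x \<le> K z" by blast
    with \<rho> have "K z < 1" by (intro K1) auto
    then show ?thesis using z K0 by (intro exI[of _ "K z"]) auto
  qed (auto intro: exI[of _ 0])
  then obtain q where q: "0 \<le> q" "q < 1" "\<And>x. x \<in> tbox \<Longrightarrow> x \<notin> ball y \<rho> \<Longrightarrow> K x \<le> q" by auto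
  \<comment> \<open>Outside the ball K is at most q; on a small box around y it exceeds a larger q'.
    The gap between q and q' decides the limit below.\<close>
  obtain q' where q': "q < q'" "q' < 1" using q dense by blast
  have "open ({x. K x > q'} \<inter> ball y \<rho> \<inter> box 0 (\<chi> i. 2*pi))"
    using contK open_Collect_less[of "\<lambda>_. q'" K] by auto
  moreover have "y \<in> {x. K x > q'} \<inter> ball y \<rho> \<inter> box 0 (\<chi> i. 2*pi)"
    using Ky q' \<rho> y by auto
  ultimately obtain u v where uv: "cbox u v \<subseteq> {x. K x > q'} \<inter> ball y \<rho> \<inter> box 0 (\<chi> i. 2*pi)" "y \<in> box u v"
    using open_contains_cbox by metis
  define \<mu> where "\<mu> = measure lborel (cbox u v)"
  have \<mu>: "\<mu> > 0" unfolding \<mu>_def content_pos_lt_eq using uv(2) by (meson mem_box(1) order.strict_trans)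
  have uvt: "cbox u v \<subseteq> tbox" using uv(1) box_subset_cbox by blast
  have "compact (h ` tbox)"
    by (intro compact_continuous_image continuous_on_subset[OF cont]) auto
  then obtain M where M: "\<And>x. x \<in> tbox \<Longrightarrow> \<bar>h x\<bar> \<le> M"
    by (metis bounded_real compact_imp_bounded imageI)
  \<comment> \<open>Inside the ball the product is nonnegative, and on the small box at least \<eta>
    * q'^N; outside the ball it is at least -M * q^N.\<close>
  have ineq: "(if x \<in> cbox u v then \<eta> * q'^N else 0) - M * q^N \<le> h x * K x ^ N" if x: "x \<in> tbox" for x N
  proof (cases "x \<in> ball y \<rho>")
    case True
    then have hx: "h x > \<eta>" using \<rho> by simp
    have "0 \<le> M * q^N" using M[OF x] q by (intro mult_nonneg_nonneg) auto
    moreover have "\<eta> * q'^N \<le> h x * K x ^ N" if "x \<in> cbox u v"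
      using that uv(1) hx \<eta> q q' by (intro mult_mono power_mono) auto
    moreover have "0 \<le> h x * K x ^ N" using hx \<eta> K0 by (intro mult_nonneg_nonneg) auto
    ultimately show ?thesis by auto
  next
    case False
    then have "x \<notin> cbox u v" using uv by auto
    moreover have "\<bar>h x * K x ^ N\<bar> \<le> M * q^N"
      unfolding abs_mult using M[OF x] K0[of x] q(3)[OF x False] q(1)
      by (intro mult_mono) (auto simp: power_abs intro!: power_mono)
    ultimately show ?thesis by auto
  qed
  have main: "\<eta> * q'^N * \<mu> \<le> M * q^N * (2*pi)^3" for N
  proof -
    have "((\<lambda>x. if x \<in> cbox u v then \<eta> * q'^N else 0) has_integral (\<mu> *\<^sub>R (\<eta> * q'^N))) tbox"
      unfolding has_integral_restrict[OF uvt] \<mu>_def by (rule has_integral_const)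
    moreover have "((\<lambda>x. M * q^N) has_integral ((2*pi)^3 *\<^sub>R (M * q^N))) tbox"
      using has_integral_const[of "M * q^N" 0 "(\<chi> i. 2*pi) :: R3"] unfolding content_tbox .
    ultimately have "((\<lambda>x. (if x \<in> cbox u v then \<eta> * q'^N else 0) - M * q^N) has_integral
       (\<mu> *\<^sub>R (\<eta> * q'^N) - (2*pi)^3 *\<^sub>R (M * q^N))) tbox"
      by (rule has_integral_diff)
    moreover have "((\<lambda>x. h x * K x ^ N) has_integral 0) tbox"
    proof -
      have "(\<lambda>x. h x * K x ^ N) integrable_on tbox"
        by (intro integrable_continuous continuous_intros contK continuous_on_subset[OF cont]) auto
      from integrable_integral[OF this] show ?thesis unfolding int0[of N] .
    qed
    ultimately have "\<mu> *\<^sub>R (\<eta> * q'^N) - (2*pi)^3 *\<^sub>R (M * q^N) \<le> 0"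
      using ineq by (rule has_integral_le)
    then show ?thesis by (simp add: algebra_simps)
  qed
  \<comment> \<open>Dividing by q'^N leaves a fixed positive number below a multiple of (q/q')^N,
    which tends to 0.\<close>
  have "\<eta> * \<mu> \<le> M * (2*pi)^3 * (q/q')^N" for N
    using main[of N] q q' by (simp add: power_divide field_simps)
  moreover have "(\<lambda>N. M * (2*pi)^3 * (q/q')^N) \<longlonglongrightarrow> M * (2*pi)^3 * 0"
    using q q' by (intro tendsto_mult_left LIMSEQ_power_zero) (auto simp: abs_if field_simps)
  ultimately have "\<eta> * \<mu> \<le> M * (2*pi)^3 * 0"
    by (intro LIMSEQ_le_const) auto
  then show False using \<eta> \<mu> by (simp add: mult_le_0_iff)
qed

lemma periodic3_int:
  assumes "periodic3 f"
  shows "f (x + (2*pi) *\<^sub>R (\<chi> i. of_int (k $ i))) = f x"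
proof -
  have nat: "f (x + (of_nat m * (2*pi)) *\<^sub>R axis i 1) = f x" for x m i
  proof (induction m)
    case (Suc m)
    have "f (x + (of_nat (Suc m) * (2*pi)) *\<^sub>R axis i 1) =
        f (x + (of_nat m * (2*pi)) *\<^sub>R axis i 1 + (2*pi) *\<^sub>R axis i 1)"
      by (simp add: algebra_simps)
    then show ?case using Suc assms by (simp add: periodic3_def)
  qed simp
  have int: "f (x + (of_int m * (2*pi)) *\<^sub>R axis i 1) = f x" for x m i
  proof (cases "m \<ge> 0")
    case True
    then show ?thesis using nat[of x "nat m" i] by simp
  next
    case False
    then show ?thesis
      using nat[of "x + (of_int m * (2*pi)) *\<^sub>R axis i 1" "nat (-m)" i] by simp
  qed
  have "(2*pi) *\<^sub>R (\<chi> i. of_int (k $ i)) = (of_int (k$1) * (2*pi)) *\<^sub>R axis 1 1 +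
      (of_int (k$2) * (2*pi)) *\<^sub>R axis 2 1 + (of_int (k$3) * (2*pi)) *\<^sub>R (axis 3 1 :: R3)"
    by (simp add: vec_eq_iff forall_3 axis_def)
  then show ?thesis using int by (simp flip: add.assoc)
qed

text \<open>The sign result for h and for -h gives zero on the open box; continuity extends this to
  the closed box and periodicity to the whole space.\<close>

lemma fc_eq_zero_imp_zero:
  assumes cont: "continuous_on UNIV h" and per: "periodic3 h" and zero: "\<And>n. fc h n = 0"
  shows "h x = 0"
proof -
  let ?B = "box 0 (\<chi> i. 2*pi) :: R3 set"
  have "fc (\<lambda>x. 0) n = 0" for n by (simp add: fc_def)
  then have "fc (\<lambda>x. - h x) n = 0" for n
    using fc_diff[of "\<lambda>_. 0" h n] cont zero by simp
  then have "h x = 0" if "x \<in> ?B" for x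
    using fc_zero_imp_nonpos[OF cont zero that] fc_zero_imp_nonpos[of "\<lambda>x. - h x", OF _ _ that] cont
    by (force intro: continuous_intros)
  moreover have "closure ?B = tbox"
  proof -
    have "(\<chi> i. pi) \<in> ?B" by (simp add: mem_box_cart)
    then show ?thesis by (intro closure_box) blast
  qed
  ultimately have box: "h x = 0" if "x \<in> tbox" for x
    using continuous_constant_on_closure[of ?B h 0 x] that continuous_on_subset[OF cont] by auto
  \<comment> \<open>The integer translation that brings x into the period box, one floor for each
    coordinate.\<close>
  define k :: Z3 where "k = (\<chi> i. - \<lfloor>x $ i / (2*pi)\<rfloor>)"
  have "x + (2*pi) *\<^sub>R (\<chi> i. of_int (k $ i)) \<in> tbox"
  proof -
    have "0 \<le> x$i + 2*pi * real_of_int (k$i) \<and> x$i + 2*pi * real_of_int (k$i) \<le> 2*pi" for i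
      using floor_divide_lower[of "2*pi" "x$i"] floor_divide_upper[of "2*pi" "x$i"]
      unfolding k_def by (simp add: algebra_simps)
    then show ?thesis by (simp add: mem_box_cart)
  qed
  then show ?thesis using box periodic3_int[OF per] by metis
qed

section \<open>Absolutely convergent Fourier series: synthesis, inversion and products\<close>

lemma continuous_on_integrable_tbox:
  "continuous_on UNIV f \<Longrightarrow> f integrable_on tbox" for f :: "R3 \<Rightarrow> 'a::banach"
  by (rule integrable_continuous) (rule continuous_on_subset, auto)

text \<open>The Weierstrass test along the net of finite frequency sets gives uniform convergence.
  Multiplied by a test function, the convergence stays uniform on the box, so sum and integral may
  be exchanged.\<close>

lemma fourier_series:
  fixes c :: "Z3 \<Rightarrow> complex"
  assumes c: "(\<lambda>n. cmod (c n)) summable_on UNIV"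
  shows fourier_series_continuous: "continuous_on UNIV (\<lambda>x. \<Sum>\<^sub>\<infinity>n. c n * ec n x)"
    and fourier_series_integral: "continuous_on UNIV \<phi> \<Longrightarrow>
      ((\<lambda>n. c n * integral tbox (\<lambda>x. ec n x * \<phi> x)) has_sum
         integral tbox (\<lambda>x. (\<Sum>\<^sub>\<infinity>n. c n * ec n x) * \<phi> x)) UNIV"
proof -
  have "uniform_limit UNIV (\<lambda>X x. \<Sum>n\<in>X. c n * ec n x) (\<lambda>x. \<Sum>\<^sub>\<infinity>n. c n * ec n x) (finite_subsets_at_top UNIV)"
    by (rule Weierstrass_m_test_general[OF _ c]) (simp add: norm_mult)
  then show "continuous_on UNIV (\<lambda>x. \<Sum>\<^sub>\<infinity>n. c n * ec n x)"
    by (rule uniform_limit_theorem[rotated]) (auto intro!: always_eventually continuous_intros)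
  assume \<phi>: "continuous_on UNIV \<phi>"
  have "compact (\<phi> ` tbox)"
    by (intro compact_continuous_image continuous_on_subset[OF \<phi>]) auto
  then obtain M where M: "\<And>x. x \<in> tbox \<Longrightarrow> cmod (\<phi> x) \<le> M"
    by (metis bounded_iff compact_imp_bounded imageI)
  let ?g = "\<lambda>n x. c n * ec n x * \<phi> x"
  have g: "continuous_on UNIV (?g n)" for n by (intro continuous_intros \<phi>)
  have A: "uniform_limit tbox (\<lambda>X x. \<Sum>n\<in>X. ?g n x) (\<lambda>x. \<Sum>\<^sub>\<infinity>n. ?g n x) (finite_subsets_at_top UNIV)"
    by (rule Weierstrass_m_test_general[where M = "\<lambda>n. cmod (c n) * M"])
       (auto simp: norm_mult intro!: mult_mono M summable_on_cmult_left c)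
  have B: "continuous_on tbox (\<lambda>x. \<Sum>n\<in>X. ?g n x)" for X
    by (intro continuous_on_sum continuous_on_subset[OF g]) auto
  obtain I J where I: "\<And>X. ((\<lambda>x. \<Sum>n\<in>X. ?g n x) has_integral I X) tbox"
    and J: "((\<lambda>x. \<Sum>\<^sub>\<infinity>n. ?g n x) has_integral J) tbox" "(I \<longlongrightarrow> J) (finite_subsets_at_top UNIV)"
    using uniform_limit_integral_cbox[OF A B finite_subsets_at_top_neq_bot] by blast
  have "I X = (\<Sum>n\<in>X. c n * integral tbox (\<lambda>x. ec n x * \<phi> x))" for X
  proof (cases "finite X")
    case True
    have "((\<lambda>x. \<Sum>n\<in>X. ?g n x) has_integral (\<Sum>n\<in>X. integral tbox (?g n))) tbox"
      using True by (intro has_integral_sum integrable_integral continuous_on_integrable_tbox g) auto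
    then have "I X = (\<Sum>n\<in>X. integral tbox (?g n))" using I has_integral_unique by blast
    then show ?thesis by (simp add: mult.assoc)
  next
    \<comment> \<open>The formula for \<open>I\<close> must hold on every set; on an infinite one
      \<open>sum\<close> is 0 by convention, and so is the integral.\<close>
    case False
    then show ?thesis using I[of X] has_integral_unique[of "\<lambda>_. 0" "I X" tbox 0] by simp
  qed
  then have "I = sum (\<lambda>n. c n * integral tbox (\<lambda>x. ec n x * \<phi> x))"
    by (simp add: fun_eq_iff)
  with J(2) have "((\<lambda>n. c n * integral tbox (\<lambda>x. ec n x * \<phi> x)) has_sum J) UNIV"
    unfolding has_sum_def by simp
  moreover have "(\<Sum>\<^sub>\<infinity>n. ?g n x) = (\<Sum>\<^sub>\<infinity>n. c n * ec n x) * \<phi> x" for x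
    by (rule infsum_cmult_left')
  ultimately show "((\<lambda>n. c n * integral tbox (\<lambda>x. ec n x * \<phi> x)) has_sum
         integral tbox (\<lambda>x. (\<Sum>\<^sub>\<infinity>n. c n * ec n x) * \<phi> x)) UNIV"
    using J(1) by (simp add: integral_unique)
qed

text \<open>Taking the real part gives a real function for every c. Nothing is lost when c has the
  symmetry c(-n) = cnj (c n), see \<open>fourier_sum_complex\<close>.\<close>

definition fourier_sum :: "(Z3 \<Rightarrow> complex) \<Rightarrow> R3 \<Rightarrow> real" where
  "fourier_sum c x = Re (\<Sum>\<^sub>\<infinity>n. c n * ec n x)"

text \<open>Reindexing by n -> -n turns the conjugate of the series into the series itself.\<close>

lemma fourier_sum_complex:
  assumes c: "(\<lambda>n. cmod (c n)) summable_on UNIV" and sym: "\<And>n. c (- n) = cnj (c n)"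
  shows "complex_of_real (fourier_sum c x) = (\<Sum>\<^sub>\<infinity>n. c n * ec n x)"
proof -
  have "(\<lambda>n. cmod (c n * ec n x)) summable_on UNIV"
    using c by (simp add: norm_mult)
  then have s: "((\<lambda>n. c n * ec n x) has_sum (\<Sum>\<^sub>\<infinity>n. c n * ec n x)) UNIV"
    by (rule has_sum_infsum[OF abs_summable_summable])
  have "((\<lambda>n. cnj (c n * ec n x)) has_sum cnj (\<Sum>\<^sub>\<infinity>n. c n * ec n x)) UNIV"
    using s by (simp only: has_sum_cnj_iff)
  then have "((\<lambda>n. (c (-n) * ec (-n) x)) has_sum cnj (\<Sum>\<^sub>\<infinity>n. c n * ec n x)) UNIV"
    by (simp add: sym cis_cnj ndot_minus_left)
  moreover have "((\<lambda>n. (c (-n) * ec (-n) x)) has_sum (\<Sum>\<^sub>\<infinity>n. c n * ec n x)) UNIV"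
    using s has_sum_reindex_bij_witness[of UNIV uminus uminus UNIV "\<lambda>n. c n * ec n x" "\<lambda>n. (c (-n) * ec (-n) x)"] by simp
  ultimately have "cnj (\<Sum>\<^sub>\<infinity>n. c n * ec n x) = (\<Sum>\<^sub>\<infinity>n. c n * ec n x)"
    using has_sum_unique by blast
  then show ?thesis
    by (simp add: fourier_sum_def complex_eq_iff)
qed

lemma fourier_sum_continuous:
  assumes c: "(\<lambda>n. cmod (c n)) summable_on UNIV"
  shows "continuous_on UNIV (fourier_sum c)"
  unfolding fourier_sum_def by (intro continuous_intros fourier_series_continuous c)

lemma fourier_sum_periodic: "periodic3 (fourier_sum c)"
  using periodic_ec by (simp add: periodic3_def fourier_sum_def)

lemma has_sum_single:
  fixes f :: "'a \<Rightarrow> 'b :: {comm_monoid_add, topological_space}"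
  assumes "\<And>x. x \<noteq> a \<Longrightarrow> f x = 0"
  shows "(f has_sum f a) UNIV"
proof -
  have "(f has_sum sum f {a}) {a}" by (rule has_sum_finite) simp
  then show ?thesis using has_sum_cong_neutral[of UNIV "{a}" f f "f a"] assms by auto
qed

text \<open>Integrate the series term by term against \<open>ec (-m)\<close>; orthogonality leaves
  the term at m.\<close>

lemma fc_fourier_sum:
  assumes c: "(\<lambda>n. cmod (c n)) summable_on UNIV" and sym: "\<And>n. c (- n) = cnj (c n)"
  shows "fc (fourier_sum c) m = c m"
proof -
  have "((\<lambda>n. c n * integral tbox (\<lambda>x. ec n x * ec (-m) x)) has_sum
         integral tbox (\<lambda>x. (\<Sum>\<^sub>\<infinity>n. c n * ec n x) * ec (-m) x)) UNIV"
    by (rule fourier_series_integral[OF c]) (intro continuous_intros)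
  moreover have "(\<lambda>x. ec n x * ec (-m) x) = ec (n - m)" for n
    by (simp add: fun_eq_iff cis_mult ndot_minus_left ndot_add_left[of n "-m", simplified])
  then have "((\<lambda>n. c n * integral tbox (\<lambda>x. ec n x * ec (-m) x)) has_sum
       (c m * integral tbox (\<lambda>x. ec m x * ec (-m) x))) UNIV"
    by (intro has_sum_single) (simp add: integral_ec)
  ultimately have "integral tbox (\<lambda>x. (\<Sum>\<^sub>\<infinity>n. c n * ec n x) * ec (-m) x) =
     c m * integral tbox (\<lambda>x. ec m x * ec (-m) x)"
    using has_sum_unique by blast
  also have "(\<lambda>x. ec m x * ec (-m) x) = ec 0"
    by (simp add: fun_eq_iff cis_mult ndot_minus_left)
  finally have "integral tbox (\<lambda>x. (\<Sum>\<^sub>\<infinity>n. c n * ec n x) * ec (-m) x) = c m * (2*pi)^3"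
    using integral_ec[of 0] by (simp only: if_True refl)
  then show ?thesis
    by (simp add: fc_def fourier_sum_complex[OF c sym] ndot_minus_left)
qed

lemma fc_minus: "fc f (- n) = cnj (fc f n)"
  unfolding fc_def by (simp add: integral_cnj ndot_minus_left cis_cnj)

lemma fourier_sum_fc:
  assumes "periodic3 f" "continuous_on UNIV f" and s: "(\<lambda>n. cmod (fc f n)) summable_on UNIV"
  shows "fourier_sum (fc f) = f"
proof
  fix x
  have "fourier_sum (fc f) x - f x = 0"
  proof (rule fc_eq_zero_imp_zero[of "\<lambda>x. fourier_sum (fc f) x - f x"])
    show "continuous_on UNIV (\<lambda>x. fourier_sum (fc f) x - f x)"
      by (intro continuous_intros fourier_sum_continuous assms)
    show "periodic3 (\<lambda>x. fourier_sum (fc f) x - f x)"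
      by (intro periodic3_comp2[where F = "(-)"] fourier_sum_periodic assms)
    show "fc (\<lambda>x. fourier_sum (fc f) x - f x) n = 0" for n
      by (simp add: fc_diff fourier_sum_continuous assms fc_fourier_sum fc_minus)
  qed
  then show "fourier_sum (fc f) x = f x" by simp
qed

text \<open>Insert the Fourier series of f into the coefficient integral of the product. Only f
  needs summable coefficients, since g serves as the continuous test function.\<close>

lemma fc_mult:
  assumes f: "periodic3 f" "continuous_on UNIV f" and s: "(\<lambda>n. cmod (fc f n)) summable_on UNIV"
    and g: "continuous_on UNIV g"
  shows "((\<lambda>m. fc f m * fc g (n - m)) has_sum fc (\<lambda>x. f x * g x) n) UNIV"
proof -
  let ?\<phi> = "\<lambda>x. complex_of_real (g x) * cis (- ndot n x)"
  have "continuous_on UNIV ?\<phi>" by (intro continuous_intros g)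
  from fourier_series_integral[OF s this]
  have "((\<lambda>m. fc f m * integral tbox (\<lambda>x. ec m x * ?\<phi> x) / complex_of_real ((2*pi)^3)) has_sum
     integral tbox (\<lambda>x. (\<Sum>\<^sub>\<infinity>n. fc f n * ec n x) * ?\<phi> x) / complex_of_real ((2*pi)^3)) UNIV"
    unfolding divide_inverse by (rule has_sum_cmult_left)
  moreover have "(\<Sum>\<^sub>\<infinity>n. fc f n * ec n x) = complex_of_real (f x)" for x
    using fourier_sum_complex[OF s fc_minus, of x] fourier_sum_fc[OF f s] by simp
  moreover have "(\<lambda>x. ec m x * ?\<phi> x) = (\<lambda>x. complex_of_real (g x) * cis (- ndot (n - m) x))" for m
    using ndot_add_left[of n "-m"] by (auto simp: fun_eq_iff cis_mult ndot_minus_left simp flip: mult.assoc)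
  ultimately show ?thesis
    unfolding fc_def by (simp add: mult.assoc)
qed

section \<open>Convolution of summable families\<close>

text \<open>Dominated convergence for sums along an arbitrary filter: the majorant makes the partial
  sums converge uniformly in the parameter, which permits swapping the two limits.\<close>

lemma tendsto_infsum_dominated:
  fixes f :: "'b \<Rightarrow> 'a \<Rightarrow> 'c :: banach"
  assumes lim: "\<And>n. ((\<lambda>x. f x n) \<longlongrightarrow> l n) F"
    and dom: "\<forall>\<^sub>F x in F. \<forall>n. norm (f x n) \<le> M n" and M: "M summable_on UNIV"
  shows "((\<lambda>x. \<Sum>\<^sub>\<infinity>n. f x n) \<longlongrightarrow> (\<Sum>\<^sub>\<infinity>n. l n)) F"
proof (cases "F = bot")
  case False
  define S where "S = {x. \<forall>n. norm (f x n) \<le> M n}"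
  have "norm (l n) \<le> M n" for n
  proof (rule tendsto_le[OF False])
    show "((\<lambda>x. norm (f x n)) \<longlongrightarrow> norm (l n)) F" by (intro tendsto_norm lim)
    show "((\<lambda>x. M n) \<longlongrightarrow> M n) F" by (rule tendsto_const)
    show "\<forall>\<^sub>F x in F. norm (f x n) \<le> M n" using dom by eventually_elim blast
  qed
  then have "(\<lambda>n. norm (l n)) summable_on UNIV"
    by (intro Infinite_Sum.abs_summable_on_comparison_test'[OF M])
  then have "(l has_sum (\<Sum>\<^sub>\<infinity>n. l n)) UNIV"
    by (rule has_sum_infsum[OF abs_summable_summable])
  then have 1: "((\<lambda>X. sum l X) \<longlongrightarrow> (\<Sum>\<^sub>\<infinity>n. l n)) (finite_subsets_at_top UNIV)"
    by (simp add: has_sum_def)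
  have 2: "uniform_limit S (\<lambda>X x. \<Sum>n\<in>X. f x n) (\<lambda>x. \<Sum>\<^sub>\<infinity>n. f x n) (finite_subsets_at_top UNIV)"
    by (rule Weierstrass_m_test_general[OF _ M]) (auto simp: S_def)
  have 3: "((\<lambda>x. \<Sum>n\<in>X. f x n) \<longlongrightarrow> sum l X) F" for X
    by (intro tendsto_sum lim)
  show ?thesis
    by (rule swap_uniform_limit'[OF _ 1 2]) (use 3 dom in \<open>auto simp: S_def\<close>)
qed simp

text \<open>A weighted l^1 bound expressed by finite partial sums. It contains summability and the
  size of the sum in one statement and passes directly to pointwise limits.\<close>

definition wsum_bd :: "('a \<Rightarrow> real) \<Rightarrow> ('a \<Rightarrow> real) \<Rightarrow> real \<Rightarrow> bool" where
  "wsum_bd w a S \<longleftrightarrow> (\<forall>n. 0 \<le> a n) \<and> (\<forall>A. finite A \<longrightarrow> (\<Sum>n\<in>A. w n * a n) \<le> S)"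

abbreviation sum_bd :: "('a \<Rightarrow> real) \<Rightarrow> real \<Rightarrow> bool" where
  "sum_bd \<equiv> wsum_bd (\<lambda>_. 1)"

lemma wsum_bd_nonneg: "wsum_bd w a S \<Longrightarrow> 0 \<le> a n"
  by (simp add: wsum_bd_def)

lemma wsum_bd_sum: "wsum_bd w a S \<Longrightarrow> finite A \<Longrightarrow> (\<Sum>n\<in>A. w n * a n) \<le> S"
  by (simp add: wsum_bd_def)

lemma wsum_bd_bound_nonneg: "wsum_bd w a S \<Longrightarrow> 0 \<le> S"
  using wsum_bd_sum[of w a S "{}"] by simp

lemma wsum_bd_imp_sum_bd: fixes a :: "'a \<Rightarrow> real" shows "wsum_bd w a S \<Longrightarrow> (\<And>n. 1 \<le> w n) \<Longrightarrow> sum_bd a S"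
  unfolding wsum_bd_def
proof (intro conjI allI impI)
  fix A :: "'a set" assume a: "(\<forall>n. 0 \<le> a n) \<and> (\<forall>A. finite A \<longrightarrow> (\<Sum>n\<in>A. w n * a n) \<le> S)" "\<And>n. 1 \<le> w n" "finite A"
  then have "(\<Sum>n\<in>A. 1 * a n) \<le> (\<Sum>n\<in>A. w n * a n)"
    by (intro sum_mono mult_right_mono) auto
  then show "(\<Sum>n\<in>A. 1 * a n) \<le> S" using a by force
qed simp

lemma wsum_bd_mono: fixes a :: "'a \<Rightarrow> real" shows "wsum_bd w b S \<Longrightarrow> (\<And>n. 0 \<le> w n) \<Longrightarrow> (\<And>n. 0 \<le> a n) \<Longrightarrow> (\<And>n. a n \<le> b n) \<Longrightarrow> S \<le> S' \<Longrightarrow> wsum_bd w a S'"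
  unfolding wsum_bd_def
proof (intro conjI allI impI)
  fix A :: "'a set" assume a: "(\<forall>n. 0 \<le> b n) \<and> (\<forall>A. finite A \<longrightarrow> (\<Sum>n\<in>A. w n * b n) \<le> S)" "\<And>n. 0 \<le> w n"
    "\<And>n. a n \<le> b n" "finite A" "S \<le> S'"
  then have "(\<Sum>n\<in>A. w n * a n) \<le> (\<Sum>n\<in>A. w n * b n)"
    by (intro sum_mono mult_left_mono) auto
  then show "(\<Sum>n\<in>A. w n * a n) \<le> S'" using a by force
qed

lemma wsum_bd_add: "wsum_bd w a S \<Longrightarrow> wsum_bd w b S' \<Longrightarrow> wsum_bd w (\<lambda>n. a n + b n) (S + S')"
  unfolding wsum_bd_def by (auto simp: distrib_left sum.distrib add_mono)

lemma wsum_bd_cmult: "wsum_bd w a S \<Longrightarrow> 0 \<le> c \<Longrightarrow> wsum_bd w (\<lambda>n. c * a n) (c * S)"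
  unfolding wsum_bd_def by (auto simp: mult.left_commute[of _ c] simp flip: sum_distrib_left intro!: mult_left_mono)

lemma wsum_bd_summable: "wsum_bd w a S \<Longrightarrow> (\<And>n. 0 \<le> w n) \<Longrightarrow> (\<lambda>n. w n * a n) summable_on UNIV"
  by (rule nonneg_bounded_partial_sums_imp_summable_on[where C = S])
     (auto simp: wsum_bd_def intro: eventually_finite_subsets_at_top_weakI)

lemma sum_bd_summable: "sum_bd a S \<Longrightarrow> a summable_on UNIV"
  using wsum_bd_summable[of "\<lambda>_. 1" a S] by simp

lemma sum_bd_infsum: "sum_bd a S \<Longrightarrow> (\<Sum>\<^sub>\<infinity>n. a n) \<le> S"
  by (rule infsum_le_finite_sums[OF sum_bd_summable]) (auto simp: wsum_bd_def)

lemma sum_bd_point: "sum_bd a S \<Longrightarrow> a n \<le> S"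
  using wsum_bd_sum[of "\<lambda>_. 1" a S "{n}"] by simp

lemma summable_wsum_bd: "(\<lambda>n. w n * a n) summable_on UNIV \<Longrightarrow> (\<And>n. 0 \<le> w n) \<Longrightarrow> (\<And>n. 0 \<le> a n) \<Longrightarrow> wsum_bd w a (\<Sum>\<^sub>\<infinity>n. w n * a n)"
  unfolding wsum_bd_def by (auto intro!: finite_sum_le_infsum)

lemma summable_sum_bd: "a summable_on UNIV \<Longrightarrow> (\<And>n. 0 \<le> a n) \<Longrightarrow> sum_bd a (\<Sum>\<^sub>\<infinity>n. a n)"
  using summable_wsum_bd[of "\<lambda>_. 1" a] by simp

section \<open>Convolutions over a bilinear product and their weighted bounds\<close>

definition conv :: "('a \<Rightarrow> 'b \<Rightarrow> 'c::banach) \<Rightarrow> ('g::ab_group_add \<Rightarrow> 'a) \<Rightarrow> ('g \<Rightarrow> 'b) \<Rightarrow> 'g \<Rightarrow> 'c" where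
  "conv \<beta> f g n = (\<Sum>\<^sub>\<infinity>m. \<beta> (f m) (g (n - m)))"

abbreviation rconv :: "('g::ab_group_add \<Rightarrow> real) \<Rightarrow> ('g \<Rightarrow> real) \<Rightarrow> 'g \<Rightarrow> real" where
  "rconv \<equiv> conv (*)"

lemma has_sum_finite_sum:
  fixes f :: "'b \<Rightarrow> 'a \<Rightarrow> 'c :: topological_comm_monoid_add"
  assumes "finite B" "\<And>b. b \<in> B \<Longrightarrow> (f b has_sum s b) A"
  shows "((\<lambda>x. \<Sum>b\<in>B. f b x) has_sum (\<Sum>b\<in>B. s b)) A"
  using assms by (induction B rule: finite_induct) (auto intro: has_sum_add)

lemma infsum_minus:
  fixes f :: "'a \<Rightarrow> 'b :: real_normed_vector"
  assumes "f summable_on A" "g summable_on A"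
  shows "(\<Sum>\<^sub>\<infinity>x\<in>A. f x - g x) = infsum f A - infsum g A"
proof -
  have "((\<lambda>x. f x + - g x) has_sum (infsum f A + - infsum g A)) A"
    using assms by (intro has_sum_add) (auto simp: has_sum_uminus)
  then show ?thesis by (simp add: infsumI)
qed

lemma rconv_summable:
  assumes "sum_bd a S" "sum_bd b S'"
  shows "(\<lambda>m. a m * b (n - m)) summable_on UNIV"
proof (rule summable_on_comparison_test[where f = "\<lambda>m. a m * S'"])
  show "(\<lambda>m. a m * S') summable_on UNIV"
    by (intro summable_on_cmult_left sum_bd_summable[OF assms(1)])
qed (use wsum_bd_nonneg[OF assms(1)] wsum_bd_nonneg[OF assms(2)] sum_bd_point[OF assms(2)] in \<open>auto intro!: mult_left_mono mult_nonneg_nonneg\<close>)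

lemma rconv_nonneg: "(\<And>n. 0 \<le> a n) \<Longrightarrow> (\<And>n. 0 \<le> b n) \<Longrightarrow> 0 \<le> rconv a b n"
  unfolding conv_def by (intro infsum_nonneg) auto

text \<open>Interchange the two sums and distribute the weight by w(m + k) <= C w(m) w(k): the
  weighted l^1 space is an algebra up to the factor C.\<close>

lemma rconv_wsum_bd:
  fixes w :: "'g::ab_group_add \<Rightarrow> real"
  assumes w: "\<And>n. 0 \<le> w n" "\<And>m k. w (m + k) \<le> C * (w m * w k)" "0 \<le> C"
    and a: "wsum_bd w a S" "sum_bd a S1" and b: "wsum_bd w b S'" "sum_bd b S1'"
  shows "wsum_bd w (rconv a b) (C * (S * S'))"
  unfolding wsum_bd_def
proof (intro conjI allI impI)
  note a0 = wsum_bd_nonneg[OF a(1)] and b0 = wsum_bd_nonneg[OF b(1)]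
  show "0 \<le> rconv a b n" for n using a0 b0 by (rule rconv_nonneg)
  fix A :: "'g set" assume A: "finite A"
  have hs: "((\<lambda>m. \<Sum>n\<in>A. w n * (a m * b (n - m))) has_sum (\<Sum>n\<in>A. w n * rconv a b n)) UNIV"
    unfolding conv_def
    by (intro has_sum_finite_sum A has_sum_cmult_right has_sum_infsum rconv_summable[OF a(2) b(2)])
  then have "(\<Sum>n\<in>A. w n * rconv a b n) = (\<Sum>\<^sub>\<infinity>m. \<Sum>n\<in>A. w n * (a m * b (n - m)))"
    by (simp add: infsumI)
  also have "\<dots> \<le> C * (S * S')"
  proof (rule infsum_le_finite_sums)
    show "(\<lambda>m. \<Sum>n\<in>A. w n * (a m * b (n - m))) summable_on UNIV"
      using hs by (rule has_sum_imp_summable)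
    fix M :: "'g set" assume M: "finite M"
    have "(\<Sum>n\<in>A. w n * (a m * b (n - m))) \<le> C * S' * (w m * a m)" for m
    proof -
      have "(\<Sum>n\<in>A. w n * (a m * b (n - m))) \<le> (\<Sum>n\<in>A. C * (w m * a m) * (w (n - m) * b (n - m)))"
      proof (rule sum_mono)
        fix n
        have "w n * (a m * b (n - m)) \<le> C * (w m * w (n - m)) * (a m * b (n - m))"
          using w(2)[of m "n - m"] a0 b0 by (intro mult_right_mono) auto
        then show "w n * (a m * b (n - m)) \<le> C * (w m * a m) * (w (n - m) * b (n - m))"
          by (simp add: mult_ac)
      qed
      also have "\<dots> = C * (w m * a m) * (\<Sum>k\<in>(\<lambda>n. n - m) ` A. w k * b k)"
        by (subst sum.reindex) (auto simp: inj_on_def sum_distrib_left)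
      also have "\<dots> \<le> C * (w m * a m) * S'"
        using A w a0 b by (intro mult_left_mono wsum_bd_sum[OF b(1)] mult_nonneg_nonneg) auto
      finally show ?thesis by (simp add: mult_ac)
    qed
    then have "(\<Sum>m\<in>M. \<Sum>n\<in>A. w n * (a m * b (n - m))) \<le> (\<Sum>m\<in>M. C * S' * (w m * a m))"
      by (intro sum_mono) auto
    also have "\<dots> \<le> C * S' * S"
      unfolding sum_distrib_left[symmetric]
      using M w wsum_bd_bound_nonneg[OF b(1)] by (intro mult_left_mono wsum_bd_sum[OF a(1)]) auto
    finally show "(\<Sum>m\<in>M. \<Sum>n\<in>A. w n * (a m * b (n - m))) \<le> C * (S * S')"
      by (simp add: mult_ac)
  qed
  finally show "(\<Sum>n\<in>A. w n * rconv a b n) \<le> C * (S * S')" .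
qed

lemma rconv_sum_bd: "sum_bd a S \<Longrightarrow> sum_bd b S' \<Longrightarrow> sum_bd (rconv a b) (S * S')"
  using rconv_wsum_bd[of "\<lambda>_. 1" 1 a S S b S' S'] by simp

lemma infsum_reflect: "(\<Sum>\<^sub>\<infinity>m. b (n - m :: 'g::ab_group_add)) = (\<Sum>\<^sub>\<infinity>m. (b m :: 'a :: {comm_monoid_add, t2_space}))"
  by (rule infsum_reindex_bij_witness[of _ "\<lambda>m. n - m" "\<lambda>m. n - m"]) auto

lemma summable_reflect: "(\<lambda>m. b (n - m :: 'g::ab_group_add)) summable_on UNIV \<longleftrightarrow> (b :: _ \<Rightarrow> 'a :: {comm_monoid_add, t2_space}) summable_on UNIV"
  by (rule summable_on_reindex_bij_witness[of _ "\<lambda>m. n - m" "\<lambda>m. n - m"]) auto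

text \<open>The weight falls on one factor at a time, so each term pairs one sup bound with one l^1
  bound. No product of two sup bounds occurs, which keeps later estimates linear in the sup
  norm.\<close>

lemma rconv_sup:
  fixes w :: "'g::ab_group_add \<Rightarrow> real"
  assumes w: "\<And>n. 0 \<le> w n" "\<And>m k. w (m + k) \<le> D * (w m + w k)" "0 \<le> D"
    and a: "sum_bd a S" "\<And>n. w n * a n \<le> A" and b: "sum_bd b S'" "\<And>n. w n * b n \<le> B"
  shows "w n * rconv a b n \<le> D * (A * S' + B * S)"
proof -
  note a0 = wsum_bd_nonneg[OF a(1)] and b0 = wsum_bd_nonneg[OF b(1)]
  have A0: "0 \<le> A" using a(2)[of 0] w(1) a0 by (meson mult_nonneg_nonneg order_trans)
  have B0: "0 \<le> B" using b(2)[of 0] w(1) b0 by (meson mult_nonneg_nonneg order_trans)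
  have sa: "a summable_on UNIV" and sb: "(\<lambda>m. b (n - m)) summable_on UNIV"
    using sum_bd_summable[OF a(1)] sum_bd_summable[OF b(1)] by (simp_all add: summable_reflect)
  have "w n * rconv a b n = (\<Sum>\<^sub>\<infinity>m. w n * (a m * b (n - m)))"
    unfolding conv_def by (intro infsum_cmult_right[symmetric] rconv_summable[OF a(1) b(1)])
  also have "\<dots> \<le> (\<Sum>\<^sub>\<infinity>m. D * A * b (n - m) + D * B * a m)"
  proof (rule infsum_mono)
    show "(\<lambda>m. w n * (a m * b (n - m))) summable_on UNIV"
      by (intro summable_on_cmult_right rconv_summable[OF a(1) b(1)])
    show "(\<lambda>m. D * A * b (n - m) + D * B * a m) summable_on UNIV"
      by (intro summable_on_add summable_on_cmult_right sa sb)
    fix m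
    have "w n * (a m * b (n - m)) \<le> D * (w m + w (n - m)) * (a m * b (n - m))"
      using w(2)[of m "n - m"] a0 b0 by (intro mult_right_mono) auto
    also have "\<dots> = D * ((w m * a m) * b (n - m) + (w (n - m) * b (n - m)) * a m)"
      by (simp add: algebra_simps)
    also have "\<dots> \<le> D * (A * b (n - m) + B * a m)"
      using a b a0 b0 w by (intro mult_left_mono add_mono mult_right_mono) auto
    finally show "w n * (a m * b (n - m)) \<le> D * A * b (n - m) + D * B * a m"
      by (simp add: algebra_simps)
  qed
  also have "\<dots> = D * A * (\<Sum>\<^sub>\<infinity>m. b m) + D * B * (\<Sum>\<^sub>\<infinity>m. a m)"
    using sa sb by (simp add: infsum_add infsum_cmult_right summable_on_cmult_right infsum_reflect)
  also have "\<dots> \<le> D * A * S' + D * B * S"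
    using sum_bd_infsum[OF a(1)] sum_bd_infsum[OF b(1)] A0 B0 w by (intro add_mono mult_left_mono) auto
  finally show ?thesis by (simp add: algebra_simps)
qed

lemma rconv_mono:
  assumes "sum_bd a S" "sum_bd b S'" "sum_bd a' R" "sum_bd b' R'" "\<And>n. a n \<le> a' n" "\<And>n. b n \<le> b' n"
  shows "rconv a b n \<le> rconv a' b' n"
  unfolding conv_def
  using wsum_bd_nonneg[OF assms(1)] wsum_bd_nonneg[OF assms(2)] wsum_bd_nonneg[OF assms(3)] assms
  by (intro infsum_mono rconv_summable mult_mono) auto

lemma sum_bd_diff:
  assumes "sum_bd (\<lambda>n. norm (x n :: 'd::real_normed_vector)) X" "sum_bd (\<lambda>n. norm (y n)) Y"
  shows "sum_bd (\<lambda>n. norm (x n - y n)) (X + Y)"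
  by (rule wsum_bd_mono[OF wsum_bd_add[OF assms]]) (auto intro: norm_triangle_ineq4)

text \<open>The constant is a parameter because the conditions on the existence time are written
  with it.\<close>

locale bbound = bounded_bilinear prod
  for prod :: "'a::real_normed_vector \<Rightarrow> 'b::real_normed_vector \<Rightarrow> 'c::banach" +
  fixes K :: real
  assumes K: "norm (prod x y) \<le> K * (norm x * norm y)" and K_nonneg: "0 \<le> K"
begin

lemma conv_summable:
  fixes f :: "'g::ab_group_add \<Rightarrow> 'a"
  assumes "sum_bd a S" "sum_bd b S'" "\<And>n. norm (f n) \<le> a n" "\<And>n. norm (g n) \<le> b n"
  shows "(\<lambda>m. norm (prod (f m) (g (n - m)))) summable_on UNIV"
    "(\<lambda>m. prod (f m) (g (n - m))) summable_on UNIV"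
    "norm (conv prod f g n) \<le> K * rconv a b n"
proof -
  have s: "(\<lambda>m. K * (a m * b (n - m))) summable_on UNIV"
    by (intro summable_on_cmult_right rconv_summable[OF assms(1,2)])
  have le: "norm (prod (f m) (g (n - m))) \<le> K * (a m * b (n - m))" for m
  proof -
    have "norm (prod (f m) (g (n - m))) \<le> K * (norm (f m) * norm (g (n - m)))" by (rule K)
    also have "\<dots> \<le> K * (a m * b (n - m))"
      using assms(3)[of m] assms(4)[of "n - m"] K_nonneg wsum_bd_nonneg[OF assms(1)] by (intro mult_left_mono mult_mono) auto
    finally show ?thesis .
  qed
  show 1: "(\<lambda>m. norm (prod (f m) (g (n - m)))) summable_on UNIV"
    by (rule Infinite_Sum.abs_summable_on_comparison_test'[OF s]) (rule le)
  then show "(\<lambda>m. prod (f m) (g (n - m))) summable_on UNIV"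
    by (rule abs_summable_summable)
  have "norm (conv prod f g n) \<le> (\<Sum>\<^sub>\<infinity>m. norm (prod (f m) (g (n - m))))"
    unfolding conv_def by (rule norm_infsum_bound) (rule 1)
  also have "\<dots> \<le> (\<Sum>\<^sub>\<infinity>m. K * (a m * b (n - m)))"
    by (rule infsum_mono[OF 1 s]) (rule le)
  also have "\<dots> = K * rconv a b n"
    unfolding conv_def by (rule infsum_cmult_right[OF rconv_summable[OF assms(1,2)]])
  finally show "norm (conv prod f g n) \<le> K * rconv a b n" .
qed

lemma conv_sum_bd:
  fixes f :: "'g::ab_group_add \<Rightarrow> 'a"
  assumes "sum_bd (\<lambda>n. norm (f n)) S" "sum_bd (\<lambda>n. norm (g n)) S'"
  shows "sum_bd (\<lambda>n. norm (conv prod f g n)) (K * (S * S'))"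
  by (rule wsum_bd_mono[OF wsum_bd_cmult[OF rconv_sum_bd[OF assms] K_nonneg]])
     (use conv_summable(3)[OF assms] in auto)

lemma conv_diff:
  fixes x :: "'g::ab_group_add \<Rightarrow> 'a"
  assumes "sum_bd (\<lambda>n. norm (x n)) X" "sum_bd (\<lambda>n. norm (y n)) Y"
    "sum_bd (\<lambda>n. norm (x' n)) X'" "sum_bd (\<lambda>n. norm (y' n)) Y'"
  shows "conv prod x x' n - conv prod y y' n =
    conv prod (\<lambda>m. x m - y m) x' n + conv prod y (\<lambda>m. x' m - y' m) n"
proof -
  note s = conv_summable(2)[OF _ _ order.refl order.refl]
  note s1 = s[OF assms(1,3)] and s2 = s[OF assms(2,4)] and s3 = s[OF assms(2,3)]
  have "conv prod (\<lambda>m. x m - y m) x' n = conv prod x x' n - conv prod y x' n"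
    unfolding conv_def diff_left by (rule infsum_minus[OF s1 s3])
  moreover have "conv prod y (\<lambda>m. x' m - y' m) n = conv prod y x' n - conv prod y y' n"
    unfolding conv_def diff_right by (rule infsum_minus[OF s3 s2])
  ultimately show ?thesis by simp
qed

lemma conv_diff_sum_bd:
  fixes x :: "'g::ab_group_add \<Rightarrow> 'a"
  assumes "sum_bd (\<lambda>n. norm (x n)) X" "sum_bd (\<lambda>n. norm (y n)) Y"
    "sum_bd (\<lambda>n. norm (x' n)) X'" "sum_bd (\<lambda>n. norm (y' n)) Y'"
    "sum_bd (\<lambda>n. norm (x n - y n)) D" "sum_bd (\<lambda>n. norm (x' n - y' n)) D'"
  shows "sum_bd (\<lambda>n. norm (conv prod x x' n - conv prod y y' n)) (K * (D * X') + K * (Y * D'))"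
  by (rule wsum_bd_mono[OF wsum_bd_add[OF conv_sum_bd[OF assms(5,3)] conv_sum_bd[OF assms(2,6)]]])
     (auto simp: conv_diff[OF assms(1-4)] intro: norm_triangle_ineq)

text \<open>The increments a - a' and b - b' dominate the differences. Both the vector convolution
  and the real one telescope into the same two terms, so domination by increments is
  inherited.\<close>

lemma conv_diff_major:
  fixes x :: "'g::ab_group_add \<Rightarrow> 'a"
  assumes b: "sum_bd a A" "sum_bd a' A'" "sum_bd b B" "sum_bd b' B'"
    and y: "\<And>n. norm (y n) \<le> a' n" "\<And>n. norm (y' n) \<le> b' n"
    and d: "\<And>n. norm (x n - y n) \<le> a n - a' n" "\<And>n. norm (x' n - y' n) \<le> b n - b' n"
  shows "norm (conv prod x x' n - conv prod y y' n) \<le> K * (rconv a b n - rconv a' b' n)"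
proof -
  have x: "norm (x n) \<le> a n" "norm (x' n) \<le> b n" for n
    using norm_triangle_ineq[of "x n - y n" "y n"] norm_triangle_ineq[of "x' n - y' n" "y' n"] y[of n] d[of n] by auto
  have bd': "sum_bd (\<lambda>n. a n - a' n) A" "sum_bd (\<lambda>n. b n - b' n) B"
    using wsum_bd_nonneg[OF b(2)] wsum_bd_nonneg[OF b(4)] order_trans[OF norm_ge_zero d(1)] order_trans[OF norm_ge_zero d(2)]
    by (intro wsum_bd_mono[OF b(1)] wsum_bd_mono[OF b(3)]; simp)+
  note bm = wsum_bd_mono[OF _ _ _ _ order.refl]
  have bx: "sum_bd (\<lambda>n. norm (x n)) A" "sum_bd (\<lambda>n. norm (y n)) A'" "sum_bd (\<lambda>n. norm (x' n)) B" "sum_bd (\<lambda>n. norm (y' n)) B'"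
    using x y by (auto intro!: bm[OF b(1)] bm[OF b(2)] bm[OF b(3)] bm[OF b(4)])
  have "norm (conv prod x x' n - conv prod y y' n) \<le>
      norm (conv prod (\<lambda>m. x m - y m) x' n) + norm (conv prod y (\<lambda>m. x' m - y' m) n)"
    unfolding conv_diff[OF bx] by (rule norm_triangle_ineq)
  also have "\<dots> \<le> K * rconv (\<lambda>n. a n - a' n) b n + K * rconv a' (\<lambda>n. b n - b' n) n"
    by (intro add_mono conv_summable(3)[OF bd'(1) b(3)] conv_summable(3)[OF b(2) bd'(2)] d x y)
  also have "\<dots> = K * (rconv a b n - rconv a' b' n)"
  proof -
    note s = rconv_summable[where n = n]
    have "rconv (\<lambda>n. a n - a' n) b n = rconv a b n - rconv a' b n"
      unfolding conv_def left_diff_distrib by (rule infsum_minus[OF s[OF b(1,3)] s[OF b(2,3)]])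
    moreover have "rconv a' (\<lambda>n. b n - b' n) n = rconv a' b n - rconv a' b' n"
      unfolding conv_def right_diff_distrib by (rule infsum_minus[OF s[OF b(2,3)] s[OF b(2,4)]])
    ultimately have "rconv (\<lambda>n. a n - a' n) b n + rconv a' (\<lambda>n. b n - b' n) n = rconv a b n - rconv a' b' n"
      by simp
    then show ?thesis by (simp flip: distrib_left)
  qed
  finally show ?thesis .
qed

lemma conv_tendsto:
  fixes f :: "'x \<Rightarrow> 'g::ab_group_add \<Rightarrow> 'a"
  assumes ab: "sum_bd a A" "sum_bd b B"
    and dom: "\<forall>\<^sub>F x in F. \<forall>n. norm (f x n) \<le> a n \<and> norm (g x n) \<le> b n"
    and lim: "\<And>n. ((\<lambda>x. f x n) \<longlongrightarrow> f0 n) F" "\<And>n. ((\<lambda>x. g x n) \<longlongrightarrow> g0 n) F"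
  shows "((\<lambda>x. conv prod (f x) (g x) n) \<longlongrightarrow> conv prod f0 g0 n) F"
  unfolding conv_def
proof (rule tendsto_infsum_dominated[where M = "\<lambda>m. K * (a m * b (n - m))"])
  show "((\<lambda>x. prod (f x m) (g x (n - m))) \<longlongrightarrow> prod (f0 m) (g0 (n - m))) F" for m
    by (intro tendsto lim)
  show "(\<lambda>m. K * (a m * b (n - m))) summable_on UNIV"
    by (intro summable_on_cmult_right rconv_summable[OF ab])
  show "\<forall>\<^sub>F x in F. \<forall>m. norm (prod (f x m) (g x (n - m))) \<le> K * (a m * b (n - m))"
    using dom
  proof eventually_elim
    case (elim x)
    show ?case
    proof
      fix m
      have "norm (prod (f x m) (g x (n - m))) \<le> K * (norm (f x m) * norm (g x (n - m)))" by (rule K)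
      also have "\<dots> \<le> K * (a m * b (n - m))"
        using elim K_nonneg wsum_bd_nonneg[OF ab(1)] by (intro mult_left_mono mult_mono) auto
      finally show "norm (prod (f x m) (g x (n - m))) \<le> K * (a m * b (n - m))" .
    qed
  qed
qed

end

lemma bbound_mult: "bbound ((*) :: real \<Rightarrow> real \<Rightarrow> real) 1"
  by unfold_locales (auto simp: algebra_simps abs_mult intro!: exI[of _ 1])

section \<open>Mild equations with a quadratic and cubic forcing\<close>

text \<open>The origin of every factor 2 * c * sqrt t below. At s = t the integrand has the default
  value 0 of a division by zero; the derivative is required only in the open interval.\<close>

lemma inverse_sqrt_integral:
  assumes "a \<le> (t::real)"
  shows "((\<lambda>s. k / sqrt (t - s)) has_integral (2 * k * sqrt (t - a))) {a..t}"
proof -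
  have "((\<lambda>s. k / sqrt (t - s)) has_integral (- 2 * k * sqrt (t - t) - (- 2 * k * sqrt (t - a)))) {a..t}"
  proof (rule fundamental_theorem_of_calculus_interior[OF assms])
    show "continuous_on {a..t} (\<lambda>s. - 2 * k * sqrt (t - s))" by (intro continuous_intros)
    show "((\<lambda>s. - 2 * k * sqrt (t - s)) has_vector_derivative k / sqrt (t - s)) (at s)" if "s \<in> {a<..<t}" for s
      unfolding has_real_derivative_iff_has_vector_derivative[symmetric]
      using that by (auto intro!: derivative_eq_intros simp: divide_simps)
  qed
  then show ?thesis by simp
qed

text \<open>The abstract equation is u = L + integral of Ker applied to P(u,u) + R(P(u,u),u).
  \<open>R\<close> takes a value of \<open>P\<close> as first argument because the cubic term of the
  system is (v x B) x B. The singularity c / sqrt \<tau> is the cost of one derivative on the heat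
  kernel.\<close>

locale mild =
  P: bbound P KP + R: bbound R KR
  for P :: "'v::banach \<Rightarrow> 'v \<Rightarrow> 'w::banach" and KP :: real
    and R :: "'w \<Rightarrow> 'v \<Rightarrow> 'w" and KR :: real +
  fixes Ker :: "real \<Rightarrow> 'g::ab_group_add \<Rightarrow> 'w \<Rightarrow> 'v" and c :: real
  assumes Ker_linear: "linear (Ker \<tau> n)"
    and Ker_cont: "continuous_on ({0..} \<times> UNIV) (\<lambda>(\<tau>, y). Ker \<tau> n y)"
    and Ker_bound: "0 < \<tau> \<Longrightarrow> \<tau> \<le> 1 \<Longrightarrow> norm (Ker \<tau> n y) \<le> c / sqrt \<tau> * norm y"
    and c_nonneg: "0 \<le> c"
begin

section \<open>The Duhamel integral: bounds and continuity in time\<close>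

definition forcing :: "('g \<Rightarrow> 'v) \<Rightarrow> 'g \<Rightarrow> 'w" where
  "forcing u n = conv P u u n + conv R (conv P u u) u n"

definition duhamel :: "(real \<Rightarrow> 'g \<Rightarrow> 'w) \<Rightarrow> real \<Rightarrow> 'g \<Rightarrow> 'v" where
  "duhamel f t n = integral {0..t} (\<lambda>s. Ker (t - s) n (f s n))"

lemma Ker_cont_comp:
  assumes "continuous_on S \<tau>" "continuous_on S f" "\<And>s. s \<in> S \<Longrightarrow> 0 \<le> \<tau> s"
  shows "continuous_on S (\<lambda>s. Ker (\<tau> s) n (f s))"
  using continuous_on_compose2[OF Ker_cont[of n], of S "\<lambda>s. (\<tau> s, f s)"] assms
  by (auto intro: continuous_intros)

lemma duhamel_integrand_cont:
  assumes "continuous_on {0..t} (\<lambda>s. f s n)"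
  shows "continuous_on {0..t} (\<lambda>s. Ker (t - s) n (f s n))"
  by (intro Ker_cont_comp continuous_intros assms) auto

lemma duhamel_diff:
  assumes "continuous_on {0..t} (\<lambda>s. f s n)" "continuous_on {0..t} (\<lambda>s. g s n)"
  shows "duhamel f t n - duhamel g t n = duhamel (\<lambda>s n. f s n - g s n) t n"
  unfolding duhamel_def linear_diff[OF Ker_linear]
  by (rule integral_diff[symmetric]; rule integrable_continuous_real; intro duhamel_integrand_cont assms)

text \<open>If the forcing vanishes before time a, the gain is sqrt (t - a) rather than sqrt t,
  which lets uniqueness advance in short steps. Finite sets of frequencies serve the l^1 estimate,
  singletons the pointwise one.\<close>

lemma duhamel_sum_bound:
  assumes t: "0 \<le> a" "a \<le> t" "t \<le> 1" and A: "finite A"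
    and cont: "\<And>n. n \<in> A \<Longrightarrow> continuous_on {0..t} (\<lambda>s. f s n)"
    and zero: "\<And>s n. s \<in> {0..<a} \<Longrightarrow> n \<in> A \<Longrightarrow> f s n = 0"
    and M: "\<And>s. s \<in> {a..t} \<Longrightarrow> (\<Sum>n\<in>A. norm (f s n)) \<le> M"
  shows "(\<Sum>n\<in>A. norm (duhamel f t n)) \<le> 2 * c * sqrt (t - a) * M"
proof -
  define q where "q s = (\<Sum>n\<in>A. norm (Ker (t - s) n (f s n)))" for s
  have qc1: "continuous_on {0..t} (\<lambda>s. norm (Ker (t - s) n (f s n)))" if "n \<in> A" for n
    using that by (intro continuous_on_norm duhamel_integrand_cont cont)
  have qc: "continuous_on {0..t} q"
    unfolding q_def by (intro continuous_on_sum qc1)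
  have "(\<Sum>n\<in>A. norm (duhamel f t n)) \<le> (\<Sum>n\<in>A. integral {0..t} (\<lambda>s. norm (Ker (t - s) n (f s n))))"
    unfolding duhamel_def
    by (intro sum_mono integral_norm_bound_integral integrable_continuous_real qc1 duhamel_integrand_cont cont) auto
  also have "\<dots> = integral {0..t} q"
    unfolding q_def by (rule integral_sum[symmetric]) (auto intro!: integrable_continuous_real qc1 A)
  also have "\<dots> = integral {0..a} q + integral {a..t} q"
    using t by (intro Henstock_Kurzweil_Integration.integral_combine[symmetric] integrable_continuous_real qc)
  \<comment> \<open>The forcing is zero only on the half-open interval, so the endpoint a is
    discarded as a null set.\<close>
  also have "integral {0..a} q = integral {0..a} (\<lambda>_. 0)"
    by (rule integral_spike[of "{a}"]) (auto simp: q_def zero linear_0[OF Ker_linear])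
  also have "integral {a..t} q \<le> 2 * (c * M) * sqrt (t - a)"
  proof (rule has_integral_le)
    show "(q has_integral integral {a..t} q) {a..t}"
      using t by (intro integrable_integral integrable_continuous_real continuous_on_subset[OF qc]) auto
    let ?h = "\<lambda>s. if s = t then q t else c * M / sqrt (t - s)"
    show "(?h has_integral 2 * (c * M) * sqrt (t - a)) {a..t}"
      by (rule has_integral_spike_finite[OF _ _ inverse_sqrt_integral[OF t(2)], of "{t}"]) auto
    show "q s \<le> ?h s" if s: "s \<in> {a..t}" for s
    proof (cases "s = t")
      case False
      then have "q s \<le> (\<Sum>n\<in>A. c / sqrt (t - s) * norm (f s n))"
        unfolding q_def using s t by (intro sum_mono Ker_bound) auto
      also have "\<dots> = c / sqrt (t - s) * (\<Sum>n\<in>A. norm (f s n))"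
        by (simp add: sum_distrib_left)
      also have "\<dots> \<le> c / sqrt (t - s) * M"
        using s c_nonneg by (intro mult_left_mono M) auto
      finally show ?thesis using False by simp
    qed simp
  qed
  finally show ?thesis by (simp add: mult_ac)
qed

lemma duhamel_bound:
  assumes t: "0 \<le> t" "t \<le> 1" and cont: "continuous_on {0..t} (\<lambda>s. f s n)"
    and M: "\<And>s. s \<in> {0..t} \<Longrightarrow> norm (f s n) \<le> M"
  shows "norm (duhamel f t n) \<le> 2 * c * sqrt t * M"
  using duhamel_sum_bound[of 0 t "{n}" f M] assms by simp

text \<open>Rescaling the integral to the unit interval makes the continuity in \<open>t\<close> immediate.\<close>

lemma duhamel_rescale:
  assumes "0 \<le> t" "continuous_on {0..t} (\<lambda>s. f s n)"
  shows "duhamel f t n = t *\<^sub>R integral {0..1} (\<lambda>\<sigma>. Ker (t - t * \<sigma>) n (f (t * \<sigma>) n))"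
proof (cases "t = 0")
  case False
  then have t: "t > 0" using assms by simp
  have "((\<lambda>s. Ker (t - s) n (f s n)) has_integral duhamel f t n) (cbox 0 t)"
    unfolding duhamel_def using integrable_integral[OF integrable_continuous_real[OF duhamel_integrand_cont[of t f n, OF assms(2)]]] by simp
  from has_integral_affinity'[OF this t, of 0]
  have "((\<lambda>\<sigma>. Ker (t - t * \<sigma>) n (f (t * \<sigma>) n)) has_integral (duhamel f t n /\<^sub>R t)) {0..1}"
    using t by simp
  then show ?thesis using t by (simp add: integral_unique)
qed (simp add: duhamel_def)

lemma duhamel_cont:
  assumes T: "0 \<le> T" and cont: "continuous_on {0..T} (\<lambda>s. f s n)"
  shows "continuous_on {0..T} (\<lambda>t. duhamel f t n)"
proof -
  have "continuous_on {0..T} (\<lambda>t. t *\<^sub>R integral (cbox 0 1) (\<lambda>\<sigma>. Ker (t - t * \<sigma>) n (f (t * \<sigma>) n)))"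
  proof (intro continuous_intros integral_continuous_on_param)
    have *: "t * \<sigma> \<in> {0..T}" "t * \<sigma> \<le> t" if "t \<in> {0..T}" "\<sigma> \<in> {0..1}" for t \<sigma>
    proof -
      show "t * \<sigma> \<le> t" using that by (simp add: mult_left_le)
      then show "t * \<sigma> \<in> {0..T}" using that by auto
    qed
    show "continuous_on ({0..T} \<times> cbox 0 1) (\<lambda>(t, \<sigma>). Ker (t - t * \<sigma>) n (f (t * \<sigma>) n))"
      unfolding split_beta
    proof (intro Ker_cont_comp)
      show "continuous_on ({0..T} \<times> cbox 0 1) (\<lambda>p. f (fst p * snd p) n)"
        by (rule continuous_on_compose2[OF cont]) (use * in \<open>auto intro!: continuous_intros\<close>)
    qed (use * in \<open>auto intro!: continuous_intros\<close>)
  qed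
  then show ?thesis
  proof (rule continuous_on_eq)
    fix t assume "t \<in> {0..T}"
    then show "t *\<^sub>R integral (cbox 0 1) (\<lambda>\<sigma>. Ker (t - t * \<sigma>) n (f (t * \<sigma>) n)) = duhamel f t n"
      by (subst duhamel_rescale) (auto intro: continuous_on_subset[OF cont])
  qed
qed

section \<open>Lipschitz bounds for the forcing and uniqueness\<close>

definition Lip :: "real \<Rightarrow> real" where
  "Lip \<rho> = 2 * KP * \<rho> + 3 * KR * KP * \<rho>\<^sup>2"

text \<open>A product of degree d telescopes into d differences, hence the factors 2 and 3 in
  \<open>Lip\<close>; the cubic part uses the quadratic difference as one of its inputs.\<close>

lemma forcing_lipschitz:
  assumes x: "sum_bd (\<lambda>n. norm (x n)) \<rho>" and y: "sum_bd (\<lambda>n. norm (y n)) \<rho>" and d: "sum_bd (\<lambda>n. norm (x n - y n)) D"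
  shows "sum_bd (\<lambda>n. norm (forcing x n - forcing y n)) (Lip \<rho> * D)"
proof -
  note 1 = P.conv_diff_sum_bd[OF x y x y d d]
  note 2 = R.conv_diff_sum_bd[OF P.conv_sum_bd[OF x x] P.conv_sum_bd[OF y y] x y 1 d]
  show ?thesis
    by (rule wsum_bd_mono[OF wsum_bd_add[OF 1 2]])
       (auto simp: forcing_def Lip_def algebra_simps power2_eq_square intro: order_trans[OF _ norm_triangle_ineq])
qed

lemma Lip_nonneg: "0 \<le> \<rho> \<Longrightarrow> 0 \<le> Lip \<rho>"
  unfolding Lip_def using P.K_nonneg R.K_nonneg by auto

text \<open>Meant for an arbitrary solution, where continuity in l^1 is known but no common majorant
  of the coefficients is.\<close>

lemma forcing_cont_of_l1_cont:
  assumes b: "\<And>t. t \<in> S \<Longrightarrow> sum_bd (\<lambda>n. norm (u t n)) \<rho>"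
    and cont: "\<And>t0. t0 \<in> S \<Longrightarrow> ((\<lambda>t. \<Sum>\<^sub>\<infinity>n. norm (u t n - u t0 n)) \<longlongrightarrow> 0) (at t0 within S)"
  shows "continuous_on S (\<lambda>s. forcing (u s) n)"
  unfolding continuous_on_def
proof
  fix t0 assume t0: "t0 \<in> S"
  have "((\<lambda>t. Lip \<rho> * (\<Sum>\<^sub>\<infinity>n. norm (u t n - u t0 n))) \<longlongrightarrow> Lip \<rho> * 0) (at t0 within S)"
    by (intro tendsto_intros cont t0)
  then have "((\<lambda>t. forcing (u t) n - forcing (u t0) n) \<longlongrightarrow> 0) (at t0 within S)"
  proof (rule Lim_null_comparison[rotated, OF tendsto_eq_rhs])
    show "\<forall>\<^sub>F t in at t0 within S. norm (forcing (u t) n - forcing (u t0) n) \<le> Lip \<rho> * (\<Sum>\<^sub>\<infinity>n. norm (u t n - u t0 n))"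
      unfolding eventually_at_filter
    proof (rule always_eventually, intro allI impI)
      fix t assume t: "t \<noteq> t0" "t \<in> S"
      have "sum_bd (\<lambda>n. norm (u t n - u t0 n)) (\<Sum>\<^sub>\<infinity>n. norm (u t n - u t0 n))"
        by (rule summable_sum_bd[OF sum_bd_summable[OF sum_bd_diff[OF b b]]]) (use t t0 in auto)
      from forcing_lipschitz[OF b b this] t t0
      show "norm (forcing (u t) n - forcing (u t0) n) \<le> Lip \<rho> * (\<Sum>\<^sub>\<infinity>n. norm (u t n - u t0 n))"
        by (auto intro: sum_bd_point)
    qed
  qed simp
  then show "((\<lambda>s. forcing (u s) n) \<longlongrightarrow> forcing (u t0) n) (at t0 within S)"
    by (simp add: LIM_zero_iff)
qed

text \<open>By the reverse triangle inequality the l^1 norm is continuous in t, so it is bounded on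
  the compact interval.\<close>

lemma l1_cont_bounded:
  fixes T :: real
  assumes s: "\<And>t. t \<in> {0..T} \<Longrightarrow> (\<lambda>n. norm (u t n)) summable_on UNIV"
    and cont: "\<And>t0. t0 \<in> {0..T} \<Longrightarrow> ((\<lambda>t. \<Sum>\<^sub>\<infinity>n. norm (u t n - u t0 n)) \<longlongrightarrow> 0) (at t0 within {0..T})"
  obtains \<rho> where "\<And>t. t \<in> {0..T} \<Longrightarrow> sum_bd (\<lambda>n. norm (u t n :: 'v)) \<rho>"
proof -
  define N where "N t = (\<Sum>\<^sub>\<infinity>n. norm (u t n))" for t
  have bN: "sum_bd (\<lambda>n. norm (u t n)) (N t)" if "t \<in> {0..T}" for t
    unfolding N_def by (rule summable_sum_bd[OF s[OF that]]) simp
  have "continuous_on {0..T} N"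
    unfolding continuous_on_def
  proof
    fix t0 assume t0: "t0 \<in> {0..T}"
    have "((\<lambda>t. N t - N t0) \<longlongrightarrow> 0) (at t0 within {0..T})"
    proof (rule Lim_null_comparison[OF _ cont[OF t0]])
      show "\<forall>\<^sub>F t in at t0 within {0..T}. norm (N t - N t0) \<le> (\<Sum>\<^sub>\<infinity>n. norm (u t n - u t0 n))"
        unfolding eventually_at_filter
      proof (rule always_eventually, intro allI impI)
        fix t assume t: "t \<noteq> t0" "t \<in> {0..T}"
        have d: "(\<lambda>n. norm (u t n - u t0 n)) summable_on UNIV"
          by (rule sum_bd_summable[OF sum_bd_diff[OF bN bN]]) (use t t0 in auto)
        have "N t - N t0 = (\<Sum>\<^sub>\<infinity>n. norm (u t n) - norm (u t0 n))"
          unfolding N_def by (rule infsum_minus[symmetric]) (use s t t0 in auto)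
        moreover have "norm (\<Sum>\<^sub>\<infinity>n. norm (u t n) - norm (u t0 n)) \<le> (\<Sum>\<^sub>\<infinity>n. norm (u t n - u t0 n))"
        proof (rule norm_infsum_le)
          show "((\<lambda>n. norm (u t n) - norm (u t0 n)) has_sum (\<Sum>\<^sub>\<infinity>n. norm (u t n) - norm (u t0 n))) UNIV"
          proof (rule has_sum_infsum[OF abs_summable_summable])
            show "(\<lambda>n. norm (norm (u t n) - norm (u t0 n))) summable_on UNIV"
              by (rule Infinite_Sum.abs_summable_on_comparison_test'[OF d]) (simp add: norm_triangle_ineq3)
          qed
          show "((\<lambda>n. norm (u t n - u t0 n)) has_sum (\<Sum>\<^sub>\<infinity>n. norm (u t n - u t0 n))) UNIV"
            by (rule has_sum_infsum[OF d])
        qed (simp add: norm_triangle_ineq3)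
        ultimately show "norm (N t - N t0) \<le> (\<Sum>\<^sub>\<infinity>n. norm (u t n - u t0 n))" by simp
      qed
    qed
    then show "(N \<longlongrightarrow> N t0) (at t0 within {0..T})" by (simp add: LIM_zero_iff)
  qed
  then have "compact (N ` {0..T})" by (intro compact_continuous_image) auto
  then obtain \<rho> where "\<And>t. t \<in> {0..T} \<Longrightarrow> \<bar>N t\<bar> \<le> \<rho>"
    by (metis bounded_real compact_imp_bounded imageI)
  then have "sum_bd (\<lambda>n. norm (u t n)) \<rho>" if "t \<in> {0..T}" for t
    using that by (intro wsum_bd_mono[OF bN[OF that]]) (auto dest: abs_le_D1)
  then show ?thesis by (rule that)
qed

text \<open>The difference of two solutions is halved by each application of the equation on a time step of fixed length.\<close>

lemma mild_unique:
  assumes T: "0 \<le> T" "T \<le> 1"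
    and s: "\<And>t. t \<in> {0..T} \<Longrightarrow> (\<lambda>n. norm (u t n)) summable_on UNIV"
      "\<And>t. t \<in> {0..T} \<Longrightarrow> (\<lambda>n. norm (v t n)) summable_on UNIV"
    and cont: "\<And>t0. t0 \<in> {0..T} \<Longrightarrow> ((\<lambda>t. \<Sum>\<^sub>\<infinity>n. norm (u t n - u t0 n)) \<longlongrightarrow> 0) (at t0 within {0..T})"
      "\<And>t0. t0 \<in> {0..T} \<Longrightarrow> ((\<lambda>t. \<Sum>\<^sub>\<infinity>n. norm (v t n - v t0 n)) \<longlongrightarrow> 0) (at t0 within {0..T})"
    and eq: "\<And>t n. t \<in> {0..T} \<Longrightarrow> u t n = L t n + duhamel (\<lambda>s. forcing (u s)) t n"
      "\<And>t n. t \<in> {0..T} \<Longrightarrow> v t n = L t n + duhamel (\<lambda>s. forcing (v s)) t n"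
    and t: "t \<in> {0..T}"
  shows "u t = v t"
proof -
  obtain \<rho>1 where \<rho>1: "\<And>t. t \<in> {0..T} \<Longrightarrow> sum_bd (\<lambda>n. norm (u t n)) \<rho>1"
    using l1_cont_bounded[OF s(1) cont(1)] by blast
  obtain \<rho>2 where \<rho>2: "\<And>t. t \<in> {0..T} \<Longrightarrow> sum_bd (\<lambda>n. norm (v t n)) \<rho>2"
    using l1_cont_bounded[OF s(2) cont(2)] by blast
  define \<rho> where "\<rho> = max \<rho>1 \<rho>2"
  have bu: "sum_bd (\<lambda>n. norm (u t n)) \<rho>" and bv: "sum_bd (\<lambda>n. norm (v t n)) \<rho>" if "t \<in> {0..T}" for t
    using that by (auto simp: \<rho>_def intro: wsum_bd_mono[OF \<rho>1[OF that]] wsum_bd_mono[OF \<rho>2[OF that]])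
  have \<rho>0: "0 \<le> \<rho>" using wsum_bd_bound_nonneg[OF bu[of 0]] T by simp
  \<comment> \<open>The step length that makes 2 * c * sqrt h * Lip \<rho> at most 1/2; the summand
    1 keeps the denominator positive when c * Lip \<rho> is 0.\<close>
  define h where "h = (1 / (1 + 4 * c * Lip \<rho>))\<^sup>2"
  have L0: "0 \<le> c * Lip \<rho>" using c_nonneg Lip_nonneg[OF \<rho>0] by simp
  then have h: "h > 0" "sqrt h = 1 / (1 + 4 * c * Lip \<rho>)"
    unfolding h_def by (auto simp: real_sqrt_abs add_pos_nonneg intro!: zero_less_power)
  have hL: "2 * c * sqrt h * Lip \<rho> \<le> 1/2"
    using L0 unfolding h(2) by (simp add: divide_simps add_pos_nonneg)
  note contF = forcing_cont_of_l1_cont[OF bu cont(1)] and contG = forcing_cont_of_l1_cont[OF bv cont(2)]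
  have "\<forall>t\<in>{0..T}. t \<le> of_nat k * h \<longrightarrow> u t = v t" for k
  proof (induction k)
    case 0
    have "u 0 n = v 0 n" for n
      using eq(1)[of 0 n] eq(2)[of 0 n] T by (simp add: duhamel_def)
    then show ?case by auto
  next
    case (Suc k)
    define a where "a = of_nat k * h"
    have a0: "0 \<le> a" using h by (simp add: a_def)
    have Sk: "of_nat (Suc k) * h = a + h" by (simp add: a_def algebra_simps)
    \<comment> \<open>The solutions agree up to a, so only the forcing on [a, t] contributes.
      Starting from the trivial bound 2 * \<rho>, each use of the equation gains a factor
      1/2.\<close>
    have "\<forall>t\<in>{0..T}. a \<le> t \<longrightarrow> t \<le> a + h \<longrightarrow> sum_bd (\<lambda>n. norm (u t n - v t n)) (2 * \<rho> / 2^j)" for j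
    proof (induction j)
      case 0
      then show ?case using sum_bd_diff[OF bu bv] by auto
    next
      case (Suc j)
      show ?case
      proof (intro ballI impI)
        fix t assume t: "t \<in> {0..T}" "a \<le> t" "t \<le> a + h"
        have sub: "{0..t} \<subseteq> {0..T}" using t by auto
        have dFF: "sum_bd (\<lambda>n. norm (forcing (u s) n - forcing (v s) n)) (Lip \<rho> * (2 * \<rho> / 2^j))" if "s \<in> {a..t}" for s
          by (rule forcing_lipschitz) (use that t a0 bu bv Suc.IH in auto)
        have 1: "(\<Sum>n\<in>A. norm (u t n - v t n)) \<le> 2 * \<rho> / 2^Suc j" if A: "finite A" for A
        proof -
          have "u t n - v t n = duhamel (\<lambda>s n. forcing (u s) n - forcing (v s) n) t n" for n
            using eq(1)[OF t(1), of n] eq(2)[OF t(1), of n]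
              duhamel_diff[of t "\<lambda>s. forcing (u s)" n "\<lambda>s. forcing (v s)", OF continuous_on_subset[OF contF sub] continuous_on_subset[OF contG sub]]
            by simp
          then have "(\<Sum>n\<in>A. norm (u t n - v t n)) = (\<Sum>n\<in>A. norm (duhamel (\<lambda>s n. forcing (u s) n - forcing (v s) n) t n))"
            by simp
          also have "\<dots> \<le> 2 * c * sqrt (t - a) * (Lip \<rho> * (2 * \<rho> / 2^j))"
          proof (rule duhamel_sum_bound[OF a0 t(2) _ A])
            show "t \<le> 1" using t T by auto
            show "continuous_on {0..t} (\<lambda>s. forcing (u s) n - forcing (v s) n)" for n
              by (intro continuous_intros continuous_on_subset[OF contF sub] continuous_on_subset[OF contG sub])
            show "forcing (u s) n - forcing (v s) n = 0" if "s \<in> {0..<a}" for s n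
              using \<open>\<forall>t\<in>{0..T}. t \<le> of_nat k * h \<longrightarrow> u t = v t\<close> that t by (auto simp: a_def)
            show "(\<Sum>n\<in>A. norm (forcing (u s) n - forcing (v s) n)) \<le> Lip \<rho> * (2 * \<rho> / 2^j)" if "s \<in> {a..t}" for s
              using wsum_bd_sum[OF dFF[OF that] A] by simp
          qed
          also have "\<dots> = 2 * c * sqrt (t - a) * Lip \<rho> * (2 * \<rho> / 2^j)" by simp
          also have "\<dots> \<le> 2 * c * sqrt h * Lip \<rho> * (2 * \<rho> / 2^j)"
            using t \<rho>0 c_nonneg Lip_nonneg[OF \<rho>0] by (intro mult_right_mono mult_left_mono) auto
          also have "\<dots> \<le> 1/2 * (2 * \<rho> / 2^j)"
            using hL \<rho>0 by (intro mult_right_mono) auto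
          finally show ?thesis by simp
        qed
        then show "sum_bd (\<lambda>n. norm (u t n - v t n)) (2 * \<rho> / 2^Suc j)"
          by (simp add: wsum_bd_def)
      qed
    qed
    note small = this
    have "u t = v t" if t: "t \<in> {0..T}" "a \<le> t" "t \<le> a + h" for t
    proof
      fix n
      have le: "norm (u t n - v t n) \<le> 2 * \<rho> * (1/2)^j" for j
        using sum_bd_point small t by (fastforce simp: power_divide)
      have "(\<lambda>j. 2 * \<rho> * (1/2)^j) \<longlonglongrightarrow> 2 * \<rho> * 0"
        by (intro tendsto_mult_left LIMSEQ_power_zero) auto
      then have "norm (u t n - v t n) \<le> 2 * \<rho> * 0"
        by (rule LIMSEQ_le_const) (use le in auto)
      then show "u t n = v t n" by simp
    qed
    then show ?case using Suc unfolding Sk by (auto simp: a_def not_le)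
  qed
  moreover obtain k :: nat where "T / h \<le> of_nat k" using real_arch_simple by blast
  moreover have "t \<le> of_nat k * h" if "T / h \<le> of_nat k" for k
    using that t h by (auto simp: divide_le_eq)
  ultimately show ?thesis using t by blast
qed

end

section \<open>Scalar majorants and existence by Picard iteration\<close>

context mild
begin

text \<open>The scalar shadow of the quadratic term: norms replaced by majorants and the product by
  its bound. \<open>major\<close> does the same for the whole forcing.\<close>

definition quad_major :: "('g \<Rightarrow> real) \<Rightarrow> 'g \<Rightarrow> real" where
  "quad_major a n = KP * rconv a a n"

definition major :: "('g \<Rightarrow> real) \<Rightarrow> 'g \<Rightarrow> real" where
  "major a n = quad_major a n + KR * rconv (quad_major a) a n"

lemma quad_major_sum_bd: "sum_bd a A \<Longrightarrow> sum_bd (quad_major a) (KP * (A * A))"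
  unfolding quad_major_def by (intro wsum_bd_cmult rconv_sum_bd P.K_nonneg)

lemma quad_major_bound: "sum_bd a A \<Longrightarrow> (\<And>n. norm (x n) \<le> a n) \<Longrightarrow> norm (conv P x x n) \<le> quad_major a n"
  unfolding quad_major_def by (rule P.conv_summable(3))

text \<open>Domination by increments passes through both convolutions. This is the induction step
  that compares successive Picard iterates with the scalar iteration.\<close>

lemma forcing_diff_major:
  assumes a: "sum_bd a A" "sum_bd a' A'" and y: "\<And>n. norm (y n) \<le> a' n"
    and d: "\<And>n. norm (x n - y n) \<le> a n - a' n"
  shows "norm (forcing x n - forcing y n) \<le> major a n - major a' n"
proof -
  have 1: "norm (conv P x x n - conv P y y n) \<le> quad_major a n - quad_major a' n" for n
    using P.conv_diff_major[OF a a y y d d, of n] by (simp add: quad_major_def right_diff_distrib)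
  have 2: "norm (conv R (conv P x x) x n - conv R (conv P y y) y n) \<le> KR * (rconv (quad_major a) a n - rconv (quad_major a') a' n)"
    by (rule R.conv_diff_major[OF quad_major_sum_bd[OF a(1)] quad_major_sum_bd[OF a(2)] a quad_major_bound[OF a(2) y] y 1 d])
  have "norm (forcing x n - forcing y n) \<le> norm (conv P x x n - conv P y y n) + norm (conv R (conv P x x) x n - conv R (conv P y y) y n)"
    unfolding forcing_def by (rule order_trans[OF _ norm_triangle_ineq]) (simp add: algebra_simps)
  then show ?thesis using 1[of n] 2 by (simp add: major_def algebra_simps)
qed

lemma conv_zero: "conv P (\<lambda>_. 0) y n = 0" "conv R (\<lambda>_. 0) y n = 0" "rconv (\<lambda>_. 0) b n = 0"
  by (simp_all add: conv_def P.zero_left R.zero_left)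

lemma forcing_zero: "forcing (\<lambda>_. 0) n = 0"
  by (simp add: forcing_def conv_zero[abs_def])

lemma major_zero: "major (\<lambda>_. 0) n = 0"
  by (simp add: major_def quad_major_def[abs_def] conv_zero)

lemma sum_bd_zero: "sum_bd (\<lambda>_. 0) 0"
  by (simp add: wsum_bd_def)

lemma forcing_bound:
  assumes a: "sum_bd a A" and x: "\<And>n. norm (x n) \<le> a n"
  shows "norm (forcing x n) \<le> major a n"
  using forcing_diff_major[OF a sum_bd_zero, of "\<lambda>_. 0" x n] x by (simp add: forcing_zero major_zero)

lemma forcing_tendsto:
  assumes a: "sum_bd a A" and dom: "\<forall>\<^sub>F x in F. \<forall>n. norm (f x n) \<le> a n"
    and lim: "\<And>n. ((\<lambda>x. f x n) \<longlongrightarrow> f0 n) F"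
  shows "((\<lambda>x. forcing (f x) n) \<longlongrightarrow> forcing f0 n) F"
proof -
  have 1: "((\<lambda>x. conv P (f x) (f x) n) \<longlongrightarrow> conv P f0 f0 n) F" for n
    by (rule P.conv_tendsto[OF a a _ lim lim]) (use dom in auto)
  have "((\<lambda>x. conv R (conv P (f x) (f x)) (f x) n) \<longlongrightarrow> conv R (conv P f0 f0) f0 n) F"
    by (rule R.conv_tendsto[OF quad_major_sum_bd[OF a] a _ 1 lim])
       (use dom in eventually_elim, use quad_major_bound[OF a] in auto)
  then show ?thesis
    unfolding forcing_def by (intro tendsto_add 1)
qed

text \<open>Counterpart for families with a common majorant, such as the Picard iterates: continuity
  of each coefficient suffices, by dominated convergence.\<close>

lemma forcing_cont_dominated:
  assumes "sum_bd a A" "\<And>t n. t \<in> S \<Longrightarrow> norm (u t n) \<le> a n" "\<And>n. continuous_on S (\<lambda>t. u t n)"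
  shows "continuous_on S (\<lambda>t. forcing (u t) n)"
  unfolding continuous_on_def
proof
  fix t assume t: "t \<in> S"
  show "((\<lambda>t. forcing (u t) n) \<longlongrightarrow> forcing (u t) n) (at t within S)"
  proof (rule forcing_tendsto[OF assms(1)])
    show "\<forall>\<^sub>F t in at t within S. \<forall>n. norm (u t n) \<le> a n"
      using assms(2) by (auto simp: eventually_at_filter)
    show "((\<lambda>t. u t n) \<longlongrightarrow> u t n) (at t within S)" for n
      using assms(3) t by (auto simp: continuous_on_def)
  qed
qed

lemma major_tendsto:
  fixes f :: "'x \<Rightarrow> 'g \<Rightarrow> real"
  assumes a: "sum_bd a A" and f0: "\<And>x n. 0 \<le> f x n" and dom: "\<And>x n. f x n \<le> a n"
    and lim: "\<And>n. ((\<lambda>x. f x n) \<longlongrightarrow> g n) F"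
  shows "((\<lambda>x. major (f x) n) \<longlongrightarrow> major g n) F"
proof -
  note ct = bbound.conv_tendsto[OF bbound_mult]
  have bf: "sum_bd (f x) A" for x
    by (rule wsum_bd_mono[OF a]) (auto simp: f0 dom)
  have 1: "((\<lambda>x. quad_major (f x) n) \<longlongrightarrow> quad_major g n) F" for n
    unfolding quad_major_def by (intro tendsto_mult_left ct[OF a a _ lim lim]) (auto simp: f0 dom)
  have 2: "0 \<le> quad_major (f x) n \<and> quad_major (f x) n \<le> quad_major a n" for x n
    unfolding quad_major_def using P.K_nonneg
    by (auto intro!: mult_left_mono mult_nonneg_nonneg rconv_nonneg f0 rconv_mono[OF bf bf a a] dom)
  show ?thesis
    unfolding major_def
    by (intro tendsto_add tendsto_mult_left 1 ct[OF quad_major_sum_bd[OF a] a _ 1 lim]) (use 2 in \<open>auto simp: f0 dom\<close>)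
qed

lemma major_mono:
  assumes a: "sum_bd a A" and b: "sum_bd b B" and le: "\<And>n. a n \<le> b n"
  shows "0 \<le> major a n" "major a n \<le> major b n"
proof -
  have 1: "quad_major a n \<le> quad_major b n" for n
    unfolding quad_major_def using P.K_nonneg by (intro mult_left_mono rconv_mono[OF a a b b] le) auto
  have 2: "rconv (quad_major a) a n \<le> rconv (quad_major b) b n"
    by (intro rconv_mono[OF quad_major_sum_bd[OF a] a quad_major_sum_bd[OF b] b] 1 le)
  show "major a n \<le> major b n"
    unfolding major_def using R.K_nonneg by (intro add_mono 1 mult_left_mono 2) auto
  show "0 \<le> major a n"
    unfolding major_def using R.K_nonneg wsum_bd_nonneg[OF a] wsum_bd_nonneg[OF quad_major_sum_bd[OF a]]
    by (intro add_nonneg_nonneg mult_nonneg_nonneg rconv_nonneg) auto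
qed

text \<open>The radii 2 * \<rho> and 2 * \<rho>r leave room for data of size \<rho> and \<rho>r plus
  an equally large correction; the powers of 2 give 4, 8 and 16. The sup bound is linear in \<rho>r
  by \<open>rconv_sup\<close>.\<close>

lemma major_bounds:
  assumes w: "\<And>n. 1 \<le> w n" "\<And>m k. w (m + k) \<le> C * (w m * w k)" "0 \<le> C"
    and wr: "\<And>n. 0 \<le> wr n" "\<And>m k. wr (m + k) \<le> D * (wr m + wr k)" "0 \<le> D"
    and a: "wsum_bd w a (2 * \<rho>)" "\<And>n. wr n * a n \<le> 2 * \<rho>r"
  shows "wsum_bd w (major a) (KP * (C * (4 * \<rho>^2)) + KR * KP * (C^2 * (8 * \<rho>^3)))"
    and "wr n * major a n \<le> \<rho>r * (KP * (8 * D * \<rho>) + KR * KP * (16 * D^2 * \<rho>^2 + 8 * D * \<rho>^2))"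
proof -
  have w0: "0 \<le> w n" for n using w(1)[of n] by simp
  note a1 = wsum_bd_imp_sum_bd[OF a(1) w(1)]
  have q: "wsum_bd w (quad_major a) (KP * (C * (2 * \<rho> * (2 * \<rho>))))"
    unfolding quad_major_def by (intro wsum_bd_cmult rconv_wsum_bd[OF w0 w(2,3) a(1) a1 a(1) a1] P.K_nonneg)
  note q1 = quad_major_sum_bd[OF a1]
  have r: "wsum_bd w (rconv (quad_major a) a) (C * (KP * (C * (2 * \<rho> * (2 * \<rho>))) * (2 * \<rho>)))"
    by (rule rconv_wsum_bd[OF w0 w(2,3) q q1 a(1) a1])
  have "wsum_bd w (major a) (KP * (C * (2 * \<rho> * (2 * \<rho>))) + KR * (C * (KP * (C * (2 * \<rho> * (2 * \<rho>))) * (2 * \<rho>))))"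
    unfolding major_def by (intro wsum_bd_add wsum_bd_cmult q r R.K_nonneg)
  then show "wsum_bd w (major a) (KP * (C * (4 * \<rho>^2)) + KR * KP * (C^2 * (8 * \<rho>^3)))"
    by (simp add: power2_eq_square power3_eq_cube mult_ac)
  have qs: "wr n * quad_major a n \<le> KP * (D * (2 * \<rho>r * (2 * \<rho>) + 2 * \<rho>r * (2 * \<rho>)))" for n
  proof -
    have "KP * (wr n * rconv a a n) \<le> KP * (D * (2 * \<rho>r * (2 * \<rho>) + 2 * \<rho>r * (2 * \<rho>)))"
      by (intro mult_left_mono rconv_sup[OF wr a1 a(2) a1 a(2)] P.K_nonneg)
    then show ?thesis by (simp add: quad_major_def mult_ac)
  qed
  have "wr n * rconv (quad_major a) a n \<le>
      D * (KP * (D * (2 * \<rho>r * (2 * \<rho>) + 2 * \<rho>r * (2 * \<rho>))) * (2 * \<rho>) + 2 * \<rho>r * (KP * (2 * \<rho> * (2 * \<rho>))))"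
    by (rule rconv_sup[OF wr q1 qs a1 a(2)])
  from mult_left_mono[OF this R.K_nonneg] qs[of n]
  have "wr n * major a n \<le> KP * (D * (2 * \<rho>r * (2 * \<rho>) + 2 * \<rho>r * (2 * \<rho>))) +
    KR * (D * (KP * (D * (2 * \<rho>r * (2 * \<rho>) + 2 * \<rho>r * (2 * \<rho>))) * (2 * \<rho>) + 2 * \<rho>r * (KP * (2 * \<rho> * (2 * \<rho>)))))"
    by (simp add: major_def distrib_left mult.left_commute)
  also have "\<dots> = \<rho>r * (KP * (8 * D * \<rho>) + KR * KP * (16 * D^2 * \<rho>^2 + 8 * D * \<rho>^2))"
    by (simp add: algebra_simps power2_eq_square)
  finally show "wr n * major a n \<le> \<rho>r * (KP * (8 * D * \<rho>) + KR * KP * (16 * D^2 * \<rho>^2 + 8 * D * \<rho>^2))" .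
qed

text \<open>The Picard iterates \<open>U k\<close> are compared, frequency by frequency and uniformly in time, with the increasing real
  iteration \<open>mm\<close>; this yields convergence and every weighted bound at once. The \<open>\<ell>\<^sup>\<infinity>\<close> bound with weight \<open>wr\<close> makes
  the Duhamel term small at each single frequency.\<close>

lemma mild_exists:
  assumes T: "0 < T" "T \<le> 1"
    and w: "\<And>n. 1 \<le> w n" "\<And>m k. w (m + k) \<le> C * (w m * w k)" "0 \<le> C"
    and wr: "\<And>n. 0 \<le> wr n" "\<And>m k. wr (m + k) \<le> D * (wr m + wr k)" "0 \<le> D"
    and L: "\<And>n. continuous_on {0..T} (\<lambda>t. L t n)" "\<And>t n. t \<in> {0..T} \<Longrightarrow> norm (L t n) \<le> l n"
    and l: "wsum_bd w l \<rho>" "\<And>n. wr n * l n \<le> \<rho>r"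
    and \<theta>: "\<theta> \<le> 1"
    and small1: "2 * c * sqrt T * (KP * (C * (4 * \<rho>^2)) + KR * KP * (C^2 * (8 * \<rho>^3))) \<le> \<rho>"
    and small2: "2 * c * sqrt T * (KP * (8 * D * \<rho>) + KR * KP * (16 * D^2 * \<rho>^2 + 8 * D * \<rho>^2)) \<le> \<theta>"
  obtains u a where "\<And>n. continuous_on {0..T} (\<lambda>t. u t n)" "wsum_bd w a (2 * \<rho>)"
    "\<And>t n. t \<in> {0..T} \<Longrightarrow> norm (u t n) \<le> a n"
    "\<And>t n. t \<in> {0..T} \<Longrightarrow> u t n = L t n + duhamel (\<lambda>s. forcing (u s)) t n"
    "\<And>t n. t \<in> {0..T} \<Longrightarrow> wr n * norm (u t n - L t n) \<le> \<theta> * \<rho>r"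
proof -
  define \<epsilon> where "\<epsilon> = 2 * c * sqrt T"
  have e0: "0 \<le> \<epsilon>" using c_nonneg T by (simp add: \<epsilon>_def)
  have w0: "0 \<le> w n" for n using w(1)[of n] by simp
  have \<rho>0: "0 \<le> \<rho>" by (rule wsum_bd_bound_nonneg[OF l(1)])
  have \<rho>r0: "0 \<le> \<rho>r" using l(2)[of 0] wr(1)[of 0] wsum_bd_nonneg[OF l(1), of 0] by (meson mult_nonneg_nonneg order_trans)
  define mm where "mm k = ((\<lambda>a n. l n + \<epsilon> * major a n) ^^ k) (\<lambda>_. 0)" for k
  define U where "U k = ((\<lambda>u t n. L t n + duhamel (\<lambda>s. forcing (u s)) t n) ^^ k) (\<lambda>_ _. 0)" for k
  have mm0: "mm 0 n = 0" and mmS: "mm (Suc k) n = l n + \<epsilon> * major (mm k) n" for k n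
    by (simp_all add: mm_def)
  have U0: "U 0 t n = 0" and US: "U (Suc k) t n = L t n + duhamel (\<lambda>s. forcing (U k s)) t n" for k t n
    by (simp_all add: U_def)
  \<comment> \<open>The two smallness conditions in usable form: the nonlinear term adds at most
    \<rho> in l^1 and \<theta> * \<rho>r in sup norm to the data bound, so the radii 2 * \<rho> and
    2 * \<rho>r are preserved.\<close>
  have GGb: "wsum_bd w (\<lambda>n. \<epsilon> * major a n) \<rho>" "\<epsilon> * (wr n * major a n) \<le> \<theta> * \<rho>r"
    if a: "wsum_bd w a (2 * \<rho>)" "\<And>n. wr n * a n \<le> 2 * \<rho>r" for a n
  proof -
    note g = major_bounds[OF w wr a]
    show "wsum_bd w (\<lambda>n. \<epsilon> * major a n) \<rho>"
      by (rule wsum_bd_mono[OF wsum_bd_cmult[OF g(1) e0]])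
         (use w0 e0 small1 wsum_bd_nonneg[OF g(1)] in \<open>auto simp: \<epsilon>_def\<close>)
    have "\<epsilon> * (wr n * major a n) \<le> \<epsilon> * (\<rho>r * (KP * (8 * D * \<rho>) + KR * KP * (16 * D^2 * \<rho>^2 + 8 * D * \<rho>^2)))"
      by (intro mult_left_mono g(2) e0)
    also have "\<dots> = (\<epsilon> * (KP * (8 * D * \<rho>) + KR * KP * (16 * D^2 * \<rho>^2 + 8 * D * \<rho>^2))) * \<rho>r"
      by (simp add: mult_ac)
    also have "\<dots> \<le> \<theta> * \<rho>r"
      using small2 \<rho>r0 by (intro mult_right_mono) (auto simp: \<epsilon>_def)
    finally show "\<epsilon> * (wr n * major a n) \<le> \<theta> * \<rho>r" .
  qed
  have M: "wsum_bd w (mm k) (2 * \<rho>) \<and> (\<forall>n. wr n * mm k n \<le> 2 * \<rho>r)" for k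
  proof (induction k)
    case 0
    then show ?case using \<rho>0 \<rho>r0 by (simp add: wsum_bd_def mm0)
  next
    case (Suc k)
    then have g: "wsum_bd w (\<lambda>n. \<epsilon> * major (mm k) n) \<rho>" "\<epsilon> * (wr n * major (mm k) n) \<le> \<theta> * \<rho>r" for n
      using GGb by auto
    have "\<theta> * \<rho>r \<le> 1 * \<rho>r" using \<theta> \<rho>r0 by (intro mult_right_mono) auto
    then have "wr n * mm (Suc k) n \<le> 2 * \<rho>r" for n
      using l(2)[of n] g(2)[of n] by (simp add: mmS algebra_simps)
    moreover have "wsum_bd w (mm (Suc k)) (2 * \<rho>)"
      unfolding mmS[abs_def] using wsum_bd_add[OF l(1) g(1)] by simp
    ultimately show ?case by simp
  qed
  have M1: "sum_bd (mm k) (2 * \<rho>)" for k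
    by (rule wsum_bd_imp_sum_bd[of w, OF _ w(1)]) (use M in blast)
  note mm_nn = wsum_bd_nonneg[OF M1]
  have mono1: "mm k n \<le> mm (Suc k) n" for k n
  proof (induction k arbitrary: n)
    case 0
    then show ?case using mm_nn[of "Suc 0" n] by (simp add: mm0)
  next
    case (Suc k)
    have "major (mm k) n \<le> major (mm (Suc k)) n"
      by (rule major_mono(2)[OF M1 M1]) (rule Suc.IH)
    then show ?case
      unfolding mmS[of "Suc k"] mmS[of k n] using e0 by (intro add_mono mult_left_mono) auto
  qed
  \<comment> \<open>The three claims are proved together: continuity makes the next Duhamel integral
    meaningful, and the increment bound yields the size bound of the next iterate by the triangle
    inequality.\<close>
  have Ucont: "(\<forall>n. continuous_on {0..T} (\<lambda>t. U k t n)) \<and> (\<forall>t\<in>{0..T}. \<forall>n. norm (U k t n) \<le> mm k n) \<and>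
      (\<forall>t\<in>{0..T}. \<forall>n. norm (U (Suc k) t n - U k t n) \<le> mm (Suc k) n - mm k n)" for k
  proof (induction k)
    case 0
    have "norm (U (Suc 0) t n - U 0 t n) \<le> mm (Suc 0) n - mm 0 n" if "t \<in> {0..T}" for t n
      using L(2)[OF that, of n] unfolding US mmS
      by (simp add: U0[abs_def] mm0[abs_def] forcing_zero major_zero duhamel_def linear_0[OF Ker_linear])
    then show ?case by (simp add: U0 mm0)
  next
    case (Suc k)
    have FFc: "continuous_on {0..T} (\<lambda>s. forcing (U k s) n)" for n
      by (rule forcing_cont_dominated[OF M1]) (use Suc in auto)
    have c: "continuous_on {0..T} (\<lambda>t. U (Suc k) t n)" for n
      unfolding US using T by (intro continuous_intros L duhamel_cont FFc) auto
    have b: "norm (U (Suc k) t n) \<le> mm (Suc k) n" if "t \<in> {0..T}" for t n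
    proof -
      have "norm (U (Suc k) t n - U k t n) \<le> mm (Suc k) n - mm k n" "norm (U k t n) \<le> mm k n"
        using Suc that by blast+
      then show ?thesis using norm_triangle_sub[of "U (Suc k) t n" "U k t n"] by linarith
    qed
    have FFc': "continuous_on {0..T} (\<lambda>s. forcing (U (Suc k) s) n)" for n
      by (rule forcing_cont_dominated[OF M1 b c])
    have "norm (U (Suc (Suc k)) t n - U (Suc k) t n) \<le> mm (Suc (Suc k)) n - mm (Suc k) n" if t: "t \<in> {0..T}" for t n
    proof -
      have sub: "{0..t} \<subseteq> {0..T}" using t by auto
      note cc = continuous_on_subset[OF FFc' sub] continuous_on_subset[OF FFc sub]
      have "U (Suc (Suc k)) t n - U (Suc k) t n = duhamel (\<lambda>s n. forcing (U (Suc k) s) n - forcing (U k s) n) t n"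
        unfolding US[of "Suc k"] US[of k t]
        using duhamel_diff[of t "\<lambda>s. forcing (U (Suc k) s)" n "\<lambda>s. forcing (U k s)", OF cc] by simp
      also have "norm \<dots> \<le> 2 * c * sqrt t * (major (mm (Suc k)) n - major (mm k) n)"
      proof (rule duhamel_bound)
        show "continuous_on {0..t} (\<lambda>s. forcing (U (Suc k) s) n - forcing (U k s) n)"
          by (intro continuous_intros cc)
        show "norm (forcing (U (Suc k) s) n - forcing (U k s) n) \<le> major (mm (Suc k)) n - major (mm k) n" if "s \<in> {0..t}" for s
          by (rule forcing_diff_major[OF M1 M1]) (use that sub Suc in auto)
      qed (use t T in auto)
      also have "\<dots> \<le> \<epsilon> * (major (mm (Suc k)) n - major (mm k) n)"
        unfolding \<epsilon>_def using t c_nonneg major_mono(2)[OF M1 M1 mono1, of k n]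
        by (intro mult_right_mono mult_left_mono) auto
      finally show ?thesis by (simp add: mmS[of "Suc k"] mmS[of k n] right_diff_distrib)
    qed
    then show ?case using c b by blast
  qed
  have mono: "mm j n \<le> mm k n" if "j \<le> k" for j k n
    using that mono1 by (rule lift_Suc_mono_le[rotated])
  have Ub: "norm (U k t n) \<le> mm k n" if "t \<in> {0..T}" for k t n using Ucont that by blast
  have Uc: "continuous_on {0..T} (\<lambda>t. U k t n)" for k n using Ucont by blast
  have Ud: "norm (U k t n - U j t n) \<le> mm k n - mm j n" if "t \<in> {0..T}" "j \<le> k" for j k t n
    using that(2)
  proof (induction k rule: dec_induct)
    case (step k)
    have "norm (U (Suc k) t n - U k t n) \<le> mm (Suc k) n - mm k n"
      using Ucont[of k] that(1) by blast
    from norm_diff_triangle_le[OF this step.IH] show ?case by simp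
  qed simp
  define a where "a n = lim (\<lambda>k. mm k n)" for n
  have alim: "(\<lambda>k. mm k n) \<longlonglongrightarrow> a n" for n
  proof -
    have "incseq (\<lambda>k. mm k n)" using mono by (simp add: incseq_def)
    moreover have "bdd_above (range (\<lambda>k. mm k n))" using sum_bd_point[OF M1] by (intro bdd_aboveI) auto
    ultimately have "convergent (\<lambda>k. mm k n)"
      using LIMSEQ_incseq_SUP convergentI by blast
    then show ?thesis by (simp add: a_def convergent_LIMSEQ_iff)
  qed
  have ma: "mm k n \<le> a n" for k n
    by (rule LIMSEQ_le_const[OF alim]) (use mono in auto)
  have bda: "wsum_bd w a (2 * \<rho>)"
    unfolding wsum_bd_def
  proof (intro conjI allI impI)
    show "0 \<le> a n" for n using ma[of 0 n] by (simp add: mm0)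
    fix A :: "'g set" assume A: "finite A"
    show "(\<Sum>n\<in>A. w n * a n) \<le> 2 * \<rho>"
    proof (rule LIMSEQ_le_const2)
      show "(\<lambda>k. \<Sum>n\<in>A. w n * mm k n) \<longlonglongrightarrow> (\<Sum>n\<in>A. w n * a n)"
        by (intro tendsto_intros alim)
      show "\<exists>N. \<forall>k\<ge>N. (\<Sum>n\<in>A. w n * mm k n) \<le> 2 * \<rho>"
        using M wsum_bd_sum A by blast
    qed
  qed
  note bda1 = wsum_bd_imp_sum_bd[OF bda w(1)]
  define u where "u t n = lim (\<lambda>k. U k t n)" for t n
  have ulim: "(\<lambda>k. U k t n) \<longlonglongrightarrow> u t n" if t: "t \<in> {0..T}" for t n
  proof -
    \<comment> \<open>The increments are dominated by those of the convergent real sequence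
      \<open>mm\<close>.\<close>
    have "Cauchy (\<lambda>k. U k t n)"
    proof (rule metric_CauchyI)
      fix e :: real assume "e > 0"
      have "Cauchy (\<lambda>k. mm k n)" using alim by (rule LIMSEQ_imp_Cauchy)
      then obtain N where N: "\<And>j k. j \<ge> N \<Longrightarrow> k \<ge> N \<Longrightarrow> dist (mm j n) (mm k n) < e"
        using \<open>e > 0\<close> unfolding Cauchy_def by blast
      have "dist (U j t n) (U k t n) < e" if "j \<ge> N" "k \<ge> N" for j k
      proof (cases "j \<le> k")
        case True
        then show ?thesis using Ud[OF t True, of n] N[OF that] by (simp add: dist_norm norm_minus_commute)
      next
        case False
        then have "k \<le> j" by simp
        then show ?thesis using Ud[OF t, of k j n] N[OF that] by (simp add: dist_norm)
      qed
      then show "\<exists>N. \<forall>m\<ge>N. \<forall>k\<ge>N. dist (U m t n) (U k t n) < e" by blast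
    qed
    then show ?thesis unfolding u_def by (simp add: Cauchy_convergent_iff convergent_LIMSEQ_iff)
  qed
  have uU: "norm (u t n - U k t n) \<le> a n - mm k n" if t: "t \<in> {0..T}" for t n k
  proof (rule LIMSEQ_le)
    show "(\<lambda>j. norm (U j t n - U k t n)) \<longlonglongrightarrow> norm (u t n - U k t n)"
      by (intro tendsto_intros ulim t)
    show "(\<lambda>j. mm j n - mm k n) \<longlonglongrightarrow> a n - mm k n"
      by (intro tendsto_intros alim)
    show "\<exists>N. \<forall>j\<ge>N. norm (U j t n - U k t n) \<le> mm j n - mm k n"
      using Ud[OF t] by blast
  qed
  have ub: "norm (u t n) \<le> a n" if "t \<in> {0..T}" for t n
    using uU[OF that, of n 0] by (simp add: U0 mm0)
  have uc: "continuous_on {0..T} (\<lambda>t. u t n)" for n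
  proof (rule uniform_limit_theorem)
    show "\<forall>\<^sub>F k in sequentially. continuous_on {0..T} (\<lambda>t. U k t n)"
      using Uc by simp
    \<comment> \<open>The error bound a n - mm k n does not depend on t, so at each fixed frequency
      the convergence is uniform in time.\<close>
    show "uniform_limit {0..T} (\<lambda>k t. U k t n) (\<lambda>t. u t n) sequentially"
    proof (rule uniform_limitI)
      fix e :: real assume "e > 0"
      then have "\<forall>\<^sub>F k in sequentially. dist (mm k n) (a n) < e"
        using alim tendstoD by blast
      then show "\<forall>\<^sub>F k in sequentially. \<forall>t\<in>{0..T}. dist (U k t n) (u t n) < e"
      proof eventually_elim
        case (elim k)
        show ?case
        proof
          fix t assume "t \<in> {0..T}"
          from uU[OF this, of n k] elim ma[of k n] show "dist (U k t n) (u t n) < e"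
            by (simp add: dist_norm norm_minus_commute)
        qed
      qed
    qed
  qed simp
  have FFu: "continuous_on {0..T} (\<lambda>s. forcing (u s) n)" for n
    by (rule forcing_cont_dominated[OF bda1 ub uc])
  have ueq: "u t n = L t n + duhamel (\<lambda>s. forcing (u s)) t n" if t: "t \<in> {0..T}" for t n
  proof -
    have sub: "{0..t} \<subseteq> {0..T}" using t by auto
    have FFc: "continuous_on {0..T} (\<lambda>s. forcing (U k s) n)" for k
      by (rule forcing_cont_dominated[OF M1 Ub Uc])
    note cc = continuous_on_subset[OF FFu sub] continuous_on_subset[OF FFc sub]
    have le: "norm (duhamel (\<lambda>s. forcing (u s)) t n - duhamel (\<lambda>s. forcing (U k s)) t n) \<le> 2 * c * sqrt t * (major a n - major (mm k) n)" for k
    proof -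
      have "duhamel (\<lambda>s. forcing (u s)) t n - duhamel (\<lambda>s. forcing (U k s)) t n = duhamel (\<lambda>s n. forcing (u s) n - forcing (U k s) n) t n"
        by (rule duhamel_diff[of t "\<lambda>s. forcing (u s)" n "\<lambda>s. forcing (U k s)", OF cc])
      also have "norm \<dots> \<le> 2 * c * sqrt t * (major a n - major (mm k) n)"
      proof (rule duhamel_bound)
        show "continuous_on {0..t} (\<lambda>s. forcing (u s) n - forcing (U k s) n)"
          by (intro continuous_intros cc)
        show "norm (forcing (u s) n - forcing (U k s) n) \<le> major a n - major (mm k) n" if "s \<in> {0..t}" for s
          by (rule forcing_diff_major[OF bda1 M1]) (use that sub Ub uU in auto)
      qed (use t T in auto)
      finally show ?thesis .
    qed
    have "(\<lambda>k. major (mm k) n) \<longlonglongrightarrow> major a n"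
      by (rule major_tendsto[OF bda1 mm_nn ma alim])
    then have "(\<lambda>k. 2 * c * sqrt t * (major a n - major (mm k) n)) \<longlonglongrightarrow> 2 * c * sqrt t * (major a n - major a n)"
      by (intro tendsto_mult_left tendsto_diff tendsto_const)
    then have "(\<lambda>k. 2 * c * sqrt t * (major a n - major (mm k) n)) \<longlonglongrightarrow> 0" by simp
    then have "(\<lambda>k. duhamel (\<lambda>s. forcing (u s)) t n - duhamel (\<lambda>s. forcing (U k s)) t n) \<longlonglongrightarrow> 0"
      by (rule Lim_null_comparison[OF always_eventually, rotated]) (use le in blast)
    then have "(\<lambda>k. duhamel (\<lambda>s. forcing (U k s)) t n) \<longlonglongrightarrow> duhamel (\<lambda>s. forcing (u s)) t n"
      using tendsto_diff[OF tendsto_const[of "duhamel (\<lambda>s. forcing (u s)) t n"]] by fastforce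
    then have "(\<lambda>k. U (Suc k) t n) \<longlonglongrightarrow> L t n + duhamel (\<lambda>s. forcing (u s)) t n"
      unfolding US by (intro tendsto_add tendsto_const)
    moreover have "(\<lambda>k. U (Suc k) t n) \<longlonglongrightarrow> u t n"
      using ulim[OF t] by (rule LIMSEQ_Suc)
    ultimately show ?thesis using LIMSEQ_unique by blast
  qed
  \<comment> \<open>The limit majorant a inherits the sup bound 2 * \<rho>r, so \<open>GGb\<close>
    applies to it and bounds the Duhamel term at the single frequency n.\<close>
  have "wr n * norm (u t n - L t n) \<le> \<theta> * \<rho>r" if t: "t \<in> {0..T}" for t n
  proof -
    have sub: "{0..t} \<subseteq> {0..T}" using t by auto
    have wra: "wr n * a n \<le> 2 * \<rho>r" for n
      by (rule LIMSEQ_le_const2[OF tendsto_mult_left[OF alim]]) (use M in auto)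
    have "norm (u t n - L t n) = norm (duhamel (\<lambda>s. forcing (u s)) t n)" using ueq[OF t, of n] by simp
    also have "\<dots> \<le> 2 * c * sqrt t * major a n"
    proof (rule duhamel_bound)
      show "continuous_on {0..t} (\<lambda>s. forcing (u s) n)" by (rule continuous_on_subset[OF FFu sub])
      show "norm (forcing (u s) n) \<le> major a n" if "s \<in> {0..t}" for s
        by (rule forcing_bound[OF bda1 ub]) (use that sub in auto)
    qed (use t T in auto)
    also have "\<dots> \<le> \<epsilon> * major a n"
      unfolding \<epsilon>_def using t c_nonneg major_mono(1)[OF bda1 bda1, of n] by (intro mult_right_mono mult_left_mono) auto
    finally have "wr n * norm (u t n - L t n) \<le> wr n * (\<epsilon> * major a n)"
      using wr(1) by (rule mult_left_mono)
    also have "\<dots> \<le> \<theta> * \<rho>r" using GGb(2)[OF bda wra, of n] by (simp add: mult_ac)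
    finally show ?thesis .
  qed
  with uc bda ub ueq show ?thesis by (rule that)
qed

end

section \<open>The Fourier multipliers of the system\<close>

type_synonym C3 = "complex^3"
text \<open>A state holds the coefficients of \<open>(v, B, E)\<close>, a forcing those of \<open>(j \<times> B, v \<otimes> v, v \<times> B)\<close>.\<close>

type_synonym cstate = "C3 \<times> C3 \<times> C3"
type_synonym cforce = "C3 \<times> (complex^3^3) \<times> C3"

section \<open>Cross product, Leray projection and curl on a single Fourier mode\<close>

lemma norm_smult: "norm (c *s (x :: complex^'n)) = cmod c * norm x"
  by (simp add: norm_vec_def norm_mult L2_set_right_distrib)

lemma norm_vec_le_sum: "norm (x :: 'a::real_normed_vector^'n) \<le> (\<Sum>i\<in>UNIV. norm (x $ i))"
  unfolding norm_vec_def by (rule L2_set_le_sum) simp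

lemma norm_vec3_le: "(\<And>i. norm ((x :: 'a::real_normed_vector^3) $ i) \<le> M) \<Longrightarrow> norm x \<le> 3 * M"
  using norm_vec_le_sum[of x] sum_mono[of UNIV "\<lambda>i. norm (x$i)" "\<lambda>_. M"] by simp

lemma cross3_nth [simp]:
  "cross3 a b $ 1 = a$2 * b$3 - a$3 * b$2" "cross3 a b $ 2 = a$3 * b$1 - a$1 * b$3" "cross3 a b $ 3 = a$1 * b$2 - a$2 * b$1"
  by (simp_all add: cross3_def)

lemma norm_cross3: "norm (cross3 a (b :: C3)) \<le> 6 * (norm a * norm b)"
proof -
  have 1: "norm (a$i * b$j - a$k * b$l) \<le> 2 * (norm a * norm b)" for i j k l
  proof -
    have "norm (a$i * b$j - a$k * b$l) \<le> norm (a$i) * norm (b$j) + norm (a$k) * norm (b$l)"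
      by (rule order_trans[OF norm_triangle_ineq4]) (simp add: norm_mult)
    also have "\<dots> \<le> norm a * norm b + norm a * norm b"
      by (intro add_mono mult_mono Finite_Cartesian_Product.norm_nth_le) auto
    finally show ?thesis by simp
  qed
  have "norm (cross3 a b $ i) \<le> 2 * (norm a * norm b)" for i
    using exhaust_3[of i] 1 by auto
  from norm_vec3_le[OF this] show ?thesis by simp
qed

lemma nsq_nonneg: "0 \<le> nsq n"
  unfolding nsq_def by (intro sum_nonneg) auto

lemma nsq_ge_1: "nsq n \<noteq> 0 \<Longrightarrow> 1 \<le> nsq n"
proof -
  have "nsq n = of_int (\<Sum>i\<in>UNIV. (n$i)\<^sup>2)" by (simp add: nsq_def)
  moreover have "0 \<le> (\<Sum>i\<in>UNIV. (n$i)\<^sup>2)" by (intro sum_nonneg) auto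
  ultimately obtain k :: int where "nsq n = of_int k" "0 \<le> k" by blast
  then show "nsq n \<noteq> 0 \<Longrightarrow> 1 \<le> nsq n" by (cases "k = 0") auto
qed

lemma nsq_minus [simp]: "nsq (- n) = nsq n"
  by (simp add: nsq_def)

lemma norm_cvec: "norm (cvec n) = sqrt (nsq n)"
  by (simp add: norm_vec_def cvec_def L2_set_def nsq_def)

lemma cvec_nth [simp]: "cvec n $ i = of_int (n $ i)"
  by (simp add: cvec_def)

lemma cmod_cdot: "cmod (cdot a b) \<le> 3 * (norm a * norm b)"
proof -
  have "cmod (cdot a b) \<le> (\<Sum>i\<in>UNIV. norm (a$i) * norm (b$i))"
    unfolding cdot_def by (rule order_trans[OF norm_sum]) (simp add: norm_mult)
  also have "\<dots> \<le> (\<Sum>i\<in>(UNIV::3 set). norm a * norm b)"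
    by (intro sum_mono mult_mono Finite_Cartesian_Product.norm_nth_le) auto
  finally show ?thesis by simp
qed

lemma norm_leray: "norm (leray n a) \<le> 4 * norm a"
proof (cases "nsq n = 0")
  case False
  then have pos: "nsq n > 0" using nsq_nonneg[of n] by simp
  have "norm ((cdot (cvec n) a / complex_of_real (nsq n)) *s cvec n) = cmod (cdot (cvec n) a) / nsq n * sqrt (nsq n)"
    using pos by (simp add: norm_smult norm_divide norm_cvec)
  also have "\<dots> \<le> 3 * (sqrt (nsq n) * norm a) / nsq n * sqrt (nsq n)"
    using cmod_cdot[of "cvec n" a] pos by (intro mult_right_mono divide_right_mono) (auto simp: norm_cvec)
  also have "\<dots> = 3 * norm a * (sqrt (nsq n) * sqrt (nsq n) / nsq n)" by simp
  also have "\<dots> = 3 * norm a" using pos by (simp del: real_sqrt_mult_self add: real_sqrt_mult_self)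
  finally show ?thesis
    using norm_triangle_ineq4[of a "(cdot (cvec n) a / complex_of_real (nsq n)) *s cvec n"] False
    by (simp add: leray_def)
qed (simp add: leray_def)

lemma norm_leray_c: "norm (leray_c n a) \<le> 5 * norm a"
  using norm_leray[of n a] norm_triangle_ineq4[of a "leray n a"] by (simp add: leray_c_def)

lemma norm_curl_hat: "norm (curl_hat n a) \<le> 6 * sqrt (nsq n) * norm a"
  using norm_cross3[of "cvec n" a] by (simp add: curl_hat_def norm_smult norm_cvec)

lemma cdot_add: "cdot a (b + c) = cdot a b + cdot a c"
  by (simp add: cdot_def distrib_left sum.distrib)

lemma cdot_smult: "cdot a (r *s b) = r * cdot a b"
  by (simp add: cdot_def sum_distrib_left mult_ac)

lemma cdot_diff: "cdot a (b - c) = cdot a b - cdot a c"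
  by (simp add: cdot_def right_diff_distrib sum_subtractf)

lemma scaleR_smult: "r *\<^sub>R (b :: complex^'n) = of_real r *s b"
  unfolding vec_eq_iff vector_scaleR_component vector_smult_component by (simp add: scaleR_conv_of_real)

text \<open>The multipliers are written with complex \<open>*s\<close>, while \<open>linear\<close>
  refers to real scaling; the translation is made once here.\<close>

lemma linear_smultI:
  "(\<And>x y. f (x + y) = f x + f y) \<Longrightarrow> (\<And>r x. f (of_real r *s x) = of_real r *s f x) \<Longrightarrow> linear f"
  for f :: "complex^'n \<Rightarrow> complex^'m"
  by (rule linearI) (simp_all only: scaleR_smult)

lemma linear_smult: "linear (\<lambda>x :: complex^'n. c *s x)"
  by (rule linearI) (auto simp: vec_eq_iff algebra_simps)

lemma linear_leray: "linear (leray n)"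
  by (rule linear_smultI) (auto simp: vec_eq_iff leray_def cdot_add cdot_smult field_simps)

lemma linear_leray_c: "linear (leray_c n)"
  unfolding leray_c_def[abs_def] by (intro linear_compose_sub linear_id[unfolded id_def] linear_leray)

lemma linear_curl_hat: "linear (curl_hat n)"
  by (rule linear_smultI) (auto simp: vec_eq_iff forall_3 curl_hat_def algebra_simps)

lemma cdot_cvec_self: "cdot (cvec n) (cvec n) = complex_of_real (nsq n)"
  by (simp add: cdot_def nsq_def power2_eq_square)

lemma leray_leray: "leray n (leray n a) = leray n a"
proof (cases "nsq n = 0")
  case False
  then have "cdot (cvec n) (leray n a) = 0"
    by (simp add: leray_def cdot_diff cdot_smult cdot_cvec_self)
  then show ?thesis using False by (simp add: leray_def)
qed (simp add: leray_def)

lemma leray_leray_c: "leray n (leray_c n a) = 0"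
  by (simp add: leray_c_def linear_diff[OF linear_leray] leray_leray)

lemma leray_curl_hat: "leray n (curl_hat n a) = curl_hat n a"
proof -
  have "cdot (cvec n) (curl_hat n a) = 0"
    by (simp add: cdot_def sum_3 curl_hat_def algebra_simps)
  then show ?thesis by (simp add: leray_def)
qed

lemma leray_smult: "leray n (c *s a) = c *s leray n a"
  by (auto simp: leray_def vec_eq_iff cdot_smult algebra_simps)

definition cnj_vec :: "C3 \<Rightarrow> C3" where "cnj_vec x = (\<chi> i. cnj (x $ i))"

lemma cnj_vec_nth [simp]: "cnj_vec x $ i = cnj (x $ i)"
  by (simp add: cnj_vec_def)

lemma linear_cnj_vec: "linear cnj_vec"
  by (rule linear_smultI) (auto simp: vec_eq_iff)

lemma norm_cnj_vec [simp]: "norm (cnj_vec x) = norm x"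
  by (simp add: norm_vec_def)

lemma cnj_vec_leray: "cnj_vec (leray n a) = leray (- n) (cnj_vec a)"
  by (auto simp: leray_def vec_eq_iff cdot_def sum_negf)

lemma cnj_vec_leray_c: "cnj_vec (leray_c n a) = leray_c (- n) (cnj_vec a)"
  by (simp add: leray_c_def linear_diff[OF linear_cnj_vec] cnj_vec_leray)

lemma cnj_vec_curl_hat: "cnj_vec (curl_hat n a) = curl_hat (- n) (cnj_vec a)"
  by (auto simp: curl_hat_def vec_eq_iff forall_3 algebra_simps)

lemma cnj_vec_cross3: "cnj_vec (cross3 a b) = cross3 (cnj_vec a) (cnj_vec b)"
  by (auto simp: vec_eq_iff forall_3)

section \<open>The damped wave and heat propagators in real form\<close>

definition dw_freq :: "Z3 \<Rightarrow> real" where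
  "dw_freq n = sqrt (4 * nsq n - 1) / 2"

text \<open>\<open>dw_freq n\<close> is sqrt (|n|^2 - 1/4), the imaginary part of the roots -1/2 +-
  i * omega of z^2 + z + |n|^2 for nonzero n. The zero mode has the real roots 0 and -1 and is
  separated for that reason.\<close>

definition dw_S_re :: "real \<Rightarrow> Z3 \<Rightarrow> real" where
  "dw_S_re t n = (if nsq n = 0 then 1 - exp (- t) else exp (- t / 2) * sin (dw_freq n * t) / dw_freq n)"

definition dw_Sd_re :: "real \<Rightarrow> Z3 \<Rightarrow> real" where
  "dw_Sd_re t n = (if nsq n = 0 then exp (- t) else exp (- t / 2) * (cos (dw_freq n * t) - sin (dw_freq n * t) / (2 * dw_freq n)))"

lemma dw_freq_ge: "nsq n \<noteq> 0 \<Longrightarrow> sqrt (nsq n) / 2 \<le> dw_freq n"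
  unfolding dw_freq_def using nsq_ge_1[of n] by (intro divide_right_mono real_sqrt_le_mono) auto

lemma dw_freq_pos: "nsq n \<noteq> 0 \<Longrightarrow> 1/2 \<le> dw_freq n"
proof -
  assume a: "nsq n \<noteq> 0"
  have "1 \<le> sqrt (nsq n)" using nsq_ge_1[OF a] by simp
  then show "1/2 \<le> dw_freq n" using dw_freq_ge[OF a] by linarith
qed

lemma dw_eq_re: "dw_S t n = complex_of_real (dw_S_re t n)" "dw_Sd t n = complex_of_real (dw_Sd_re t n)"
proof -
  have "dw_S t n = complex_of_real (dw_S_re t n) \<and> dw_Sd t n = complex_of_real (dw_Sd_re t n)"
  proof (cases "nsq n = 0")
    case True
    then have "lam_p n = 0" "lam_m n = -1" by (auto simp: lam_p_def lam_m_def)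
    then show ?thesis using True
      by (simp add: dw_S_def dw_Sd_def dw_S_re_def dw_Sd_re_def exp_of_real[symmetric] del: exp_of_real)
  next
    case False
    define \<omega> where "\<omega> = dw_freq n"
    have \<omega>: "\<omega> \<noteq> 0" using dw_freq_pos[OF False] by (simp add: \<omega>_def)
    have "csqrt (complex_of_real (1 - 4 * nsq n)) = \<i> * sqrt \<bar>1 - 4 * nsq n\<bar>"
      using nsq_ge_1[OF False] by (subst csqrt_of_real_nonpos) auto
    also have "\<bar>1 - 4 * nsq n\<bar> = 4 * nsq n - 1" using nsq_ge_1[OF False] by simp
    finally have sq: "csqrt (complex_of_real (1 - 4 * nsq n)) = 2 * \<i> * \<omega>"
      by (simp add: \<omega>_def dw_freq_def)
    have lp: "lam_p n = - 1/2 + \<i> * \<omega>" and lm: "lam_m n = - 1/2 - \<i> * \<omega>"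
      unfolding lam_p_def lam_m_def sq by (simp_all add: field_simps)
    have ep: "exp (lam_p n * t) = of_real (exp (- t / 2)) * cis (\<omega> * t)"
      and em: "exp (lam_m n * t) = of_real (exp (- t / 2)) * cis (- (\<omega> * t))"
      unfolding lp lm cis_conv_exp exp_of_real[symmetric] exp_add[symmetric] by (simp_all add: algebra_simps flip: exp_add)
    have "lam_p n - lam_m n = 2 * \<i> * \<omega>" by (simp add: lp lm)
    then show ?thesis using \<omega> False unfolding dw_S_def dw_Sd_def dw_S_re_def dw_Sd_re_def ep em \<omega>_def[symmetric]
      by (auto simp: complex_eq_iff lp lm Re_divide Im_divide field_simps power2_eq_square)
  qed
  then show "dw_S t n = complex_of_real (dw_S_re t n)" "dw_Sd t n = complex_of_real (dw_Sd_re t n)" by auto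
qed

text \<open>The first bound is the gain of one derivative: 1 / dw_freq n compensates |n| up to the
  factor 2, so the curl in the equation for B causes no loss.\<close>

lemma dw_re_bound: "0 \<le> t \<Longrightarrow> \<bar>dw_S_re t n\<bar> * sqrt (nsq n) \<le> 2" "0 \<le> t \<Longrightarrow> \<bar>dw_S_re t n\<bar> \<le> 2"
  "0 \<le> t \<Longrightarrow> \<bar>dw_Sd_re t n\<bar> \<le> 2"
proof -
  assume t: "0 \<le> t"
  have e: "exp (- t / 2) \<le> 1" using t by simp
  have "\<bar>dw_S_re t n\<bar> * sqrt (nsq n) \<le> 2 \<and> \<bar>dw_S_re t n\<bar> \<le> 2 \<and> \<bar>dw_Sd_re t n\<bar> \<le> 2"
  proof (cases "nsq n = 0")
    case True
    then have eq: "dw_S_re t n = 1 - exp (- t)" "dw_Sd_re t n = exp (- t)" by (simp_all add: dw_S_re_def dw_Sd_re_def)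
    have "exp (- t) \<le> 1" "0 < exp (- t)" using t by auto
    then have "\<bar>dw_S_re t n\<bar> \<le> 2 \<and> \<bar>dw_Sd_re t n\<bar> \<le> 2" unfolding eq by linarith
    then show ?thesis using True by simp
  next
    case False
    note f = dw_freq_ge[OF False] dw_freq_pos[OF False]
    have S: "\<bar>dw_S_re t n\<bar> \<le> 1 / dw_freq n"
    proof -
      have "\<bar>exp (- t / 2) * sin (dw_freq n * t)\<bar> \<le> 1 * 1"
        unfolding abs_mult using e by (intro mult_mono) auto
      then show ?thesis using False f by (simp add: dw_S_re_def divide_right_mono)
    qed
    have "\<bar>dw_S_re t n\<bar> * sqrt (nsq n) \<le> 1 / dw_freq n * (2 * dw_freq n)"
      using S f nsq_nonneg[of n] by (intro mult_mono) auto
    also have "\<dots> = 2" using f by simp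
    finally have 1: "\<bar>dw_S_re t n\<bar> * sqrt (nsq n) \<le> 2" .
    have 2: "1 / dw_freq n \<le> 2" using f by (simp add: divide_le_eq)
    have "\<bar>cos (dw_freq n * t) - sin (dw_freq n * t) / (2 * dw_freq n)\<bar> \<le> 1 + 1"
    proof -
      have "\<bar>sin (dw_freq n * t) / (2 * dw_freq n)\<bar> \<le> 1 / (2 * dw_freq n)"
        using f by (simp add: divide_right_mono)
      also have "\<dots> \<le> 1" using f by (simp add: divide_le_eq)
      finally show ?thesis using abs_cos_le_one[of "dw_freq n * t"] by linarith
    qed
    then have "exp (- t / 2) * \<bar>cos (dw_freq n * t) - sin (dw_freq n * t) / (2 * dw_freq n)\<bar> \<le> 1 * 2"
      using e by (intro mult_mono) auto
    then have "\<bar>dw_Sd_re t n\<bar> \<le> 2" using False by (simp add: dw_Sd_re_def abs_mult)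
    with 1 2 S show ?thesis by linarith
  qed
  then show "\<bar>dw_S_re t n\<bar> * sqrt (nsq n) \<le> 2" "\<bar>dw_S_re t n\<bar> \<le> 2" "\<bar>dw_Sd_re t n\<bar> \<le> 2" by auto
qed

lemma dw_minus: "dw_S_re t (- n) = dw_S_re t n" "dw_Sd_re t (- n) = dw_Sd_re t n"
  by (simp_all add: dw_S_re_def dw_Sd_re_def dw_freq_def)

lemma continuous_dw [continuous_intros]:
  assumes "continuous_on S f"
  shows "continuous_on S (\<lambda>x. dw_S_re (f x) n)" "continuous_on S (\<lambda>x. dw_Sd_re (f x) n)"
proof -
  have m: "continuous_on S (\<lambda>x. dw_freq n * f x)" by (intro continuous_on_mult continuous_on_const assms)
  have sc: "continuous_on S (\<lambda>x. sin (dw_freq n * f x))" "continuous_on S (\<lambda>x. cos (dw_freq n * f x))"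
    using continuous_on_compose2[OF _ m, of UNIV sin] continuous_on_compose2[OF _ m, of UNIV cos]
    by (auto intro: isCont_sin isCont_cos continuous_at_imp_continuous_on)
  have e: "continuous_on S (\<lambda>x. exp (- f x / 2))" "continuous_on S (\<lambda>x. exp (- f x))"
    by (intro continuous_intros assms; simp)+
  have "continuous_on S (\<lambda>x. exp (- f x / 2) * sin (dw_freq n * f x) / dw_freq n)" if "nsq n \<noteq> 0"
    using dw_freq_pos[OF that] by (intro continuous_on_divide continuous_on_mult continuous_on_const sc e) auto
  then show "continuous_on S (\<lambda>x. dw_S_re (f x) n)"
    unfolding dw_S_re_def by (cases "nsq n = 0") (simp_all add: continuous_on_diff e)
  have "continuous_on S (\<lambda>x. exp (- f x / 2) * (cos (dw_freq n * f x) - sin (dw_freq n * f x) / (2 * dw_freq n)))" if "nsq n \<noteq> 0"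
    using dw_freq_pos[OF that]
    by (intro continuous_on_divide continuous_on_diff continuous_on_mult continuous_on_const sc e) auto
  then show "continuous_on S (\<lambda>x. dw_Sd_re (f x) n)"
    unfolding dw_Sd_re_def by (cases "nsq n = 0") (simp_all add: e)
qed

lemma heat_bound: "0 < \<nu> \<Longrightarrow> 0 \<le> \<tau> \<Longrightarrow> cmod (heat \<nu> \<tau> n) \<le> 1"
  using nsq_nonneg[of n] by (simp add: heat_def)

text \<open>With x = \<nu> |n|^2 \<tau> this is sqrt x <= 1 + x <= exp x, divided by sqrt (\<nu> *
  \<tau>).\<close>

lemma heat_grad_bound:
  assumes "0 < \<nu>" "0 < \<tau>"
  shows "cmod (heat \<nu> \<tau> n) * sqrt (nsq n) \<le> 1 / sqrt \<nu> / sqrt \<tau>"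
proof -
  define x where "x = \<nu> * nsq n * \<tau>"
  have x: "0 \<le> x" using assms nsq_nonneg[of n] by (simp add: x_def)
  have "sqrt x \<le> 1 + x"
  proof (rule real_le_lsqrt)
    show "x \<le> (1 + x)\<^sup>2" using x by (simp add: power2_eq_square algebra_simps)
  qed (use x in auto)
  also have "\<dots> \<le> exp x" by (rule exp_ge_add_one_self)
  finally have "exp (- x) * sqrt x \<le> 1" by (simp add: exp_minus field_simps)
  moreover have "sqrt x = sqrt (nsq n) * (sqrt \<nu> * sqrt \<tau>)" by (simp add: x_def real_sqrt_mult mult_ac)
  ultimately have "exp (- x) * sqrt (nsq n) * (sqrt \<nu> * sqrt \<tau>) \<le> 1" by (simp add: mult_ac)
  then have "exp (- x) * sqrt (nsq n) \<le> 1 / (sqrt \<nu> * sqrt \<tau>)"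
    using assms by (simp add: pos_le_divide_eq)
  moreover have "cmod (heat \<nu> \<tau> n) = exp (- x)" by (simp add: heat_def x_def)
  ultimately show ?thesis by simp
qed

section \<open>Conjugation symmetry of solutions\<close>

lemma (in bbound) conv_equivariant:
  fixes f :: "'g::ab_group_add \<Rightarrow> 'a"
  assumes J: "bounded_linear J''" "\<And>x y. J'' (prod x y) = prod (J x) (J' y)"
    and b: "sum_bd (\<lambda>n. norm (f n)) A" "sum_bd (\<lambda>n. norm (g n)) B"
  shows "J'' (conv prod f g (- n)) = conv prod (\<lambda>m. J (f (- m))) (\<lambda>m. J' (g (- m))) n"
proof -
  have "((\<lambda>m. prod (f m) (g (- n - m))) has_sum conv prod f g (- n)) UNIV"
    unfolding conv_def by (rule has_sum_infsum[OF conv_summable(2)[OF b order.refl order.refl]])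
  from has_sum_bounded_linear[OF J(1) this]
  have "J'' (conv prod f g (- n)) = (\<Sum>\<^sub>\<infinity>m. prod (J (f m)) (J' (g (- n - m))))"
    by (simp add: J(2) infsumI)
  also have "\<dots> = (\<Sum>\<^sub>\<infinity>m. prod (J (f (- m))) (J' (g (- (n - m)))))"
    by (rule infsum_reindex_bij_witness[of _ uminus uminus]) auto
  finally show ?thesis by (simp add: conv_def)
qed

context mild
begin

text \<open>The conjugate of u at -n solves the same equation with the same free part, so uniqueness
  identifies it with u. This is how the complex iteration is known to produce coefficients of real
  functions.\<close>

lemma mild_equivariant:
  assumes J: "bounded_linear cnj_state" "bounded_linear cnj_force" and JN: "\<And>x. norm (cnj_state x) = norm x"
    and JP: "\<And>x y. cnj_force (P x y) = P (cnj_state x) (cnj_state y)" and JR: "\<And>x y. cnj_force (R x y) = R (cnj_force x) (cnj_state y)"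
    and JK: "\<And>\<tau> n z. cnj_state (Ker \<tau> n z) = Ker \<tau> (- n) (cnj_force z)"
    and JL: "\<And>t n. cnj_state (L t n) = L t (- n)"
    and T: "0 \<le> T" "T \<le> 1"
    and s: "\<And>t. t \<in> {0..T} \<Longrightarrow> (\<lambda>n. norm (u t n)) summable_on UNIV"
    and cont: "\<And>t0. t0 \<in> {0..T} \<Longrightarrow> ((\<lambda>t. \<Sum>\<^sub>\<infinity>n. norm (u t n - u t0 n)) \<longlongrightarrow> 0) (at t0 within {0..T})"
    and eq: "\<And>t n. t \<in> {0..T} \<Longrightarrow> u t n = L t n + duhamel (\<lambda>s. forcing (u s)) t n"
    and t: "t \<in> {0..T}"
  shows "u t (- n) = cnj_state (u t n)"
proof -
  define v where "v t n = cnj_state (u t (- n))" for t n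
  obtain \<rho> where b: "\<And>t. t \<in> {0..T} \<Longrightarrow> sum_bd (\<lambda>n. norm (u t n)) \<rho>"
    using l1_cont_bounded[OF s cont] by blast
  have r: "(\<Sum>\<^sub>\<infinity>m. f (- m :: 'g)) = (\<Sum>\<^sub>\<infinity>m. (f m :: real))" for f
    using infsum_reflect[of f 0] by simp
  have FFv: "forcing (v s) n = cnj_force (forcing (u s) (- n))" if "s \<in> {0..T}" for s n
  proof -
    have 1: "conv P (v s) (v s) n = cnj_force (conv P (u s) (u s) (- n))" for n
      using P.conv_equivariant[OF J(2) JP b b, of s s n] that by (simp add: v_def[abs_def])
    have "conv R (conv P (v s) (v s)) (v s) n = cnj_force (conv R (conv P (u s) (u s)) (u s) (- n))"
      unfolding 1[abs_def]
      using R.conv_equivariant[OF J(2) JR P.conv_sum_bd[OF b b] b, of s s s n] that by (simp add: v_def[abs_def])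
    then show ?thesis by (simp add: forcing_def 1 linear_add[OF bounded_linear.linear[OF J(2)]])
  qed
  have "u t = v t"
  proof (rule mild_unique[OF T s _ cont _ eq _ t])
    show "(\<lambda>n. norm (v t n)) summable_on UNIV" if "t \<in> {0..T}" for t
      using s[OF that] summable_reflect[of "\<lambda>n. norm (u t n)" 0] by (simp add: v_def JN)
    show "((\<lambda>t. \<Sum>\<^sub>\<infinity>n. norm (v t n - v t0 n)) \<longlongrightarrow> 0) (at t0 within {0..T})" if "t0 \<in> {0..T}" for t0
    proof -
      have "(\<Sum>\<^sub>\<infinity>n. norm (v t n - v t0 n)) = (\<Sum>\<^sub>\<infinity>n. norm (u t n - u t0 n))" for t
        unfolding v_def linear_diff[OF bounded_linear.linear[OF J(1)], symmetric] JN
        by (rule r[of "\<lambda>n. norm (u t n - u t0 n)"])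
      then show ?thesis using cont[OF that] by simp
    qed
    show "v t n = L t n + duhamel (\<lambda>s. forcing (v s)) t n" if t: "t \<in> {0..T}" for t n
    proof -
      have sub: "{0..t} \<subseteq> {0..T}" using t by auto
      have c: "continuous_on {0..t} (\<lambda>s. forcing (u s) (- n))"
        by (rule continuous_on_subset[OF forcing_cont_of_l1_cont[OF b cont] sub])
      have "cnj_state (duhamel (\<lambda>s. forcing (u s)) t (- n)) = integral {0..t} (cnj_state \<circ> (\<lambda>s. Ker (t - s) (- n) (forcing (u s) (- n))))"
        unfolding duhamel_def
        by (rule integral_linear[symmetric, OF integrable_continuous_real[OF duhamel_integrand_cont[of t "\<lambda>s. forcing (u s)", OF c]] J(1)])
      also have "\<dots> = duhamel (\<lambda>s. forcing (v s)) t n"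
        unfolding duhamel_def by (rule integral_cong) (use FFv sub in \<open>auto simp: JK\<close>)
      finally have "cnj_state (duhamel (\<lambda>s. forcing (u s)) t (- n)) = duhamel (\<lambda>s. forcing (v s)) t n" .
      moreover have "v t n = cnj_state (L t (- n)) + cnj_state (duhamel (\<lambda>s. forcing (u s)) t (- n))"
        unfolding v_def by (subst eq[OF t]) (rule linear_add[OF bounded_linear.linear[OF J(1)]])
      ultimately show ?thesis by (simp add: JL)
    qed
  qed
  from fun_cong[OF this, of "- n"] show ?thesis unfolding v_def minus_minus .
qed

end

section \<open>The system as an instance of the abstract equation\<close>

definition outer3 :: "C3 \<Rightarrow> C3 \<Rightarrow> complex^3^3" where
  "outer3 a b = (\<chi> k. (a $ k) *s b)"

definition mhd_quad :: "cstate \<Rightarrow> cstate \<Rightarrow> cforce" where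
  "mhd_quad x y = (cross3 (snd (snd x)) (fst (snd y)), outer3 (fst x) (fst y), cross3 (fst x) (fst (snd y)))"

text \<open>Eliminating j = E + v x B splits j x B into the quadratic E x B, placed in
  \<open>mhd_quad\<close>, and (v x B) x B here, with v x B read off the third slot of the
  force.\<close>

definition mhd_cub :: "cforce \<Rightarrow> cstate \<Rightarrow> cforce" where
  "mhd_cub x y = (cross3 (snd (snd x)) (fst (snd y)), 0, 0)"

definition tensor_div :: "Z3 \<Rightarrow> complex^3^3 \<Rightarrow> C3" where
  "tensor_div n M = (\<Sum>k\<in>UNIV. (\<i> * of_int (n$k)) *s (M $ k))"

text \<open>The divergence of v v is subtracted inside the heat slot. The third slot adds the
  divergence-free and the gradient part of E, which the system propagates differently.\<close>

definition mhd_kernel :: "real \<Rightarrow> real \<Rightarrow> Z3 \<Rightarrow> cforce \<Rightarrow> cstate" where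
  "mhd_kernel \<nu> \<tau> n y =
    (heat \<nu> \<tau> n *s leray n (fst y - tensor_div n (fst (snd y))),
     dw_S \<tau> n *s curl_hat n (snd (snd y)),
     - (dw_Sd \<tau> n *s leray n (snd (snd y))) - complex_of_real (exp (- \<tau>)) *s leray_c n (snd (snd y)))"

definition mhd_free :: "real \<Rightarrow> (Z3 \<Rightarrow> C3) \<Rightarrow> (Z3 \<Rightarrow> C3) \<Rightarrow> (Z3 \<Rightarrow> C3) \<Rightarrow> real \<Rightarrow> Z3 \<Rightarrow> cstate" where
  "mhd_free \<nu> v B E t n =
    (heat \<nu> t n *s v n,
     (dw_Sd t n + dw_S t n) *s B n + dw_S t n *s (- curl_hat n (E n)),
     (dw_Sd t n *s leray n (E n) + dw_S t n *s curl_hat n (B n)) + complex_of_real (exp (- t)) *s leray_c n (E n))"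

lemma linear_cross3: "linear (\<lambda>x. cross3 x (b :: C3))" "linear (\<lambda>x. cross3 a (x :: C3))"
proof -
  show "linear (\<lambda>x. cross3 x b)"
    by (rule linear_smultI) (auto simp: vec_eq_iff forall_3 algebra_simps)
  show "linear (\<lambda>x. cross3 a x)"
    by (rule linear_smultI) (auto simp: vec_eq_iff forall_3 algebra_simps)
qed

lemma linear_outer3: "linear (\<lambda>x. outer3 x b)" "linear (\<lambda>x. outer3 a x)"
  by (auto simp: vec_eq_iff outer3_def algebra_simps scaleR_smult intro!: linearI)

lemma norm_outer3: "norm (outer3 a b) \<le> 3 * (norm a * norm b)"
proof -
  have "norm (outer3 a b $ k) \<le> norm a * norm b" for k
    by (auto simp: outer3_def norm_smult intro!: mult_mono Finite_Cartesian_Product.norm_nth_le)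
  from norm_vec3_le[OF this] show ?thesis by simp
qed

lemma norm_triple_le: "norm (a, b, c) \<le> norm a + norm b + norm c"
  using norm_Pair_le[of a "(b, c)"] norm_Pair_le[of b c] by linarith

lemma norm_triple_ge: "norm (fst x) \<le> norm x" "norm (fst (snd x)) \<le> norm x" "norm (snd (snd x)) \<le> norm x"
  using norm_fst_le[of "fst x" "snd x"] norm_snd_le[of "snd x" "fst x"]
    norm_fst_le[of "fst (snd x)" "snd (snd x)"] norm_snd_le[of "snd (snd x)" "fst (snd x)"] by auto

lemma bboundI:
  assumes "\<And>y. linear (\<lambda>x. f x y)" "\<And>x. linear (f x)" "\<And>x y. norm (f x y) \<le> K * (norm x * norm y)" "0 \<le> K"
  shows "bbound f K"
proof -
  have "norm (f x y) \<le> norm x * norm y * K" for x y using assms(3)[of x y] by (simp add: mult_ac)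
  then show ?thesis
    using assms by unfold_locales (auto simp: linear_add linear_scale intro!: exI[of _ K]
      simp: linear_add[OF assms(1)] linear_scale[OF assms(1)] linear_add[OF assms(2)] linear_scale[OF assms(2)])
qed

lemma norm_cross3_le: "norm a \<le> A \<Longrightarrow> norm b \<le> B \<Longrightarrow> norm (cross3 a (b :: C3)) \<le> 6 * (A * B)"
  by (rule order_trans[OF norm_cross3]) (auto intro!: mult_mono order_trans[OF norm_ge_zero])

lemma norm_outer3_le: "norm a \<le> A \<Longrightarrow> norm b \<le> B \<Longrightarrow> norm (outer3 a b) \<le> 3 * (A * B)"
  by (rule order_trans[OF norm_outer3]) (auto intro!: mult_mono order_trans[OF norm_ge_zero])

text \<open>15 = 6 + 3 + 6, from two cross products and one outer product.\<close>

lemma bbound_mhd_quad: "bbound mhd_quad 15"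
proof (rule bboundI)
  show "linear (\<lambda>x. mhd_quad x y)" for y
    by (rule linearI) (auto simp: mhd_quad_def linear_add[OF linear_cross3(1)] linear_scale[OF linear_cross3(1)]
        linear_add[OF linear_outer3(1)] linear_scale[OF linear_outer3(1)])
  show "linear (mhd_quad x)" for x
    by (rule linearI) (auto simp: mhd_quad_def linear_add[OF linear_cross3(2)] linear_scale[OF linear_cross3(2)]
        linear_add[OF linear_outer3(2)] linear_scale[OF linear_outer3(2)])
  show "norm (mhd_quad x y) \<le> 15 * (norm x * norm y)" for x y
    using norm_cross3_le[OF norm_triple_ge(3)[of x] norm_triple_ge(2)[of y]]
      norm_outer3_le[OF norm_triple_ge(1)[of x] norm_triple_ge(1)[of y]]
      norm_cross3_le[OF norm_triple_ge(1)[of x] norm_triple_ge(2)[of y]]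
      norm_triple_le[of "cross3 (snd (snd x)) (fst (snd y))" "outer3 (fst x) (fst y)" "cross3 (fst x) (fst (snd y))"]
    unfolding mhd_quad_def by linarith
qed simp

lemma bbound_mhd_cub: "bbound mhd_cub 6"
proof (rule bboundI)
  show "linear (\<lambda>x. mhd_cub x y)" for y
    by (rule linearI) (auto simp: mhd_cub_def linear_add[OF linear_cross3(1)] linear_scale[OF linear_cross3(1)])
  show "linear (mhd_cub x)" for x
    by (rule linearI) (auto simp: mhd_cub_def linear_add[OF linear_cross3(2)] linear_scale[OF linear_cross3(2)])
  show "norm (mhd_cub x y) \<le> 6 * (norm x * norm y)" for x y
    using norm_cross3_le[OF norm_triple_ge(3)[of x] norm_triple_ge(2)[of y]]
      norm_triple_le[of "cross3 (snd (snd x)) (fst (snd y))" "0 :: complex^3^3" "0 :: C3"]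
    unfolding mhd_cub_def by simp
qed simp

lemma norm_tensor_div: "norm (tensor_div n M) \<le> 3 * sqrt (nsq n) * norm M"
proof -
  have "norm (tensor_div n M) \<le> (\<Sum>k\<in>UNIV. norm ((\<i> * of_int (n$k)) *s (M $ k)))"
    unfolding tensor_div_def by (rule norm_sum)
  also have "\<dots> \<le> (\<Sum>k\<in>(UNIV :: 3 set). sqrt (nsq n) * norm M)"
  proof (rule sum_mono)
    fix k :: 3
    have "norm (cvec n $ k) \<le> norm (cvec n)" by (rule Finite_Cartesian_Product.norm_nth_le)
    then have "cmod (\<i> * of_int (n$k)) \<le> sqrt (nsq n)" by (simp add: norm_cvec norm_mult)
    then show "norm ((\<i> * of_int (n$k)) *s (M $ k)) \<le> sqrt (nsq n) * norm M"
      unfolding norm_smult by (intro mult_mono Finite_Cartesian_Product.norm_nth_le) (auto simp: nsq_nonneg)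
  qed
  finally show ?thesis by simp
qed

lemma linear_tensor_div: "linear (tensor_div n)"
  by (rule linearI) (auto simp: tensor_div_def vec_eq_iff sum.distrib algebra_simps scaleR_sum_right)

lemma linear_mhd_kernel: "linear (mhd_kernel \<nu> \<tau> n)"
  by (rule linearI)
     (auto simp: mhd_kernel_def linear_add[OF linear_smult] linear_add[OF linear_leray] linear_add[OF linear_tensor_div]
        linear_add[OF linear_curl_hat] linear_add[OF linear_leray_c] linear_diff[OF linear_leray] linear_diff[OF linear_smult]
        linear_scale[OF linear_smult] linear_scale[OF linear_leray] linear_scale[OF linear_tensor_div]
        linear_scale[OF linear_curl_hat] linear_scale[OF linear_leray_c] scaleR_right_diff_distrib)

text \<open>29 = 4 + 12 + 13 collects the bounded parts of the three slots, and 12 = 4 * 3 belongs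
  to the divergence under the heat kernel, the only part that is singular as \<tau> tends to 0. The
  bounded parts are weakened to 1 / sqrt \<tau> using \<tau> <= 1.\<close>

lemma mhd_kernel_bound:
  assumes "0 < \<nu>" "0 < \<tau>" "\<tau> \<le> 1"
  shows "norm (mhd_kernel \<nu> \<tau> n y) \<le> (29 + 12 / sqrt \<nu>) / sqrt \<tau> * norm y"
proof -
  obtain a M b where y: "y = (a, M, b)" by (cases y) auto
  have ab: "norm a \<le> norm y" "norm M \<le> norm y" "norm b \<le> norm y"
    using norm_triple_ge[of y] by (simp_all add: y)
  have "norm (heat \<nu> \<tau> n *s leray n (a - tensor_div n M)) \<le> cmod (heat \<nu> \<tau> n) * (4 * (norm a + 3 * sqrt (nsq n) * norm M))"
    unfolding norm_smult
    using norm_leray[of n "a - tensor_div n M"] norm_triangle_ineq4[of a "tensor_div n M"] norm_tensor_div[of n M]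
    by (intro mult_left_mono) auto
  also have "\<dots> = 4 * (cmod (heat \<nu> \<tau> n) * norm a) + 12 * (cmod (heat \<nu> \<tau> n) * sqrt (nsq n)) * norm M"
    by (simp add: algebra_simps)
  also have "\<dots> \<le> 4 * (1 * norm y) + 12 * (1 / sqrt \<nu> / sqrt \<tau>) * norm y"
    using heat_bound[of \<nu> \<tau> n] heat_grad_bound[of \<nu> \<tau> n] assms ab
    by (intro add_mono mult_mono mult_left_mono) auto
  finally have 1: "norm (heat \<nu> \<tau> n *s leray n (a - tensor_div n M)) \<le> 4 * norm y + 12 / sqrt \<nu> / sqrt \<tau> * norm y" by simp
  have "norm (dw_S \<tau> n *s curl_hat n b) \<le> \<bar>dw_S_re \<tau> n\<bar> * (6 * sqrt (nsq n) * norm b)"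
    unfolding norm_smult dw_eq_re using norm_curl_hat[of n b] by (simp add: mult_left_mono)
  also have "\<dots> = 6 * (\<bar>dw_S_re \<tau> n\<bar> * sqrt (nsq n)) * norm b" by simp
  also have "\<dots> \<le> 6 * 2 * norm y"
    using dw_re_bound(1)[of \<tau> n] assms ab by (intro mult_mono) (auto simp: nsq_nonneg)
  finally have 2: "norm (dw_S \<tau> n *s curl_hat n b) \<le> 12 * norm y" by simp
  have "norm (dw_Sd \<tau> n *s leray n b) \<le> 2 * (4 * norm b)"
    unfolding norm_smult dw_eq_re using norm_leray[of n b] dw_re_bound(3)[of \<tau> n] assms by (intro mult_mono) auto
  moreover have "norm (complex_of_real (exp (- \<tau>)) *s leray_c n b) \<le> 1 * (5 * norm b)"
    unfolding norm_smult using norm_leray_c[of n b] assms by (intro mult_mono) auto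
  ultimately have 3: "norm (- (dw_Sd \<tau> n *s leray n b) - complex_of_real (exp (- \<tau>)) *s leray_c n b) \<le> 13 * norm y"
    using norm_triangle_ineq4[of "- (dw_Sd \<tau> n *s leray n b)" "complex_of_real (exp (- \<tau>)) *s leray_c n b"] ab by simp
  have "norm (mhd_kernel \<nu> \<tau> n y) \<le> 29 * norm y + 12 / sqrt \<nu> / sqrt \<tau> * norm y"
    unfolding mhd_kernel_def y using 1 2 3 by (intro order_trans[OF norm_triple_le]) (auto simp: y)
  also have "\<dots> \<le> 29 / sqrt \<tau> * norm y + 12 / sqrt \<nu> / sqrt \<tau> * norm y"
  proof -
    have "29 * 1 \<le> 29 / sqrt \<tau>" using assms by (simp add: le_divide_eq)
    then show ?thesis by (intro add_right_mono mult_right_mono) auto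
  qed
  finally show ?thesis by (simp add: algebra_simps add_divide_distrib)
qed

lemma continuous_smult [continuous_intros]:
  assumes "continuous_on S f" "continuous_on S g"
  shows "continuous_on S (\<lambda>x. f x *s (g x :: complex^'n))"
  unfolding vector_scalar_mult_def using assms by (intro continuous_intros) auto

lemma continuous_linear:
  fixes F :: "'a::euclidean_space \<Rightarrow> 'b::real_normed_vector"
  assumes "linear F" "continuous_on S g"
  shows "continuous_on S (\<lambda>x. F (g x))"
  by (rule continuous_on_compose2[OF linear_continuous_on[of F UNIV] assms(2)])
     (use assms(1) in \<open>auto simp: linear_conv_bounded_linear\<close>)

lemma continuous_heat [continuous_intros]: "continuous_on S f \<Longrightarrow> continuous_on S (\<lambda>x. heat \<nu> (f x) n)"
  unfolding heat_def by (intro continuous_intros)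

lemma mhd_kernel_cont: "continuous_on S (\<lambda>(\<tau>, y). mhd_kernel \<nu> \<tau> n y)"
  unfolding mhd_kernel_def split_beta dw_eq_re
  by (intro continuous_intros continuous_linear[OF linear_leray] continuous_linear[OF linear_leray_c]
      continuous_linear[OF linear_curl_hat] continuous_linear[OF linear_tensor_div])

lemma mild_mhd: "0 < \<nu> \<Longrightarrow> mild mhd_quad 15 mhd_cub 6 (mhd_kernel \<nu>) (29 + 12 / sqrt \<nu>)"
  by (intro mild.intro mild_axioms.intro bbound_mhd_quad bbound_mhd_cub linear_mhd_kernel mhd_kernel_cont mhd_kernel_bound) auto

lemma mhd_free_cont: "continuous_on S (\<lambda>t. mhd_free \<nu> v B E t n)"
  unfolding mhd_free_def dw_eq_re by (intro continuous_intros)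

text \<open>25 = 12 + 13 is the total coefficient of E, the largest of the three; the curl terms are
  absorbed by the derivative gain of the wave propagator.\<close>

lemma mhd_free_bound:
  assumes "0 < \<nu>" "0 \<le> t"
  shows "norm (mhd_free \<nu> v B E t n) \<le> 25 * (norm (v n) + norm (B n) + norm (E n))"
proof -
  have S: "\<bar>dw_S_re t n\<bar> \<le> 2" "\<bar>dw_Sd_re t n\<bar> \<le> 2" "\<bar>dw_S_re t n\<bar> * sqrt (nsq n) \<le> 2"
    using dw_re_bound assms by auto
  have c: "norm (dw_S t n *s curl_hat n a) \<le> 12 * norm a" for a
  proof -
    have "norm (dw_S t n *s curl_hat n a) \<le> \<bar>dw_S_re t n\<bar> * (6 * sqrt (nsq n) * norm a)"
      unfolding norm_smult dw_eq_re using norm_curl_hat[of n a] by (simp add: mult_left_mono)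
    also have "\<dots> = 6 * (\<bar>dw_S_re t n\<bar> * sqrt (nsq n)) * norm a" by simp
    also have "\<dots> \<le> 6 * 2 * norm a" using S by (intro mult_mono) (auto simp: nsq_nonneg)
    finally show ?thesis by simp
  qed
  have 1: "norm (heat \<nu> t n *s v n) \<le> norm (v n)"
    using heat_bound[of \<nu> t n] assms by (simp add: norm_smult mult_left_le_one_le)
  have "norm ((dw_Sd t n + dw_S t n) *s B n) \<le> 4 * norm (B n)"
    unfolding norm_smult dw_eq_re using S norm_triangle_ineq[of "complex_of_real (dw_Sd_re t n)" "complex_of_real (dw_S_re t n)"]
    by (intro mult_right_mono) auto
  moreover have "norm (dw_S t n *s (- curl_hat n (E n))) \<le> 12 * norm (E n)"
    using c[of "E n"] by (simp add: norm_smult)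
  ultimately have 2: "norm ((dw_Sd t n + dw_S t n) *s B n + dw_S t n *s (- curl_hat n (E n))) \<le> 4 * norm (B n) + 12 * norm (E n)"
    using norm_triangle_ineq[of "(dw_Sd t n + dw_S t n) *s B n" "dw_S t n *s (- curl_hat n (E n))"] by linarith
  have "norm (dw_Sd t n *s leray n (E n)) \<le> 2 * (4 * norm (E n))"
    unfolding norm_smult dw_eq_re using norm_leray[of n "E n"] S by (intro mult_mono) auto
  moreover have "norm (complex_of_real (exp (- t)) *s leray_c n (E n)) \<le> 1 * (5 * norm (E n))"
    unfolding norm_smult using norm_leray_c[of n "E n"] assms by (intro mult_mono) auto
  ultimately have 3: "norm ((dw_Sd t n *s leray n (E n) + dw_S t n *s curl_hat n (B n)) + complex_of_real (exp (- t)) *s leray_c n (E n))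
      \<le> 13 * norm (E n) + 12 * norm (B n)"
    using c[of "B n"] norm_triangle_ineq[of "dw_Sd t n *s leray n (E n) + dw_S t n *s curl_hat n (B n)" "complex_of_real (exp (- t)) *s leray_c n (E n)"]
      norm_triangle_ineq[of "dw_Sd t n *s leray n (E n)" "dw_S t n *s curl_hat n (B n)"] by linarith
  have "norm (v n) + (4 * norm (B n) + 12 * norm (E n)) + (13 * norm (E n) + 12 * norm (B n)) \<le>
      25 * (norm (v n) + norm (B n) + norm (E n))"
    using norm_ge_zero[of "v n"] norm_ge_zero[of "B n"] by (simp add: algebra_simps)
  then show ?thesis unfolding mhd_free_def
    by (rule order_trans[OF order_trans[OF norm_triple_le add_mono[OF add_mono[OF 1 2] 3]]])
qed

section \<open>Compatibility of the system with complex conjugation\<close>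

definition cnj_state :: "cstate \<Rightarrow> cstate" where
  "cnj_state x = (cnj_vec (fst x), cnj_vec (fst (snd x)), cnj_vec (snd (snd x)))"

definition cnj_force :: "cforce \<Rightarrow> cforce" where
  "cnj_force x = (cnj_vec (fst x), (\<chi> k. cnj_vec (fst (snd x) $ k)), cnj_vec (snd (snd x)))"

lemma bounded_linear_cnj_state: "bounded_linear cnj_state"
  unfolding linear_conv_bounded_linear[symmetric]
  by (rule linearI) (auto simp: cnj_state_def linear_add[OF linear_cnj_vec] linear_scale[OF linear_cnj_vec])

lemma bounded_linear_cnj_force: "bounded_linear cnj_force"
  unfolding linear_conv_bounded_linear[symmetric]
  by (rule linearI) (auto simp: cnj_force_def linear_add[OF linear_cnj_vec] linear_scale[OF linear_cnj_vec] vec_eq_iff)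

lemma norm_cnj_state: "norm (cnj_state x) = norm x"
  by (simp add: cnj_state_def norm_prod_def)

lemma cnj_force_quad: "cnj_force (mhd_quad x y) = mhd_quad (cnj_state x) (cnj_state y)"
  by (auto simp: cnj_force_def mhd_quad_def cnj_state_def cnj_vec_cross3 outer3_def vec_eq_iff)

lemma cnj_force_cub: "cnj_force (mhd_cub x y) = mhd_cub (cnj_force x) (cnj_state y)"
  by (auto simp: cnj_force_def mhd_cub_def cnj_state_def cnj_vec_cross3 vec_eq_iff)

lemma cnj_vec_tensor_div: "cnj_vec (tensor_div n M) = tensor_div (- n) (\<chi> k. cnj_vec (M $ k))"
  by (auto simp: tensor_div_def vec_eq_iff)

lemma cnj_vec_smult: "cnj_vec (c *s a) = cnj c *s cnj_vec a"
  by (auto simp: vec_eq_iff)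

lemma cnj_state_kernel: "cnj_state (mhd_kernel \<nu> \<tau> n z) = mhd_kernel \<nu> \<tau> (- n) (cnj_force z)"
  by (simp add: cnj_state_def mhd_kernel_def cnj_force_def dw_eq_re cnj_vec_smult cnj_vec_leray cnj_vec_leray_c cnj_vec_curl_hat heat_def dw_minus
      linear_diff[OF linear_cnj_vec] linear_neg[OF linear_cnj_vec] cnj_vec_tensor_div)

lemma cnj_state_free:
  assumes "\<And>n. v (- n) = cnj_vec (v n)" "\<And>n. B (- n) = cnj_vec (B n)" "\<And>n. E (- n) = cnj_vec (E n)"
  shows "cnj_state (mhd_free \<nu> v B E t n) = mhd_free \<nu> v B E t (- n)"
  by (simp add: cnj_state_def mhd_free_def dw_eq_re cnj_vec_smult cnj_vec_leray cnj_vec_leray_c cnj_vec_curl_hat heat_def dw_minus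
      linear_add[OF linear_cnj_vec] linear_diff[OF linear_cnj_vec] linear_neg[OF linear_cnj_vec] assms)

section \<open>The system in Fourier coefficients\<close>

lemma has_sum_vec:
  fixes f :: "'a \<Rightarrow> ('b::real_normed_vector)^'n"
  assumes "\<And>i. ((\<lambda>x. f x $ i) has_sum S $ i) A"
  shows "(f has_sum S) A"
  unfolding has_sum_def
  by (rule vec_tendstoI) (use assms in \<open>simp add: has_sum_def\<close>)

lemma has_sum_Pair:
  fixes f :: "'a \<Rightarrow> 'b::real_normed_vector" and g :: "'a \<Rightarrow> 'c::real_normed_vector"
  assumes "(f has_sum S) A" "(g has_sum S') A"
  shows "((\<lambda>x. (f x, g x)) has_sum (S, S')) A"
proof -
  have "sum (\<lambda>x. (f x, g x)) = (\<lambda>X. (sum f X, sum g X))"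
    by (auto simp: fun_eq_iff prod_eq_iff fst_sum snd_sum)
  then show ?thesis
    using tendsto_Pair[OF assms[unfolded has_sum_def]] unfolding has_sum_def by simp
qed

text \<open>The Wiener algebra of absolutely convergent Fourier series, in its continuous
  representatives: the class in which all products of the system become convolutions.\<close>

definition wiener :: "(R3 \<Rightarrow> real) \<Rightarrow> bool" where
  "wiener f \<longleftrightarrow> periodic3 f \<and> continuous_on UNIV f \<and> (\<lambda>n. cmod (fc f n)) summable_on UNIV"

definition wiener_v :: "(R3 \<Rightarrow> R3) \<Rightarrow> bool" where
  "wiener_v u \<longleftrightarrow> (\<forall>i. wiener (\<lambda>x. u x $ i))"

lemma wt_ge_1: "0 \<le> s \<Longrightarrow> 1 \<le> wt s n"
  unfolding wt_def using nsq_nonneg[of n] by (intro ge_one_powr_ge_zero) auto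

lemma wt_pos: "0 < wt s n"
  unfolding wt_def using nsq_nonneg[of n] by auto

lemma in_X_wiener:
  assumes "in_X s f" "0 \<le> s"
  shows "wiener f"
proof -
  have "(\<lambda>n. cmod (fc f n)) summable_on UNIV"
  proof (rule summable_on_comparison_test)
    show "(\<lambda>n. wt s n * cmod (fc f n)) summable_on UNIV" using assms by (simp add: in_X_def)
    show "cmod (fc f n) \<le> wt s n * cmod (fc f n)" for n
      using wt_ge_1[OF assms(2), of n] mult_right_mono[of 1 "wt s n" "cmod (fc f n)"] by simp
  qed simp
  then show ?thesis using assms by (simp add: wiener_def in_X_def)
qed

lemma in_Xv_wiener: "in_Xv s u \<Longrightarrow> 0 \<le> s \<Longrightarrow> wiener_v u"
  by (auto simp: wiener_v_def in_Xv_def intro: in_X_wiener)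

lemma bbound_complex_mult: "bbound ((*) :: complex \<Rightarrow> complex \<Rightarrow> complex) 1"
  by (rule bboundI) (auto simp: norm_mult algebra_simps intro!: linearI)

lemma wiener_mult:
  assumes f: "wiener f" and g: "wiener g"
  shows "((\<lambda>m. fc f m * fc g (n - m)) has_sum fc (\<lambda>x. f x * g x) n) UNIV"
    and "wiener (\<lambda>x. f x * g x)"
proof -
  show hs: "((\<lambda>m. fc f m * fc g (n - m)) has_sum fc (\<lambda>x. f x * g x) n) UNIV" for n
    using f g by (intro fc_mult) (auto simp: wiener_def)
  have "fc (\<lambda>x. f x * g x) = conv (*) (fc f) (fc g)"
    unfolding conv_def by (rule ext) (rule infsumI[OF hs, symmetric])
  moreover have "(\<lambda>n. norm (conv (*) (fc f) (fc g) n)) summable_on UNIV"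
    by (rule sum_bd_summable[OF bbound.conv_sum_bd[OF bbound_complex_mult]])
       (use f g in \<open>auto simp: wiener_def intro!: summable_sum_bd\<close>)
  ultimately show "wiener (\<lambda>x. f x * g x)"
    using f g periodic3_comp2[of f g "(*)"] by (auto simp: wiener_def intro!: continuous_intros)
qed

lemma summable_norm_add:
  assumes "(\<lambda>n. norm (f n)) summable_on A" "(\<lambda>n. norm (g n)) summable_on A"
  shows "(\<lambda>n. norm (f n + g n)) summable_on A" "(\<lambda>n. norm (f n - g n)) summable_on A"
proof -
  have s: "(\<lambda>n. norm (f n) + norm (g n)) summable_on A" by (intro summable_on_add assms)
  show "(\<lambda>n. norm (f n + g n)) summable_on A" "(\<lambda>n. norm (f n - g n)) summable_on A"
    by (rule summable_on_comparison_test[OF s]; simp add: norm_triangle_ineq norm_triangle_ineq4)+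
qed

lemma wiener_add: "wiener f \<Longrightarrow> wiener g \<Longrightarrow> wiener (\<lambda>x. f x + g x)"
  using periodic3_comp2[of f g "(+)"]
  by (auto simp: wiener_def fc_add summable_norm_add intro!: continuous_intros)

lemma wiener_diff: "wiener f \<Longrightarrow> wiener g \<Longrightarrow> wiener (\<lambda>x. f x - g x)"
  using periodic3_comp2[of f g "(-)"]
  by (auto simp: wiener_def fc_diff summable_norm_add intro!: continuous_intros)

lemma wiener_fc_diff: "wiener f \<Longrightarrow> wiener g \<Longrightarrow> fc (\<lambda>x. f x - g x) n = fc f n - fc g n"
  by (simp add: wiener_def fc_diff)

lemma wiener_fc_add: "wiener f \<Longrightarrow> wiener g \<Longrightarrow> fc (\<lambda>x. f x + g x) n = fc f n + fc g n"
  by (simp add: wiener_def fc_add)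

lemma wiener_v_add:
  assumes "wiener_v a" "wiener_v b"
  shows "wiener_v (\<lambda>x. a x + b x)" "fcv (\<lambda>x. a x + b x) n = fcv a n + fcv b n"
  using assms wiener_add wiener_fc_add by (auto simp: wiener_v_def fcv_def vec_eq_iff)

lemma wiener_v_fc_diff:
  assumes "wiener_v a" "wiener_v b"
  shows "fcv (\<lambda>x. a x - b x) n = fcv a n - fcv b n"
  using assms wiener_fc_diff by (auto simp: wiener_v_def fcv_def vec_eq_iff)

lemma wiener_v_summable:
  assumes "wiener_v a"
  shows "(\<lambda>n. norm (fcv a n)) summable_on UNIV"
proof (rule summable_on_comparison_test)
  show "(\<lambda>n. \<Sum>i\<in>UNIV. cmod (fc (\<lambda>x. a x $ i) n)) summable_on UNIV"
    by (rule has_sum_imp_summable, rule has_sum_finite_sum, simp, rule has_sum_infsum)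
       (use assms in \<open>auto simp: wiener_v_def wiener_def\<close>)
  show "norm (fcv a n) \<le> (\<Sum>i\<in>UNIV. cmod (fc (\<lambda>x. a x $ i) n))" for n
    using norm_vec_le_sum[of "fcv a n"] by (simp add: fcv_def)
qed simp

lemma has_sum_diff_complex:
  fixes f g :: "'a \<Rightarrow> complex"
  assumes "(f has_sum S) A" "(g has_sum S') A"
  shows "((\<lambda>x. f x - g x) has_sum (S - S')) A"
proof -
  have "((\<lambda>x. - g x) has_sum - S') A" using assms(2) by (simp add: has_sum_uminus)
  from has_sum_add[OF assms(1) this] show ?thesis by simp
qed

lemma wiener_v_cross3:
  assumes a: "wiener_v a" and b: "wiener_v b"
  shows "wiener_v (\<lambda>x. cross3 (a x) (b x))"
    and "((\<lambda>m. cross3 (fcv a m) (fcv b (n - m))) has_sum fcv (\<lambda>x. cross3 (a x) (b x)) n) UNIV"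
proof -
  have w: "wiener (\<lambda>x. a x $ i)" "wiener (\<lambda>x. b x $ i)" for i
    using a b by (auto simp: wiener_v_def)
  show "wiener_v (\<lambda>x. cross3 (a x) (b x))"
    unfolding wiener_v_def forall_3 cross3_nth by (intro conjI wiener_diff wiener_mult w)
  show "((\<lambda>m. cross3 (fcv a m) (fcv b (n - m))) has_sum fcv (\<lambda>x. cross3 (a x) (b x)) n) UNIV"
  proof (rule has_sum_vec)
    fix i :: 3
    have *: "((\<lambda>m. fcv a m $ j * fcv b (n - m) $ k - fcv a m $ k * fcv b (n - m) $ j) has_sum
        fc (\<lambda>x. a x $ j * b x $ k - a x $ k * b x $ j) n) UNIV" for j k
      unfolding fcv_def vec_lambda_beta wiener_fc_diff[OF wiener_mult(2)[OF w(1) w(2)] wiener_mult(2)[OF w(1) w(2)]]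
      by (intro has_sum_diff_complex wiener_mult w)
    show "((\<lambda>m. cross3 (fcv a m) (fcv b (n - m)) $ i) has_sum fcv (\<lambda>x. cross3 (a x) (b x)) n $ i) UNIV"
      using exhaust_3[of i] * by (auto simp: fcv_def)
  qed
qed

lemma fcv_outer:
  assumes "wiener_v a"
  shows "((\<lambda>m. outer3 (fcv a m) (fcv a (n - m))) has_sum (\<chi> k. fcv (\<lambda>x. (a x $ k) *\<^sub>R a x) n)) UNIV"
proof (intro has_sum_vec)
  fix k i
  show "((\<lambda>m. outer3 (fcv a m) (fcv a (n - m)) $ k $ i) has_sum (\<chi> k. fcv (\<lambda>x. (a x $ k) *\<^sub>R a x) n) $ k $ i) UNIV"
    using assms wiener_mult(1)[of "\<lambda>x. a x $ k" "\<lambda>x. a x $ i" n] by (simp add: outer3_def fcv_def wiener_v_def)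
qed

definition coeffs :: "(R3 \<Rightarrow> R3) \<Rightarrow> (R3 \<Rightarrow> R3) \<Rightarrow> (R3 \<Rightarrow> R3) \<Rightarrow> Z3 \<Rightarrow> cstate" where
  "coeffs v B E n = (fcv v n, fcv B n, fcv E n)"

text \<open>The convolution theorem slot by slot. The cubic term applies it twice, which is
  legitimate because v x B again lies in the Wiener algebra.\<close>

lemma forcing_coeffs:
  assumes v: "wiener_v v" and B: "wiener_v B" and E: "wiener_v E" and "mild mhd_quad K1 mhd_cub K2 (Ker :: real \<Rightarrow> Z3 \<Rightarrow> cforce \<Rightarrow> cstate) c"
  shows "mild.forcing mhd_quad mhd_cub (coeffs v B E) n =
    (fcv (\<lambda>x. cross3 (E x + cross3 (v x) (B x)) (B x)) n,
     (\<chi> k. fcv (\<lambda>x. (v x $ k) *\<^sub>R v x) n),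
     fcv (\<lambda>x. cross3 (v x) (B x)) n)"
proof -
  interpret mild mhd_quad K1 mhd_cub K2 Ker c by fact
  note vB = wiener_v_cross3(1)[OF v B]
  have 1: "conv mhd_quad (coeffs v B E) (coeffs v B E) n =
    (fcv (\<lambda>x. cross3 (E x) (B x)) n, (\<chi> k. fcv (\<lambda>x. (v x $ k) *\<^sub>R v x) n), fcv (\<lambda>x. cross3 (v x) (B x)) n)" for n
    unfolding conv_def coeffs_def mhd_quad_def fst_conv snd_conv
    by (intro infsumI has_sum_Pair wiener_v_cross3 fcv_outer assms)
  have 2: "conv mhd_cub (conv mhd_quad (coeffs v B E) (coeffs v B E)) (coeffs v B E) n =
    (fcv (\<lambda>x. cross3 (cross3 (v x) (B x)) (B x)) n, 0, 0)"
    unfolding conv_def[of mhd_cub] 1 unfolding coeffs_def mhd_cub_def fst_conv snd_conv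
    by (intro infsumI has_sum_Pair wiener_v_cross3(2) vB B has_sum_0) auto
  have "(\<lambda>x. cross3 (E x + cross3 (v x) (B x)) (B x)) = (\<lambda>x. cross3 (E x) (B x) + cross3 (cross3 (v x) (B x)) (B x))"
    by (auto simp: fun_eq_iff vec_eq_iff forall_3 algebra_simps)
  then have "fcv (\<lambda>x. cross3 (E x + cross3 (v x) (B x)) (B x)) n =
      fcv (\<lambda>x. cross3 (E x) (B x)) n + fcv (\<lambda>x. cross3 (cross3 (v x) (B x)) (B x)) n"
    using wiener_v_add(2)[OF wiener_v_cross3(1)[OF E B] wiener_v_cross3(1)[OF vB B]] by simp
  then show ?thesis unfolding forcing_def 1 2 by simp
qed

section \<open>Equivalence of the projected equations with a single vector equation\<close>

lemma leray_c_leray: "leray_c n (leray n a) = 0"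
  by (simp add: leray_c_def leray_leray)

lemma leray_c_leray_c: "leray_c n (leray_c n a) = leray_c n a"
  by (simp add: leray_c_def[of n "leray_c n a"] leray_leray_c)

lemma leray_c_curl_hat: "leray_c n (curl_hat n a) = 0"
  by (simp add: leray_c_def leray_curl_hat)

lemma leray_c_smult: "leray_c n (c *s a) = c *s leray_c n a"
  by (auto simp: leray_c_def leray_smult vec_eq_iff algebra_simps)

lemma leray_decomp: "(leray n a = leray n b \<and> leray_c n a = leray_c n b) \<longleftrightarrow> a = b"
  unfolding leray_c_def by (metis diff_add_cancel)

lemma integral_linear': "linear f \<Longrightarrow> g integrable_on S \<Longrightarrow> integral S (\<lambda>x. f (g x)) = f (integral S g)"
  for f :: "'a::euclidean_space \<Rightarrow> 'b::real_normed_vector"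
  using integral_linear[of g S f] by (simp add: linear_conv_bounded_linear o_def)

text \<open>The Leray projection and its complement commute with the integral, annihilate each other
  and sum to the identity, so the two projected equations for E amount to one. Continuity of the
  forcing supplies the integrability.\<close>

lemma mhd_equations_iff:
  assumes c: "continuous_on {0..t} (\<lambda>s. (a s, M s, b s))"
  shows "(p, q, r) = mhd_free \<nu> v0 B0 E0 t n + integral {0..t} (\<lambda>s. mhd_kernel \<nu> (t - s) n (a s, M s, b s)) \<longleftrightarrow>
    p = heat \<nu> t n *s v0 n + integral {0..t} (\<lambda>s. heat \<nu> (t - s) n *s leray n (a s - tensor_div n (M s))) \<and>
    q = (dw_Sd t n + dw_S t n) *s B0 n + dw_S t n *s (- curl_hat n (E0 n))
        + integral {0..t} (\<lambda>s. dw_S (t - s) n *s curl_hat n (b s)) \<and>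
    leray n r = dw_Sd t n *s leray n (E0 n) + dw_S t n *s curl_hat n (B0 n)
        - integral {0..t} (\<lambda>s. dw_Sd (t - s) n *s leray n (b s)) \<and>
    leray_c n r = complex_of_real (exp (- t)) *s leray_c n (E0 n)
        - integral {0..t} (\<lambda>s. complex_of_real (exp (- (t - s))) *s leray_c n (b s))"
proof -
  let ?k = "\<lambda>s. mhd_kernel \<nu> (t - s) n (a s, M s, b s)"
  define k3 where "k3 s = - (dw_Sd (t - s) n *s leray n (b s)) - complex_of_real (exp (- (t - s))) *s leray_c n (b s)" for s
  have "continuous_on {0..t} ?k"
    using continuous_on_compose2[OF mhd_kernel_cont[of UNIV \<nu> n]
        continuous_on_Pair[OF continuous_on_diff[OF continuous_on_const continuous_on_id] c]]
    by simp
  then have int: "?k integrable_on {0..t}" by (rule integrable_continuous_real)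
  have lin: "linear (fst :: cstate \<Rightarrow> _)" "linear (\<lambda>x :: cstate. fst (snd x))" "linear (\<lambda>x :: cstate. snd (snd x))"
    by (auto intro!: linearI)
  note I = integral_linear'[OF lin(1) int] integral_linear'[OF lin(2) int] integral_linear'[OF lin(3) int]
  have k3: "(\<lambda>s. snd (snd (?k s))) = k3" by (simp add: mhd_kernel_def k3_def fun_eq_iff)
  have k3i: "k3 integrable_on {0..t}"
    using integrable_linear[OF int, of "\<lambda>x. snd (snd x)"] lin(3) by (simp add: linear_conv_bounded_linear o_def flip: k3)
  define I3 where "I3 = integral {0..t} k3"
  have "leray n I3 = integral {0..t} (\<lambda>s. leray n (k3 s))"
    unfolding I3_def by (rule integral_linear'[OF linear_leray k3i, symmetric])
  also have "(\<lambda>s. leray n (k3 s)) = (\<lambda>s. - (dw_Sd (t - s) n *s leray n (b s)))"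
    by (simp add: fun_eq_iff k3_def linear_diff[OF linear_leray] linear_neg[OF linear_leray] leray_smult leray_leray leray_leray_c)
  finally have l1: "leray n I3 = - integral {0..t} (\<lambda>s. dw_Sd (t - s) n *s leray n (b s))"
    by simp
  have "leray_c n I3 = integral {0..t} (\<lambda>s. leray_c n (k3 s))"
    unfolding I3_def by (rule integral_linear'[OF linear_leray_c k3i, symmetric])
  also have "(\<lambda>s. leray_c n (k3 s)) = (\<lambda>s. - (complex_of_real (exp (- (t - s))) *s leray_c n (b s)))"
    by (simp add: fun_eq_iff k3_def linear_diff[OF linear_leray_c] linear_neg[OF linear_leray_c] leray_c_smult leray_c_leray leray_c_leray_c)
  finally have l2: "leray_c n I3 = - integral {0..t} (\<lambda>s. complex_of_real (exp (- (t - s))) *s leray_c n (b s))"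
    by simp
  define L3 where "L3 = (dw_Sd t n *s leray n (E0 n) + dw_S t n *s curl_hat n (B0 n)) + complex_of_real (exp (- t)) *s leray_c n (E0 n)"
  have L: "leray n L3 = dw_Sd t n *s leray n (E0 n) + dw_S t n *s curl_hat n (B0 n)"
    "leray_c n L3 = complex_of_real (exp (- t)) *s leray_c n (E0 n)"
    by (simp_all add: L3_def linear_add[OF linear_leray] linear_add[OF linear_leray_c] leray_smult leray_c_smult
        leray_leray leray_leray_c leray_curl_hat leray_c_leray leray_c_leray_c leray_c_curl_hat)
  have "r = L3 + I3 \<longleftrightarrow> leray n r = leray n L3 + leray n I3 \<and> leray_c n r = leray_c n L3 + leray_c n I3"
    using leray_decomp[of n r "L3 + I3"] by (simp add: linear_add[OF linear_leray] linear_add[OF linear_leray_c])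
  also have "\<dots> \<longleftrightarrow> leray n r = dw_Sd t n *s leray n (E0 n) + dw_S t n *s curl_hat n (B0 n)
        - integral {0..t} (\<lambda>s. dw_Sd (t - s) n *s leray n (b s)) \<and>
    leray_c n r = complex_of_real (exp (- t)) *s leray_c n (E0 n)
        - integral {0..t} (\<lambda>s. complex_of_real (exp (- (t - s))) *s leray_c n (b s))"
    unfolding L l1 l2 by simp
  finally have 3: "r = L3 + I3 \<longleftrightarrow> \<dots>" .
  have "(p, q, r) = mhd_free \<nu> v0 B0 E0 t n + integral {0..t} ?k \<longleftrightarrow>
    p = fst (mhd_free \<nu> v0 B0 E0 t n) + fst (integral {0..t} ?k) \<and>
    q = fst (snd (mhd_free \<nu> v0 B0 E0 t n)) + fst (snd (integral {0..t} ?k)) \<and>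
    r = snd (snd (mhd_free \<nu> v0 B0 E0 t n)) + snd (snd (integral {0..t} ?k))"
    by (auto simp: prod_eq_iff)
  also have "snd (snd (mhd_free \<nu> v0 B0 E0 t n)) = L3" by (simp add: mhd_free_def L3_def)
  also have "snd (snd (integral {0..t} ?k)) = I3" unfolding I(3)[symmetric] k3 I3_def ..
  also note 3
  finally show ?thesis
    unfolding I(1,2)[symmetric] by (simp add: mhd_free_def mhd_kernel_def)
qed

text \<open>Transfers continuity in X^1 to the l^1 continuity of the abstract theory. Since
  \<open>Xnorm\<close> is an infinite sum with default value 0, summability of the weighted
  difference has to come first.\<close>

lemma sum_bd_fcv_diff:
  assumes a: "in_Xv 1 a" and b: "in_Xv 1 b"
  shows "sum_bd (\<lambda>n. norm (fcv a n - fcv b n)) (Xnormv 1 (\<lambda>x. a x - b x))"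
proof -
  have X: "in_X 1 (\<lambda>x. a x $ i)" "in_X 1 (\<lambda>x. b x $ i)" for i using a b by (auto simp: in_Xv_def)
  note w = in_X_wiener[OF X(1), simplified] in_X_wiener[OF X(2), simplified]
  have 1: "sum_bd (\<lambda>n. cmod (fc (\<lambda>x. a x $ i) n - fc (\<lambda>x. b x $ i) n)) (Xnorm 1 (\<lambda>x. a x $ i - b x $ i))" for i
  proof -
    have "(\<lambda>n. norm (wt 1 n *\<^sub>R fc (\<lambda>x. a x $ i) n - wt 1 n *\<^sub>R fc (\<lambda>x. b x $ i) n)) summable_on UNIV"
      using X wt_pos[of 1] by (intro summable_norm_add) (auto simp: in_X_def less_imp_le)
    then have "(\<lambda>n. wt 1 n * cmod (fc (\<lambda>x. a x $ i - b x $ i) n)) summable_on UNIV"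
      using wt_pos[of 1] by (simp add: wiener_fc_diff w less_imp_le flip: scaleR_diff_right)
    then have "wsum_bd (wt 1) (\<lambda>n. cmod (fc (\<lambda>x. a x $ i - b x $ i) n)) (Xnorm 1 (\<lambda>x. a x $ i - b x $ i))"
      unfolding Xnorm_def by (rule summable_wsum_bd) (auto simp: less_imp_le wt_pos)
    from wsum_bd_imp_sum_bd[OF this] show ?thesis by (simp add: wt_ge_1 wiener_fc_diff w)
  qed
  show ?thesis
  proof (rule wsum_bd_mono[OF wsum_bd_add[OF 1[of 1] wsum_bd_add[OF 1[of 2] 1[of 3]]]])
    show "norm (fcv a n - fcv b n) \<le> cmod (fc (\<lambda>x. a x $ 1) n - fc (\<lambda>x. b x $ 1) n) +
        (cmod (fc (\<lambda>x. a x $ 2) n - fc (\<lambda>x. b x $ 2) n) + cmod (fc (\<lambda>x. a x $ 3) n - fc (\<lambda>x. b x $ 3) n))" for n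
      using norm_vec_le_sum[of "fcv a n - fcv b n"] by (simp add: fcv_def sum_3)
  qed (auto simp: Xnormv_def sum_3)
qed

lemma coeffs_l1_cont:
  assumes X: "\<And>t. t \<in> S \<Longrightarrow> in_Xv 1 (v t) \<and> in_Xv 1 (B t) \<and> in_Xv 1 (E t)" and t0: "t0 \<in> S"
    and c: "((\<lambda>t. Xnormv 1 (\<lambda>x. v t x - v t0 x)) \<longlongrightarrow> 0) (at t0 within S)"
       "((\<lambda>t. Xnormv 1 (\<lambda>x. B t x - B t0 x)) \<longlongrightarrow> 0) (at t0 within S)"
       "((\<lambda>t. Xnormv 1 (\<lambda>x. E t x - E t0 x)) \<longlongrightarrow> 0) (at t0 within S)"
  shows "((\<lambda>t. \<Sum>\<^sub>\<infinity>n. norm (coeffs (v t) (B t) (E t) n - coeffs (v t0) (B t0) (E t0) n)) \<longlongrightarrow> 0) (at t0 within S)"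
proof (rule Lim_null_comparison)
  show "((\<lambda>t. Xnormv 1 (\<lambda>x. v t x - v t0 x) + (Xnormv 1 (\<lambda>x. B t x - B t0 x) + Xnormv 1 (\<lambda>x. E t x - E t0 x))) \<longlongrightarrow> 0) (at t0 within S)"
    using tendsto_add[OF c(1) tendsto_add[OF c(2,3)]] by simp
  show "\<forall>\<^sub>F t in at t0 within S. norm (\<Sum>\<^sub>\<infinity>n. norm (coeffs (v t) (B t) (E t) n - coeffs (v t0) (B t0) (E t0) n)) \<le>
     Xnormv 1 (\<lambda>x. v t x - v t0 x) + (Xnormv 1 (\<lambda>x. B t x - B t0 x) + Xnormv 1 (\<lambda>x. E t x - E t0 x))"
    unfolding eventually_at_filter
  proof (rule always_eventually, intro allI impI)
    fix t assume t: "t \<noteq> t0" "t \<in> S"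
    have b: "sum_bd (\<lambda>n. norm (fcv (v t) n - fcv (v t0) n) + (norm (fcv (B t) n - fcv (B t0) n) + norm (fcv (E t) n - fcv (E t0) n)))
       (Xnormv 1 (\<lambda>x. v t x - v t0 x) + (Xnormv 1 (\<lambda>x. B t x - B t0 x) + Xnormv 1 (\<lambda>x. E t x - E t0 x)))"
      using X[OF t(2)] X[OF t0] by (intro wsum_bd_add sum_bd_fcv_diff) auto
    have "sum_bd (\<lambda>n. norm (coeffs (v t) (B t) (E t) n - coeffs (v t0) (B t0) (E t0) n))
       (Xnormv 1 (\<lambda>x. v t x - v t0 x) + (Xnormv 1 (\<lambda>x. B t x - B t0 x) + Xnormv 1 (\<lambda>x. E t x - E t0 x)))"
      by (rule wsum_bd_mono[OF b])
         (auto simp: coeffs_def add.assoc[symmetric] intro: norm_triple_le)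
    from sum_bd_infsum[OF this]
    show "norm (\<Sum>\<^sub>\<infinity>n. norm (coeffs (v t) (B t) (E t) n - coeffs (v t0) (B t0) (E t0) n)) \<le>
       Xnormv 1 (\<lambda>x. v t x - v t0 x) + (Xnormv 1 (\<lambda>x. B t x - B t0 x) + Xnormv 1 (\<lambda>x. E t x - E t0 x))"
      by (simp add: infsum_nonneg)
  qed
qed

lemma coeffs_summable:
  assumes "wiener_v v" "wiener_v B" "wiener_v E"
  shows "(\<lambda>n. norm (coeffs v B E n)) summable_on UNIV"
proof (rule summable_on_comparison_test)
  show "(\<lambda>n. norm (fcv v n) + norm (fcv B n) + norm (fcv E n)) summable_on UNIV"
    by (intro summable_on_add wiener_v_summable assms)
qed (auto simp: coeffs_def intro: norm_triple_le)

text \<open>The bridge between functions and coefficient sequences, through which existence and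
  uniqueness for the abstract equation reach the system.\<close>

lemma mhd_mild_iff:
  assumes \<nu>: "0 < \<nu>" and T: "0 \<le> T"
    and X: "\<And>t. t \<in> {0..T} \<Longrightarrow> in_Xv 1 (v t) \<and> in_Xv 1 (B t) \<and> in_Xv 1 (E t)"
    and c: "\<And>t0. t0 \<in> {0..T} \<Longrightarrow> ((\<lambda>t. Xnormv 1 (\<lambda>x. v t x - v t0 x)) \<longlongrightarrow> 0) (at t0 within {0..T})"
       "\<And>t0. t0 \<in> {0..T} \<Longrightarrow> ((\<lambda>t. Xnormv 1 (\<lambda>x. B t x - B t0 x)) \<longlongrightarrow> 0) (at t0 within {0..T})"
       "\<And>t0. t0 \<in> {0..T} \<Longrightarrow> ((\<lambda>t. Xnormv 1 (\<lambda>x. E t x - E t0 x)) \<longlongrightarrow> 0) (at t0 within {0..T})"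
  shows "mhd_mild \<nu> T v0 B0 E0 v B E \<longleftrightarrow>
    (\<forall>t\<in>{0..T}. \<forall>n. coeffs (v t) (B t) (E t) n = mhd_free \<nu> (fcv v0) (fcv B0) (fcv E0) t n +
       mild.duhamel (mhd_kernel \<nu>) (\<lambda>s. mild.forcing mhd_quad mhd_cub (coeffs (v s) (B s) (E s))) t n)"
proof -
  interpret mild mhd_quad 15 mhd_cub 6 "mhd_kernel \<nu>" "29 + 12 / sqrt \<nu>" by (rule mild_mhd[OF \<nu>])
  define u where "u t = coeffs (v t) (B t) (E t)" for t
  have w: "wiener_v (v t)" "wiener_v (B t)" "wiener_v (E t)" if "t \<in> {0..T}" for t
    using X[OF that] in_Xv_wiener[of 1] by auto
  have cont: "((\<lambda>t. \<Sum>\<^sub>\<infinity>n. norm (u t n - u t0 n)) \<longlongrightarrow> 0) (at t0 within {0..T})" if "t0 \<in> {0..T}" for t0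
    unfolding u_def by (rule coeffs_l1_cont[OF X that c[OF that]])
  have "(\<lambda>n. norm (u t n)) summable_on UNIV" if "t \<in> {0..T}" for t
    unfolding u_def by (intro coeffs_summable w that)
  then obtain \<rho> where b: "\<And>t. t \<in> {0..T} \<Longrightarrow> sum_bd (\<lambda>n. norm (u t n)) \<rho>"
    using l1_cont_bounded[OF _ cont] by blast
  have FFc: "continuous_on {0..T} (\<lambda>s. forcing (u s) n)" for n
    by (rule forcing_cont_of_l1_cont[OF b cont])
  have FFu: "forcing (u s) n = (fcv (\<lambda>x. cross3 (E s x + cross3 (v s x) (B s x)) (B s x)) n,
     (\<chi> k. fcv (\<lambda>x. (v s x $ k) *\<^sub>R v s x) n), fcv (\<lambda>x. cross3 (v s x) (B s x)) n)" if "s \<in> {0..T}" for s n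
    unfolding u_def by (rule forcing_coeffs[OF w[OF that] mild_mhd[OF \<nu>]])
  have main: "u t n = mhd_free \<nu> (fcv v0) (fcv B0) (fcv E0) t n + duhamel (\<lambda>s. forcing (u s)) t n \<longleftrightarrow>
      fcv (v t) n =
        heat \<nu> t n *s fcv v0 n
        + integral {0..t} (\<lambda>s. heat \<nu> (t - s) n *s leray n
            (fcv (\<lambda>x. cross3 (E s x + cross3 (v s x) (B s x)) (B s x)) n
             - (\<Sum>k\<in>UNIV. (\<i> * of_int (n$k)) *s fcv (\<lambda>x. (v s x $ k) *\<^sub>R v s x) n))) \<and>
      fcv (B t) n =
        (dw_Sd t n + dw_S t n) *s fcv B0 n
        + dw_S t n *s (- curl_hat n (fcv E0 n))
        + integral {0..t} (\<lambda>s. dw_S (t - s) n *s curl_hat n (fcv (\<lambda>x. cross3 (v s x) (B s x)) n)) \<and>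
      leray n (fcv (E t) n) =
        dw_Sd t n *s leray n (fcv E0 n)
        + dw_S t n *s curl_hat n (fcv B0 n)
        - integral {0..t} (\<lambda>s. dw_Sd (t - s) n *s leray n (fcv (\<lambda>x. cross3 (v s x) (B s x)) n)) \<and>
      leray_c n (fcv (E t) n) =
        complex_of_real (exp (- t)) *s leray_c n (fcv E0 n)
        - integral {0..t} (\<lambda>s. complex_of_real (exp (- (t - s))) *s
              leray_c n (fcv (\<lambda>x. cross3 (v s x) (B s x)) n))" if t: "t \<in> {0..T}" for t n
  proof -
    have sub: "{0..t} \<subseteq> {0..T}" using t by auto
    let ?f = "\<lambda>s. (fcv (\<lambda>x. cross3 (E s x + cross3 (v s x) (B s x)) (B s x)) n,
     (\<chi> k. fcv (\<lambda>x. (v s x $ k) *\<^sub>R v s x) n), fcv (\<lambda>x. cross3 (v s x) (B s x)) n)"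
    have "continuous_on {0..t} ?f"
      by (rule continuous_on_eq[OF continuous_on_subset[OF FFc[of n] sub]]) (use FFu sub in auto)
    note iff = mhd_equations_iff[OF this, of "fcv (v t) n" "fcv (B t) n" "fcv (E t) n" \<nu> "fcv v0" "fcv B0" "fcv E0" n]
    have "duhamel (\<lambda>s. forcing (u s)) t n = integral {0..t} (\<lambda>s. mhd_kernel \<nu> (t - s) n (?f s))"
      unfolding duhamel_def by (rule integral_cong) (use FFu sub in auto)
    then show ?thesis
      using iff unfolding tensor_div_def vec_lambda_beta by (simp add: u_def coeffs_def)
  qed
  show ?thesis
    unfolding mhd_mild_def u_def[symmetric] using X c main by auto
qed

section \<open>Irregular data\<close>

lemma sq_le_nsq: "(of_int (n $ i))\<^sup>2 \<le> nsq n"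
  unfolding nsq_def by (rule member_le_sum) auto

text \<open>Eight derivatives give the power 4: three factors make the series over the lattice
  converge and the fourth absorbs the weight of X^1.\<close>

lemma smooth_torus_decay:
  assumes "smooth_torus f"
  obtains M where "\<And>n. (1 + nsq n)^4 * cmod (fc f n) \<le> M"
proof -
  have "\<forall>j. \<exists>M. \<forall>n. \<bar>of_int (n$j)\<bar>^8 * cmod (fc f n) \<le> M"
    using smooth_torus_decay1[OF assms] by metis
  then obtain M where M: "\<And>j n. \<bar>of_int (n$j)\<bar>^8 * cmod (fc f n) \<le> M j" by metis
  obtain M0 where M0: "\<And>n. \<bar>of_int (n$1)\<bar>^0 * cmod (fc f n) \<le> M0"
    using smooth_torus_decay1[OF assms] by blast
  define M1 where "M1 = 16 * (M0 + 81 * (\<Sum>j\<in>UNIV. M j))"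
  have "(1 + nsq n)^4 * cmod (fc f n) \<le> M1" for n
  proof -
    \<comment> \<open>The decay is known only for pure derivatives along an axis, so |n| is compared
      with its largest component, |n|^2 <= 3 m^2.\<close>
    define m where "m = Max (range (\<lambda>j. \<bar>of_int (n$j) :: real\<bar>))"
    have "m \<in> range (\<lambda>j. \<bar>of_int (n$j) :: real\<bar>)" unfolding m_def by (rule Max_in) auto
    then obtain j where j: "m = \<bar>of_int (n$j)\<bar>" by auto
    have le: "\<bar>of_int (n$i)\<bar> \<le> m" for i unfolding m_def by (rule Max_ge) auto
    have "nsq n \<le> (\<Sum>i\<in>(UNIV::3 set). m\<^sup>2)"
      unfolding nsq_def by (intro sum_mono) (metis abs_ge_zero le power2_abs power_mono)
    then have n3: "nsq n \<le> 3 * m\<^sup>2" by simp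
    have "(1 + nsq n)^4 \<le> (2 * max 1 (3 * m\<^sup>2))^4"
      using n3 nsq_nonneg[of n] by (intro power_mono) auto
    also have "\<dots> = 16 * (max 1 (3 * m\<^sup>2))^4" by (simp add: power_mult_distrib)
    also have "(max 1 (3 * m\<^sup>2))^4 \<le> 1 + (3 * m\<^sup>2)^4" by (auto simp: max_def)
    also have "(3 * m\<^sup>2)^4 = 81 * m^8" by (simp add: power_mult_distrib flip: power_mult)
    finally have "(1 + nsq n)^4 \<le> 16 * (1 + 81 * m^8)" by simp
    then have "(1 + nsq n)^4 * cmod (fc f n) \<le> 16 * (1 + 81 * m^8) * cmod (fc f n)"
      by (rule mult_right_mono) simp
    also have "\<dots> = 16 * (cmod (fc f n) + 81 * (m^8 * cmod (fc f n)))" by (simp add: algebra_simps)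
    also have "\<dots> \<le> 16 * (M0 + 81 * M j)"
      using M0[of n] M[of n j] unfolding j by (intro mult_left_mono add_mono) auto
    also have "M j \<le> (\<Sum>j\<in>UNIV. M j)"
    proof (rule member_le_sum)
      show "0 \<le> M i" for i using M[of 0 i] by (rule order_trans[rotated]) auto
    qed auto
    finally show ?thesis by (simp add: M1_def)
  qed
  then show ?thesis by (rule that)
qed

text \<open>The absolute value is injective on the nonnegative and on the negative integers, so each
  half is bounded by the series over the naturals.\<close>

lemma inverse_square_sum_int:
  obtains G where "\<And>A. finite A \<Longrightarrow> (\<Sum>i\<in>A. 1 / (1 + (of_int i)\<^sup>2)) \<le> (G :: real)"
proof -
  have s: "summable (\<lambda>k. 1 / (1 + (real k)\<^sup>2))"
  proof (rule summable_comparison_test')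
    show "summable (\<lambda>k. 1 / (real k)\<^sup>2)"
      using inverse_power_summable[of 2, where 'a = real] by (simp add: inverse_eq_divide)
    show "norm (1 / (1 + (real k)\<^sup>2)) \<le> 1 / (real k)\<^sup>2" if "1 \<le> k" for k
      using that by (auto simp: frac_le)
  qed
  define H where "H = (\<Sum>k. 1 / (1 + (real k)\<^sup>2))"
  have "(\<Sum>i\<in>A. 1 / (1 + (of_int i)\<^sup>2)) \<le> 2 * H" if A: "finite A" for A
  proof -
    have le: "(\<Sum>i\<in>B. 1 / (1 + (of_int i)\<^sup>2)) \<le> H" if "finite B" "inj_on (\<lambda>i. nat \<bar>i\<bar>) B" for B :: "int set"
    proof -
      have "(\<Sum>i\<in>B. 1 / (1 + (of_int i)\<^sup>2)) = (\<Sum>k\<in>(\<lambda>i. nat \<bar>i\<bar>) ` B. 1 / (1 + (real k)\<^sup>2))"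
        using that by (subst sum.reindex) auto
      also have "\<dots> \<le> H" unfolding H_def using that s by (intro sum_le_suminf) auto
      finally show ?thesis .
    qed
    have "(\<Sum>i\<in>A. 1 / (1 + (of_int i :: real)\<^sup>2)) = (\<Sum>i\<in>A \<inter> {0..}. 1 / (1 + (of_int i)\<^sup>2)) + (\<Sum>i\<in>A - {0..}. 1 / (1 + (of_int i)\<^sup>2))"
      by (rule sum.Int_Diff[OF A])
    also have "\<dots> \<le> H + H" using A by (intro add_mono le) (auto simp: inj_on_def)
    finally show ?thesis by simp
  qed
  then show ?thesis by (rule that)
qed

lemma sum_triple:
  fixes g :: "'a \<Rightarrow> real"
  shows "(\<Sum>(x,y,z)\<in>A \<times> B \<times> C. g x * (g y * g z)) = (\<Sum>x\<in>A. g x) * ((\<Sum>y\<in>B. g y) * (\<Sum>z\<in>C. g z))"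
  by (simp add: sum.cartesian_product[symmetric] sum_distrib_left[symmetric] sum_distrib_right[symmetric])

text \<open>Each 1 + n_i^2 is at most 1 + |n|^2, so the lattice sum is bounded by a product of three
  one-dimensional sums.\<close>

lemma sum_bd_inverse_nsq:
  obtains S where "sum_bd (\<lambda>n. 1 / (1 + nsq n)^3) S"
proof -
  obtain G where G: "\<And>A. finite A \<Longrightarrow> (\<Sum>i\<in>A. 1 / (1 + (of_int i)\<^sup>2)) \<le> (G :: real)"
    using inverse_square_sum_int by blast
  have G0: "0 \<le> G" using G[of "{}"] by simp
  let ?g = "\<lambda>i::int. 1 / (1 + (of_int i :: real)\<^sup>2)"
  have g0: "0 \<le> ?g i" for i by simp
  have "(\<Sum>n\<in>A. 1 / (1 + nsq n)^3) \<le> G * (G * G)" if A: "finite A" for A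
  proof -
    let ?p = "\<lambda>n::Z3. (n$1, n$2, n$3)"
    let ?A = "\<lambda>j. (\<lambda>n. n $ j) ` A"
    have inj: "inj_on ?p A" by (auto simp: inj_on_def vec_eq_iff forall_3)
    have "(\<Sum>n\<in>A. 1 / (1 + nsq n)^3) \<le> (\<Sum>n\<in>A. ?g (n$1) * (?g (n$2) * ?g (n$3)))"
    proof (rule sum_mono)
      fix n
      have "(1 + (of_int (n$1))\<^sup>2) * ((1 + (of_int (n$2))\<^sup>2) * (1 + (of_int (n$3))\<^sup>2)) \<le> (1 + nsq n) * ((1 + nsq n) * (1 + nsq n))"
        using sq_le_nsq[of n] nsq_nonneg[of n] by (intro mult_mono add_mono) auto
      then have "1 / ((1 + nsq n) * ((1 + nsq n) * (1 + nsq n))) \<le> 1 / ((1 + (of_int (n$1))\<^sup>2) * ((1 + (of_int (n$2))\<^sup>2) * (1 + (of_int (n$3))\<^sup>2)))"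
        by (intro divide_left_mono) (auto intro!: mult_pos_pos add_pos_nonneg simp: nsq_nonneg)
      then show "1 / (1 + nsq n)^3 \<le> ?g (n$1) * (?g (n$2) * ?g (n$3))"
        by (simp add: power3_eq_cube mult_ac)
    qed
    also have "\<dots> = (\<Sum>(x,y,z)\<in>?p ` A. ?g x * (?g y * ?g z))"
      by (subst sum.reindex[OF inj]) auto
    also have "\<dots> \<le> (\<Sum>(x,y,z)\<in>?A 1 \<times> ?A 2 \<times> ?A 3. ?g x * (?g y * ?g z))"
      using A by (intro sum_mono2) auto
    also have "\<dots> = (\<Sum>x\<in>?A 1. ?g x) * ((\<Sum>y\<in>?A 2. ?g y) * (\<Sum>z\<in>?A 3. ?g z))"
      by (rule sum_triple)
    also have "\<dots> \<le> G * (G * G)"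
      using A G0 by (intro mult_mono G mult_nonneg_nonneg sum_nonneg g0) auto
    finally show ?thesis .
  qed
  moreover have "0 \<le> 1 / (1 + nsq n)^3" for n using nsq_nonneg[of n] by simp
  ultimately have "sum_bd (\<lambda>n. 1 / (1 + nsq n)^3) (G * (G * G))" unfolding wsum_bd_def by simp
  then show ?thesis by (rule that)
qed

lemma wt_le: "s \<le> 2 \<Longrightarrow> wt s n \<le> 1 + nsq n"
  unfolding wt_def using powr_mono[of "s/2" 1 "1 + nsq n"] nsq_nonneg[of n] by simp

lemma wt_mono: "s \<le> s' \<Longrightarrow> wt s n \<le> wt s' n"
  unfolding wt_def using nsq_nonneg[of n] by (intro powr_mono) auto

text \<open>The extra factor 1 + |n|^2 in the second bound is what later makes the smooth data
  negligible at high frequencies relative to <n>^(-r); the range s <= 2 covers r.\<close>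

lemma smooth_torus_weight:
  assumes "smooth_torus f"
  obtains M S where "wsum_bd (wt 1) (\<lambda>n. cmod (fc f n)) S"
    "\<And>n s. s \<le> 2 \<Longrightarrow> wt s n * cmod (fc f n) * (1 + nsq n) \<le> M"
proof -
  obtain M where M: "\<And>n. (1 + nsq n)^4 * cmod (fc f n) \<le> M" using smooth_torus_decay[OF assms] by blast
  obtain G where G: "sum_bd (\<lambda>n. 1 / (1 + nsq n)^3) G" using sum_bd_inverse_nsq by blast
  have pos: "1 \<le> 1 + nsq n" for n using nsq_nonneg[of n] by simp
  have M0: "0 \<le> M" using order_trans[OF _ M[of 0]] nsq_nonneg[of 0] by simp
  have "sum_bd (\<lambda>n. wt 1 n * cmod (fc f n)) (M * G)"
  proof (rule wsum_bd_mono[OF wsum_bd_cmult[OF G M0]])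
    fix n
    have "wt 1 n * cmod (fc f n) \<le> (1 + nsq n) * cmod (fc f n)" by (intro mult_right_mono wt_le) auto
    also have "\<dots> = ((1 + nsq n)^4 * cmod (fc f n)) / (1 + nsq n)^3"
      using pos[of n] by (simp add: power_eq_if)
    also have "\<dots> \<le> M / (1 + nsq n)^3" using pos[of n] by (intro divide_right_mono M) auto
    finally show "wt 1 n * cmod (fc f n) \<le> M * (1 / (1 + nsq n)^3)" by simp
  qed (auto simp: less_imp_le wt_pos)
  then have "wsum_bd (wt 1) (\<lambda>n. cmod (fc f n)) (M * G)" by (simp add: wsum_bd_def)
  moreover have "wt s n * cmod (fc f n) * (1 + nsq n) \<le> M" if "s \<le> 2" for s n
  proof -
    have "wt s n * cmod (fc f n) * (1 + nsq n) \<le> (1 + nsq n) * cmod (fc f n) * (1 + nsq n)"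
      using wt_le[OF that] pos[of n] by (intro mult_right_mono) auto
    also have "\<dots> = (1 + nsq n)^2 * cmod (fc f n)" by (simp add: power2_eq_square)
    also have "\<dots> \<le> (1 + nsq n)^4 * cmod (fc f n)" using pos[of n] by (intro mult_right_mono power_increasing) auto
    finally show ?thesis using M[of n] by linarith
  qed
  ultimately show ?thesis by (rule that)
qed

section \<open>Submultiplicativity and quasi-additivity of the weights\<close>

lemma wt_sqrt: "wt s n = sqrt (1 + nsq n) powr s"
  using nsq_nonneg[of n] by (simp add: wt_def powr_half_sqrt[symmetric] powr_powr)

text \<open><n> is the norm of the vector (1, n); the triangle inequality applies after the first
  entry of the sum is enlarged from 1 to 2.\<close>

lemma sqrt_nsq_add: "sqrt (1 + nsq (m + k)) \<le> sqrt (1 + nsq m) + sqrt (1 + nsq k)"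
proof -
  have eq: "norm (1::real, cvec n) = sqrt (1 + nsq n)" for n
    by (simp add: norm_Pair norm_cvec nsq_nonneg)
  have "nsq (m + k) = (norm (cvec m + cvec k))\<^sup>2"
  proof -
    have "cvec (m + k) = cvec m + cvec k" by (simp add: vec_eq_iff)
    then show ?thesis using norm_cvec[of "m + k"] nsq_nonneg[of "m + k"] by simp
  qed
  then have "sqrt (1 + nsq (m + k)) \<le> norm (1 + 1 :: real, cvec m + cvec k)"
    unfolding norm_Pair by (intro real_sqrt_le_mono) simp
  also have "\<dots> = norm ((1::real, cvec m) + (1, cvec k))" by simp
  also have "\<dots> \<le> sqrt (1 + nsq m) + sqrt (1 + nsq k)" unfolding eq[symmetric] by (rule norm_triangle_ineq)
  finally show ?thesis .
qed

lemma wt_submult: "wt 1 (m + k) \<le> 2 * (wt 1 m * wt 1 k)"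
proof -
  have 1: "1 \<le> wt 1 n" and e: "wt 1 n = sqrt (1 + nsq n)" for n
    using wt_ge_1[of 1 n] nsq_nonneg[of n] by (auto simp: wt_sqrt)
  have "wt 1 (m + k) \<le> wt 1 m + wt 1 k" unfolding e by (rule sqrt_nsq_add)
  also have "\<dots> \<le> 2 * (wt 1 m * wt 1 k)"
  proof -
    have "0 \<le> wt 1 m * (wt 1 k - 1) + wt 1 k * (wt 1 m - 1)"
      using 1[of m] 1[of k] by (intro add_nonneg_nonneg mult_nonneg_nonneg) auto
    then show ?thesis by (simp add: algebra_simps)
  qed
  finally show ?thesis .
qed

text \<open>The bracket of m + k is at most twice the larger of the two brackets, and the power of a
  maximum is at most the sum of the powers.\<close>

lemma wt_quasi_add: "0 \<le> s \<Longrightarrow> wt s (m + k) \<le> 2 powr s * (wt s m + wt s k)"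
proof -
  assume s: "0 \<le> s"
  let ?a = "sqrt (1 + nsq m)" and ?b = "sqrt (1 + nsq k)"
  have "wt s (m + k) \<le> (2 * max ?a ?b) powr s"
    unfolding wt_sqrt using sqrt_nsq_add[of m k] nsq_nonneg[of "m + k"] s by (intro powr_mono2) auto
  also have "\<dots> = 2 powr s * max ?a ?b powr s"
    by (rule powr_mult)
  also have "max ?a ?b powr s \<le> wt s m + wt s k"
    unfolding wt_sqrt by (auto simp: max_def)
  finally show "wt s (m + k) \<le> 2 powr s * (wt s m + wt s k)" by simp
qed

section \<open>Frequencies on the second axis and their phases\<close>

definition axis_freq :: "nat \<Rightarrow> Z3" where "axis_freq N = axis 2 (int N)"

lemma axis_freq_nth: "axis_freq N $ 1 = 0" "axis_freq N $ 2 = int N" "axis_freq N $ 3 = 0"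
  by (auto simp: axis_freq_def axis_def)

lemma nsq_axis_freq: "nsq (axis_freq N) = (real N)\<^sup>2"
  by (simp add: nsq_def sum_3 axis_freq_nth)

lemma inj_axis_freq: "inj axis_freq"
  by (metis axis_freq_nth(2) injI of_nat_eq_iff)

lemma abs_sin_add_npi: "\<bar>sin (x + real j * pi)\<bar> = \<bar>sin x\<bar>"
  by (simp add: sin_add abs_mult)

lemma sin_ge_half:
  assumes "pi/6 \<le> x" "x \<le> 5*pi/6"
  shows "1/2 \<le> sin x"
proof (cases "x \<le> pi/2")
  case True
  then show ?thesis using sin_monotone_2pi_le[of "pi/6" x] assms sin_30 by simp
next
  case False
  then have "sin (pi/6) \<le> sin (pi - x)" using assms by (intro sin_monotone_2pi_le) auto
  then show ?thesis using sin_30 by simp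
qed

lemma dw_freq_axis_freq: "1 \<le> N \<Longrightarrow> dw_freq (axis_freq N) \<le> real N" "1 \<le> N \<Longrightarrow> real N / 2 \<le> dw_freq (axis_freq N)"
  "1 \<le> N \<Longrightarrow> dw_freq (axis_freq (Suc N)) \<le> dw_freq (axis_freq N) + 3/2"
proof -
  assume N: "1 \<le> N"
  have "sqrt (4 * (real N)\<^sup>2 - 1) \<le> 2 * real N"
    by (rule real_le_lsqrt) (auto simp: power_mult_distrib)
  then show "dw_freq (axis_freq N) \<le> real N" by (simp add: dw_freq_def nsq_axis_freq)
  show "real N / 2 \<le> dw_freq (axis_freq N)" using dw_freq_ge[of "axis_freq N"] N by (simp add: nsq_axis_freq)
  have N2: "1 \<le> (real N)\<^sup>2" using N by simp
  \<comment> \<open>A crude lower bound for the root that suffices for the step estimate: after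
    squaring, the increment of 8 N is covered by 6 * (3/2) N = 9 N.\<close>
  have r: "3/2 * real N \<le> sqrt (4 * (real N)\<^sup>2 - 1)"
    by (rule real_le_rsqrt) (use N2 in \<open>simp add: power2_eq_square algebra_simps\<close>)
  have "sqrt (4 * (real (Suc N))\<^sup>2 - 1) \<le> sqrt (4 * (real N)\<^sup>2 - 1) + 3"
  proof (rule real_le_lsqrt)
    have "(sqrt (4 * (real N)\<^sup>2 - 1) + 3)\<^sup>2 = 4 * (real N)\<^sup>2 - 1 + 6 * sqrt (4 * (real N)\<^sup>2 - 1) + 9"
      using N2 by (simp add: power2_sum)
    then show "4 * (real (Suc N))\<^sup>2 - 1 \<le> (sqrt (4 * (real N)\<^sup>2 - 1) + 3)\<^sup>2"
      using r by (simp add: power2_eq_square algebra_simps)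
  qed (use r in auto)
  then show "dw_freq (axis_freq (Suc N)) \<le> dw_freq (axis_freq N) + 3/2" by (simp add: dw_freq_def nsq_axis_freq field_simps)
qed

text \<open>The phases grow without bound in steps below \<open>2 * pi / 3\<close>, the length of the interval
  on which the sine exceeds one half.\<close>

lemma good_frequency:
  assumes t: "0 < t" "t \<le> 1"
  shows "\<exists>N\<ge>M. 1 \<le> N \<and> 1/2 \<le> \<bar>sin (dw_freq (axis_freq N) * t)\<bar>"
proof -
  define M' where "M' = max M 1"
  define th where "th N = dw_freq (axis_freq N) * t" for N
  obtain j :: nat where j: "th M' / pi \<le> real j" using real_arch_simple by blast
  \<comment> \<open>The left end of an interval, shifted by a multiple of pi beyond the initial
    phase, on which |sin| is at least 1/2.\<close>
  define c where "c = pi/6 + real j * pi"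
  have c: "th M' < c"
  proof -
    have "th M' \<le> real j * pi" using j by (simp add: divide_le_eq)
    then show ?thesis using pi_gt_zero unfolding c_def by linarith
  qed
  obtain N0 :: nat where N0: "2 * c / t \<le> real N0" using real_arch_simple by blast
  have "c \<le> th (max N0 M')"
  proof -
    have "c \<le> real N0 / 2 * t" using N0 t by (simp add: field_simps)
    also have "\<dots> \<le> real (max N0 M') / 2 * t" using t by (intro mult_right_mono divide_right_mono) auto
    also have "\<dots> \<le> th (max N0 M')"
      unfolding th_def using t by (intro mult_right_mono dw_freq_axis_freq(2)) (auto simp: M'_def)
    finally show ?thesis .
  qed
  then have ex: "\<exists>N. M' \<le> N \<and> c \<le> th N" by (intro exI[of _ "max N0 M'"]) auto
  \<comment> \<open>The first phase to reach c overshoots it by less than one step, hence stays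
    within the interval of length 2*pi/3 that starts at c.\<close>
  define N where "N = (LEAST N. M' \<le> N \<and> c \<le> th N)"
  have N: "M' \<le> N" "c \<le> th N" using LeastI_ex[OF ex] by (auto simp: N_def)
  with c have "M' \<noteq> N" by auto
  then obtain N1 where N1: "N = Suc N1" "M' \<le> N1" using N(1) by (cases N) auto
  then have "th N1 < c" using not_less_Least[of N1 "\<lambda>N. M' \<le> N \<and> c \<le> th N"] by (auto simp: N_def[symmetric])
  moreover have "th N \<le> th N1 + 3/2 * t"
    unfolding th_def N1(1) distrib_right[symmetric]
    using t N1(2) by (intro mult_right_mono dw_freq_axis_freq(3)) (auto simp: M'_def)
  moreover have "3/2 * t \<le> 2*pi/3" using t pi_gt3 by simp
  ultimately have "1/2 \<le> sin (th N - real j * pi)" using N(2) by (intro sin_ge_half) (auto simp: c_def)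
  then have "1/2 \<le> \<bar>sin (th N)\<bar>" using abs_sin_add_npi[of "th N - real j * pi" j] by simp
  then show ?thesis using N(1) by (intro exI[of _ N]) (auto simp: th_def M'_def)
qed

text \<open>The growth 2^k makes the weighted sums of the datum geometric, with a bound that does
  not depend on which sequence f is found.\<close>

lemma good_frequencies:
  assumes "0 < t" "t \<le> 1"
  obtains f :: "nat \<Rightarrow> nat" where "strict_mono f" "\<And>k. 2^k \<le> f k" "\<And>k. 1/2 \<le> \<bar>sin (dw_freq (axis_freq (f k)) * t)\<bar>"
proof -
  have "\<exists>f. \<forall>k. (2^k \<le> f k \<and> 1/2 \<le> \<bar>sin (dw_freq (axis_freq (f k)) * t)\<bar>) \<and> f k < f (Suc k)"
  proof (rule dependent_nat_choice)
    show "\<exists>N. 2^0 \<le> N \<and> 1/2 \<le> \<bar>sin (dw_freq (axis_freq N) * t)\<bar>" using good_frequency[OF assms, of 1] by auto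
    show "\<exists>N'. (2^Suc k \<le> N' \<and> 1/2 \<le> \<bar>sin (dw_freq (axis_freq N') * t)\<bar>) \<and> N < N'" for N k
      using good_frequency[OF assms, of "max (2^Suc k) (Suc N)"] by auto
  qed
  then show ?thesis using that by (metis strict_mono_Suc_iff)
qed

lemma wsum_bd_range:
  fixes g :: "nat \<Rightarrow> 'a"
  assumes g: "inj g" and h: "\<And>n. 0 \<le> h n" and w: "\<And>k. w (g k) * h (g k) \<le> q ^ k" and q: "0 \<le> q" "q < 1"
  shows "wsum_bd w (\<lambda>n. if n \<in> range g then h n else 0) (1 / (1 - q))"
  unfolding wsum_bd_def
proof (intro conjI allI impI)
  fix A :: "'a set" assume A: "finite A"
  have fin: "finite (g -` A)" using A g by (rule finite_vimageI)
  have "(\<Sum>n\<in>A. w n * (if n \<in> range g then h n else 0)) = (\<Sum>n\<in>g ` (g -` A). w n * h n)"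
    using A by (intro sum.mono_neutral_cong_right) auto
  also have "\<dots> = (\<Sum>k\<in>g -` A. w (g k) * h (g k))"
    using g by (subst sum.reindex) (auto simp: inj_on_def)
  also have "\<dots> \<le> (\<Sum>k\<in>g -` A. q ^ k)" by (intro sum_mono w)
  also have "\<dots> \<le> (\<Sum>k. q ^ k)" using fin q by (intro sum_le_suminf summable_geometric) auto
  also have "\<dots> = 1 / (1 - q)" using q by (simp add: suminf_geometric)
  finally show "(\<Sum>n\<in>A. w n * (if n \<in> range g then h n else 0)) \<le> 1 / (1 - q)" .
qed (use h in auto)

lemma not_summable_of_frequent:
  fixes F :: "'a \<Rightarrow> real"
  assumes g: "inj (g :: nat \<Rightarrow> 'a)" and F: "\<And>n. 0 \<le> F n" and c: "0 < c" "\<And>k. k \<ge> k0 \<Longrightarrow> c \<le> F (g k)"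
  shows "\<not> F summable_on UNIV"
proof
  assume "F summable_on UNIV"
  then have b: "sum_bd F (\<Sum>\<^sub>\<infinity>n. F n)" using F by (rule summable_sum_bd)
  have "real K * c \<le> (\<Sum>\<^sub>\<infinity>n. F n)" for K
  proof -
    have "real K * c = (\<Sum>k\<in>{k0..<k0+K}. c)" by simp
    also have "\<dots> \<le> (\<Sum>k\<in>{k0..<k0+K}. F (g k))" using c(2) by (intro sum_mono) auto
    also have "\<dots> = (\<Sum>n\<in>g ` {k0..<k0+K}. 1 * F n)"
      using g by (subst sum.reindex) (auto simp: inj_on_def)
    also have "\<dots> \<le> (\<Sum>\<^sub>\<infinity>n. F n)" by (rule wsum_bd_sum[OF b]) simp
    finally show ?thesis .
  qed
  then have K: "real K \<le> (\<Sum>\<^sub>\<infinity>n. F n) / c" for K using c(1) by (simp add: pos_le_divide_eq)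
  obtain K :: nat where "(\<Sum>\<^sub>\<infinity>n. F n) / c < real K" using reals_Archimedean2 by blast
  then show False using K[of K] by simp
qed

section \<open>From coefficient sequences back to functions, and uniqueness for the system\<close>

definition synthesis :: "(Z3 \<Rightarrow> C3) \<Rightarrow> R3 \<Rightarrow> R3" where
  "synthesis c x = (\<chi> i. fourier_sum (\<lambda>n. c n $ i) x)"

lemma synthesis_coeffs:
  assumes c: "(\<lambda>n. wt 1 n * norm (c n)) summable_on UNIV" and sym: "\<And>n. c (- n) = cnj_vec (c n)"
  shows "in_Xv 1 (synthesis c)" "fcv (synthesis c) n = c n"
proof -
  have le: "cmod (c n $ i) \<le> norm (c n)" for i n by (rule Finite_Cartesian_Product.norm_nth_le)
  have w: "(\<lambda>n. wt 1 n * cmod (c n $ i)) summable_on UNIV" for i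
    by (rule summable_on_comparison_test[OF c]) (auto intro!: mult_left_mono le simp: less_imp_le wt_pos)
  have s: "(\<lambda>n. cmod (c n $ i)) summable_on UNIV" for i
  proof (rule summable_on_comparison_test[OF w[of i]])
    show "cmod (c n $ i) \<le> wt 1 n * cmod (c n $ i)" for n
      using mult_right_mono[OF wt_ge_1[of 1 n], of "cmod (c n $ i)"] by simp
  qed simp
  have f: "fc (fourier_sum (\<lambda>n. c n $ i)) n = c n $ i" for i n
    by (rule fc_fourier_sum[OF s]) (simp add: sym)
  show "in_Xv 1 (synthesis c)"
    unfolding in_Xv_def in_X_def synthesis_def vec_lambda_beta by (simp add: f w fourier_sum_periodic fourier_sum_continuous[OF s])
  show "fcv (synthesis c) n = c n" by (simp add: fcv_def synthesis_def f vec_eq_iff)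
qed

text \<open>Dominated convergence of the weighted sums, with twice the common majorant.\<close>

lemma synthesis_cont:
  assumes a: "wsum_bd (wt 1) a A" and dom: "\<And>t n. t \<in> S \<Longrightarrow> norm (c t n) \<le> a n"
    and sym: "\<And>t n. t \<in> S \<Longrightarrow> c t (- n) = cnj_vec (c t n)"
    and cont: "\<And>n. continuous_on S (\<lambda>t. c t n)" and t0: "t0 \<in> S"
  shows "((\<lambda>t. Xnormv 1 (\<lambda>x. synthesis (c t) x - synthesis (c t0) x)) \<longlongrightarrow> 0) (at t0 within S)"
proof -
  have wa: "(\<lambda>n. wt 1 n * a n) summable_on UNIV" by (rule wsum_bd_summable[OF a]) (simp add: less_imp_le wt_pos)
  have ws: "(\<lambda>n. wt 1 n * norm (c t n)) summable_on UNIV" if "t \<in> S" for t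
    by (rule summable_on_comparison_test[OF wa]) (auto intro!: mult_left_mono dom that simp: less_imp_le wt_pos)
  note co = synthesis_coeffs[OF ws sym]
  have e: "Xnormv 1 (\<lambda>x. synthesis (c t) x - synthesis (c t0) x) =
      (\<Sum>i\<in>UNIV. \<Sum>\<^sub>\<infinity>n. wt 1 n * cmod (c t n $ i - c t0 n $ i))" if t: "t \<in> S" for t
  proof -
    have "fc (\<lambda>x. synthesis (c t) x $ i - synthesis (c t0) x $ i) n = c t n $ i - c t0 n $ i" for i n
      using wiener_v_fc_diff[OF in_Xv_wiener[OF co(1)[OF t t]] in_Xv_wiener[OF co(1)[OF t0 t0]], of n] co(2)[OF t t, of n] co(2)[OF t0 t0, of n]
      by (simp add: fcv_def vec_eq_iff)
    then show ?thesis by (simp add: Xnormv_def Xnorm_def)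
  qed
  have "((\<lambda>t. \<Sum>i\<in>UNIV. \<Sum>\<^sub>\<infinity>n. wt 1 n * cmod (c t n $ i - c t0 n $ i)) \<longlongrightarrow> (\<Sum>i\<in>(UNIV::3 set). \<Sum>\<^sub>\<infinity>n::Z3. 0)) (at t0 within S)"
  proof (rule tendsto_sum, rule tendsto_infsum_dominated[where M = "\<lambda>n. 2 * (wt 1 n * a n)"])
    fix i :: 3
    have "((\<lambda>t. c t n) \<longlongrightarrow> c t0 n) (at t0 within S)" for n
      using cont t0 by (auto simp: continuous_on_def)
    then have "((\<lambda>t. wt 1 n * cmod (c t n $ i - c t0 n $ i)) \<longlongrightarrow> wt 1 n * cmod (c t0 n $ i - c t0 n $ i)) (at t0 within S)" for n
      by (intro tendsto_mult_left tendsto_norm tendsto_diff tendsto_vec_nth tendsto_const)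
    then show "((\<lambda>t. wt 1 n * cmod (c t n $ i - c t0 n $ i)) \<longlongrightarrow> 0) (at t0 within S)" for n by simp
    show "(\<lambda>n. 2 * (wt 1 n * a n)) summable_on UNIV" by (intro summable_on_cmult_right wa)
    show "\<forall>\<^sub>F t in at t0 within S. \<forall>n. norm (wt 1 n * cmod (c t n $ i - c t0 n $ i)) \<le> 2 * (wt 1 n * a n)"
      unfolding eventually_at_filter
    proof (rule always_eventually, intro allI impI)
      fix t n assume t: "t \<noteq> t0" "t \<in> S"
      have "cmod (c t n $ i - c t0 n $ i) \<le> cmod (c t n $ i) + cmod (c t0 n $ i)" by (rule norm_triangle_ineq4)
      also have "\<dots> \<le> a n + a n"
        by (intro add_mono order_trans[OF Finite_Cartesian_Product.norm_nth_le dom] t t0)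
      finally have "wt 1 n * cmod (c t n $ i - c t0 n $ i) \<le> wt 1 n * (a n + a n)"
        using wt_pos[of 1 n] by (intro mult_left_mono) auto
      then show "norm (wt 1 n * cmod (c t n $ i - c t0 n $ i)) \<le> 2 * (wt 1 n * a n)"
        using wt_pos[of 1 n] by (simp add: abs_mult)
    qed
  qed
  then have "((\<lambda>t. \<Sum>i\<in>UNIV. \<Sum>\<^sub>\<infinity>n. wt 1 n * cmod (c t n $ i - c t0 n $ i)) \<longlongrightarrow> 0) (at t0 within S)" by simp
  then show ?thesis
    by (rule Lim_transform_eventually) (auto simp: e eventually_at_filter)
qed

lemma wiener_v_eqI:
  assumes "wiener_v a" "wiener_v b" "\<And>n. fcv a n = fcv b n"
  shows "a = b"
proof -
  have "(\<lambda>x. a x $ i) = (\<lambda>x. b x $ i)" for i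
  proof -
    have "fc (\<lambda>x. a x $ i) = fc (\<lambda>x. b x $ i)" using assms(3) by (auto simp: fcv_def vec_eq_iff)
    then show ?thesis using assms(1,2) fourier_sum_fc unfolding wiener_v_def wiener_def by metis
  qed
  then show ?thesis by (auto simp: fun_eq_iff vec_eq_iff)
qed

text \<open>Both solutions satisfy the same coefficient equation; its uniqueness equates the
  coefficients, and these determine functions of the Wiener algebra.\<close>

lemma mhd_mild_unique:
  assumes \<nu>: "0 < \<nu>" and T: "0 \<le> T" "T \<le> 1"
    and 1: "mhd_mild \<nu> T v0 B0 E0 v B E" and 2: "mhd_mild \<nu> T v0 B0 E0 v' B' E'" and t: "t \<in> {0..T}"
  shows "v' t = v t \<and> B' t = B t \<and> E' t = E t"
proof -
  interpret mild mhd_quad 15 mhd_cub 6 "mhd_kernel \<nu>" "29 + 12 / sqrt \<nu>" by (rule mild_mhd[OF \<nu>])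
  have sol: "(\<forall>t\<in>{0..T}. wiener_v (v t) \<and> wiener_v (B t) \<and> wiener_v (E t)) \<and>
      (\<forall>t0\<in>{0..T}. ((\<lambda>t. \<Sum>\<^sub>\<infinity>n. norm (coeffs (v t) (B t) (E t) n - coeffs (v t0) (B t0) (E t0) n)) \<longlongrightarrow> 0) (at t0 within {0..T})) \<and>
      (\<forall>t\<in>{0..T}. \<forall>n. coeffs (v t) (B t) (E t) n = mhd_free \<nu> (fcv v0) (fcv B0) (fcv E0) t n +
         duhamel (\<lambda>s. forcing (coeffs (v s) (B s) (E s))) t n)"
    if s: "mhd_mild \<nu> T v0 B0 E0 v B E" for v B E
  proof -
    have X: "in_Xv 1 (v t) \<and> in_Xv 1 (B t) \<and> in_Xv 1 (E t)" if "t \<in> {0..T}" for t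
      using s that unfolding mhd_mild_def by blast
    have c: "((\<lambda>t. Xnormv 1 (\<lambda>x. v t x - v t0 x)) \<longlongrightarrow> 0) (at t0 within {0..T})"
       "((\<lambda>t. Xnormv 1 (\<lambda>x. B t x - B t0 x)) \<longlongrightarrow> 0) (at t0 within {0..T})"
       "((\<lambda>t. Xnormv 1 (\<lambda>x. E t x - E t0 x)) \<longlongrightarrow> 0) (at t0 within {0..T})" if "t0 \<in> {0..T}" for t0
      using s that unfolding mhd_mild_def by blast+
    have "\<forall>t\<in>{0..T}. wiener_v (v t) \<and> wiener_v (B t) \<and> wiener_v (E t)"
      using X in_Xv_wiener[of 1] by auto
    moreover have "\<forall>t0\<in>{0..T}. ((\<lambda>t. \<Sum>\<^sub>\<infinity>n. norm (coeffs (v t) (B t) (E t) n - coeffs (v t0) (B t0) (E t0) n)) \<longlongrightarrow> 0) (at t0 within {0..T})"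
      by (rule ballI) (rule coeffs_l1_cont[OF X _ c])
    moreover have "\<forall>t\<in>{0..T}. \<forall>n. coeffs (v t) (B t) (E t) n = mhd_free \<nu> (fcv v0) (fcv B0) (fcv E0) t n +
         duhamel (\<lambda>s. forcing (coeffs (v s) (B s) (E s))) t n"
      using mhd_mild_iff[OF \<nu> T(1) X c] s by simp
    ultimately show ?thesis by (intro conjI)
  qed
  note s1 = sol[OF 1, THEN conjunct1] sol[OF 1, THEN conjunct2, THEN conjunct1] sol[OF 1, THEN conjunct2, THEN conjunct2]
  note s2 = sol[OF 2, THEN conjunct1] sol[OF 2, THEN conjunct2, THEN conjunct1] sol[OF 2, THEN conjunct2, THEN conjunct2]
  have sm: "(\<lambda>n. norm (coeffs (v t) (B t) (E t) n)) summable_on UNIV" "(\<lambda>n. norm (coeffs (v' t) (B' t) (E' t) n)) summable_on UNIV"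
    if "t \<in> {0..T}" for t
    using s1(1) s2(1) that by (auto intro!: coeffs_summable)
  have "coeffs (v' t) (B' t) (E' t) = coeffs (v t) (B t) (E t)"
    by (rule mild_unique[OF T, where u = "\<lambda>t. coeffs (v' t) (B' t) (E' t)" and v = "\<lambda>t. coeffs (v t) (B t) (E t)"
          and L = "mhd_free \<nu> (fcv v0) (fcv B0) (fcv E0)", OF sm(2,1) s2(2)[rule_format] s1(2)[rule_format]
          s2(3)[rule_format] s1(3)[rule_format] t])
  then have "fcv (v' t) n = fcv (v t) n" "fcv (B' t) n = fcv (B t) n" "fcv (E' t) n = fcv (E t) n" for n
    by (auto simp: coeffs_def fun_eq_iff)
  then show ?thesis using s1(1) s2(1) t by (auto intro!: wiener_v_eqI)
qed

section \<open>Construction of the irregular datum and its solution\<close>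

lemma smooth_torus_v_weight:
  assumes "smooth_torus_v u"
  obtains M S where "wsum_bd (wt 1) (\<lambda>n. norm (fcv u n)) S"
    "\<And>n s. s \<le> 2 \<Longrightarrow> wt s n * norm (fcv u n) * (1 + nsq n) \<le> M"
proof -
  have sm: "smooth_torus (\<lambda>x. u x $ i)" for i using assms by (simp add: smooth_torus_v_def)
  have "\<exists>M S. wsum_bd (wt 1) (\<lambda>n. cmod (fc (\<lambda>x. u x $ i) n)) S \<and>
    (\<forall>n s. s \<le> 2 \<longrightarrow> wt s n * cmod (fc (\<lambda>x. u x $ i) n) * (1 + nsq n) \<le> M)" for i
    by (rule smooth_torus_weight[OF sm[of i]]) blast
  then obtain M S where b: "\<And>i. wsum_bd (wt 1) (\<lambda>n. cmod (fc (\<lambda>x. u x $ i) n)) (S i)"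
    and M: "\<And>i n s. s \<le> 2 \<Longrightarrow> wt s n * cmod (fc (\<lambda>x. u x $ i) n) * (1 + nsq n) \<le> M i"
    by metis
  have le: "norm (fcv u n) \<le> cmod (fc (\<lambda>x. u x $ 1) n) + (cmod (fc (\<lambda>x. u x $ 2) n) + cmod (fc (\<lambda>x. u x $ 3) n))" for n
    using norm_vec_le_sum[of "fcv u n"] by (simp add: fcv_def sum_3)
  show ?thesis
  proof (rule that)
    show "wsum_bd (wt 1) (\<lambda>n. norm (fcv u n)) (S 1 + (S 2 + S 3))"
      by (rule wsum_bd_mono[OF wsum_bd_add[OF b wsum_bd_add[OF b b]]]) (auto simp: less_imp_le wt_pos le)
    show "wt s n * norm (fcv u n) * (1 + nsq n) \<le> M 1 + (M 2 + M 3)" if s: "s \<le> 2" for s n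
    proof -
      have "wt s n * norm (fcv u n) * (1 + nsq n) \<le>
        wt s n * (cmod (fc (\<lambda>x. u x $ 1) n) + (cmod (fc (\<lambda>x. u x $ 2) n) + cmod (fc (\<lambda>x. u x $ 3) n))) * (1 + nsq n)"
        using le[of n] wt_pos[of s n] nsq_nonneg[of n] by (intro mult_right_mono mult_left_mono) auto
      then show ?thesis using M[OF s, of n 1] M[OF s, of n 2] M[OF s, of n 3] by (simp add: distrib_left distrib_right)
    qed
  qed
qed

text \<open>At (0, N, 0) the curl carries the first component of E, multiplied by N, into the third
  component of B. The factor 1/4 arises from exp (-t/2) >= 1/2 for t <= 1, |sin| >= 1/2 and dw_freq
  <= N; the factor 4 bounds the two propagators acting on B.\<close>

lemma mhd_free_lower:
  assumes t: "0 \<le> t" "t \<le> 1" and N: "1 \<le> N" "1/2 \<le> \<bar>sin (dw_freq (axis_freq N) * t)\<bar>"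
  shows "cmod (E (axis_freq N) $ 1) / 4 - 4 * norm (B (axis_freq N)) \<le> cmod (fst (snd (mhd_free \<nu> v B E t (axis_freq N))) $ 3)"
proof -
  let ?n = "axis_freq N"
  have nz: "nsq ?n \<noteq> 0" using N by (simp add: nsq_axis_freq)
  have d: "dw_freq ?n \<le> real N" "0 < dw_freq ?n" using dw_freq_axis_freq(1)[OF N(1)] dw_freq_pos[OF nz] by auto
  have e: "1/2 \<le> exp (- t / 2)" using exp_ge_add_one_self[of "- t / 2"] t by simp
  have "1/2 * (1/2) / real N \<le> exp (- t / 2) * \<bar>sin (dw_freq ?n * t)\<bar> / dw_freq ?n"
    using N d e by (intro frac_le mult_mono) auto
  also have "\<dots> = \<bar>dw_S_re t ?n\<bar>" using nz d by (simp add: dw_S_re_def abs_mult)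
  finally have S: "1/4 \<le> \<bar>dw_S_re t ?n\<bar> * real N" using N by (simp add: field_simps)
  define z where "z = (dw_Sd t ?n + dw_S t ?n) * (B ?n $ 3)"
  have "cmod z \<le> 4 * norm (B ?n)"
    unfolding z_def norm_mult dw_eq_re using dw_re_bound[of t ?n] t
      norm_triangle_ineq[of "complex_of_real (dw_Sd_re t ?n)" "complex_of_real (dw_S_re t ?n)"]
    by (intro mult_mono Finite_Cartesian_Product.norm_nth_le) auto
  moreover have "fst (snd (mhd_free \<nu> v B E t ?n)) $ 3 = z + dw_S t ?n * (\<i> * (of_nat N * E ?n $ 1))"
    by (simp add: mhd_free_def z_def curl_hat_def axis_freq_nth distrib_right)
  moreover have "cmod (E ?n $ 1) / 4 \<le> cmod (dw_S t ?n * (\<i> * (of_nat N * E ?n $ 1)))"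
    using mult_right_mono[OF S, of "cmod (E ?n $ 1)"] by (simp add: norm_mult dw_eq_re mult.assoc)
  ultimately show ?thesis
    using norm_triangle_ineq4[of "z + dw_S t ?n * (\<i> * (of_nat N * E ?n $ 1))" z] by simp
qed

text \<open>The quotient of the weights is <n>^(-\<delta>/2), so doubling frequencies give a
  geometric sequence of ratio 2^(-\<delta>/2).\<close>

lemma frequency_weight:
  assumes "2^k \<le> N" "0 \<le> \<delta>"
  shows "wt 1 (axis_freq N) * (1 / wt (1 + \<delta>/2) (axis_freq N)) \<le> (2 powr (- \<delta>/2)) ^ k"
proof -
  let ?b = "sqrt (1 + nsq (axis_freq N))"
  have "real (2^k) \<le> real N" using assms(1) by (rule of_nat_mono)
  also have "\<dots> \<le> ?b" by (rule real_le_rsqrt) (simp add: nsq_axis_freq)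
  finally have b: "2^k \<le> ?b" by simp
  have "wt 1 (axis_freq N) * (1 / wt (1 + \<delta>/2) (axis_freq N)) = ?b powr (- \<delta>/2)"
  proof -
    have "wt 1 (axis_freq N) * (1 / wt (1 + \<delta>/2) (axis_freq N)) = ?b powr 1 / ?b powr (1 + \<delta>/2)"
      by (simp only: wt_sqrt times_divide_eq_right mult_1_right)
    also have "\<dots> = ?b powr (1 - (1 + \<delta>/2))" by (rule powr_diff[symmetric])
    finally show ?thesis by simp
  qed
  also have "\<dots> \<le> (2^k) powr (- \<delta>/2)"
    by (rule powr_mono2') (use b assms(2) in auto)
  also have "\<dots> = (2 powr (- \<delta>/2)) ^ k"
    by (simp add: powr_realpow[symmetric] powr_powr mult.commute)
  finally show ?thesis .
qed

lemma small_time: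
  assumes "0 \<le> X1" "0 \<le> X2" "0 < (y1::real)" "0 < y2" "0 \<le> c"
  obtains T where "0 < T" "T \<le> 1" "2 * c * sqrt T * X1 \<le> y1" "2 * c * sqrt T * X2 \<le> y2"
proof -
  \<comment> \<open>The time will be h^2, so its root is h. The summands 1 keep the denominators
    positive when a coefficient is 0.\<close>
  define h where "h = min 1 (min (y1 / (2 * c * X1 + 1)) (y2 / (2 * c * X2 + 1)))"
  have p: "0 < 2 * c * X1 + 1" "0 < 2 * c * X2 + 1" using assms by (auto intro!: add_nonneg_pos)
  have h: "0 < h" "h \<le> 1" "h \<le> y1 / (2 * c * X1 + 1)" "h \<le> y2 / (2 * c * X2 + 1)"
    using p assms by (auto simp: h_def)
  have "h * (2 * c * X1 + 1) \<le> y1" "h * (2 * c * X2 + 1) \<le> y2"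
    using h(3,4) p by (simp_all add: pos_le_divide_eq)
  then have "2 * c * h * X1 \<le> y1" "2 * c * h * X2 \<le> y2" using h(1) by (simp_all add: algebra_simps)
  then show ?thesis using that[of "h\<^sup>2"] h by (simp add: power_le_one)
qed

lemma exists_irregular_solution:
  assumes \<nu>: "\<nu> > 0" and \<delta>: "0 < \<delta>" "\<delta> < 1"
    and sm: "smooth_torus E02" "smooth_torus E03" "smooth_torus_v v0" "smooth_torus_v B0"
  shows "\<exists>E01. in_X 1 E01 \<and> \<not> in_X (1 + \<delta>/2) E01 \<and>
          (\<exists>T>0. \<exists>v B E.
             mhd_mild \<nu> T v0 B0 (\<lambda>x. vector [E01 x, E02 x, E03 x]) v B E \<and>
             (\<forall>v' B' E'. mhd_mild \<nu> T v0 B0 (\<lambda>x. vector [E01 x, E02 x, E03 x]) v' B' E' \<longrightarrow>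
                (\<forall>t\<in>{0..T}. v' t = v t \<and> B' t = B t \<and> E' t = E t)) \<and>
             (\<exists>t\<in>{0<..<T}. \<not> in_Xv (5 + \<delta>) (v t) \<or> \<not> in_Xv (5 + \<delta>) (B t)))"
proof -
  interpret mild mhd_quad 15 mhd_cub 6 "mhd_kernel \<nu>" "29 + 12 / sqrt \<nu>" by (rule mild_mhd[OF \<nu>])
  define r where "r = 1 + \<delta>/2"
  have r: "0 \<le> r" "r \<le> 2" "r \<le> 5 + \<delta>" using \<delta> by (auto simp: r_def)
  have wp: "0 < wt s n" for s n by (rule wt_pos)
  obtain M2 S2 where e2: "wsum_bd (wt 1) (\<lambda>n. cmod (fc E02 n)) S2"
    "\<And>n s. s \<le> 2 \<Longrightarrow> wt s n * cmod (fc E02 n) * (1 + nsq n) \<le> M2" by (rule smooth_torus_weight[OF sm(1)]) (rule that, assumption, blast)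
  obtain M3 S3 where e3: "wsum_bd (wt 1) (\<lambda>n. cmod (fc E03 n)) S3"
    "\<And>n s. s \<le> 2 \<Longrightarrow> wt s n * cmod (fc E03 n) * (1 + nsq n) \<le> M3" by (rule smooth_torus_weight[OF sm(2)]) (rule that, assumption, blast)
  obtain Mv Sv where ev: "wsum_bd (wt 1) (\<lambda>n. norm (fcv v0 n)) Sv"
    "\<And>n s. s \<le> 2 \<Longrightarrow> wt s n * norm (fcv v0 n) * (1 + nsq n) \<le> Mv" by (rule smooth_torus_v_weight[OF sm(3)]) (rule that, assumption, blast)
  obtain MB SB where eB: "wsum_bd (wt 1) (\<lambda>n. norm (fcv B0 n)) SB"
    "\<And>n s. s \<le> 2 \<Longrightarrow> wt s n * norm (fcv B0 n) * (1 + nsq n) \<le> MB" by (rule smooth_torus_v_weight[OF sm(4)]) (rule that, assumption, blast)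
  \<comment> \<open>The part of the data that is prescribed, kept apart from the component still to
    be constructed.\<close>
  define dat where "dat n = (norm (fcv v0 n) + norm (fcv B0 n)) + (cmod (fc E02 n) + cmod (fc E03 n))" for n
  define Dt where "Dt = (Sv + SB) + (S2 + S3)"
  have dat: "wsum_bd (wt 1) dat Dt"
    unfolding dat_def[abs_def] Dt_def by (intro wsum_bd_add e2 e3 ev eB)
  have drop: "wt r n * x \<le> M" if "wt r n * x * (1 + nsq n) \<le> M" "0 \<le> x" for x M n
  proof -
    have "wt r n * x * 1 \<le> wt r n * x * (1 + nsq n)"
      using that(2) wp[of r n] nsq_nonneg[of n] by (intro mult_left_mono) auto
    then show ?thesis using that(1) by simp
  qed
  define Dr where "Dr = (Mv + MB) + (M2 + M3)"
  have datr: "wt r n * dat n \<le> Dr" for n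
    unfolding dat_def Dr_def distrib_left by (intro add_mono drop e2 e3 ev eB r) auto
  have Dr0: "0 \<le> Dr" using datr[of 0] wp[of r 0] wsum_bd_nonneg[OF dat, of 0] by (meson mult_nonneg_nonneg less_imp_le order_trans)
  have Dt0: "0 \<le> Dt" by (rule wsum_bd_bound_nonneg[OF dat])
  define q where "q = 2 powr (- \<delta>/2)"
  have q: "0 \<le> q" "q < 1" using \<delta> by (auto simp: q_def powr_less_one)
  \<comment> \<open>25 is the constant of \<open>mhd_free_bound\<close>; the two geometric series
    belong to the frequencies g k and -g k of the unknown component.\<close>
  define \<rho> where "\<rho> = 25 * (Dt + (1 / (1 - q) + 1 / (1 - q)))"
  \<comment> \<open>The summand 2 anticipates the bound \<open>avr\<close> for the component still
    to be constructed.\<close>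
  define \<rho>r where "\<rho>r = 25 * (Dr + 2)"
  \<comment> \<open>This makes \<theta> * \<rho>r equal to 1/8, half of the coefficient 1/4 of the
    free wave.\<close>
  define \<theta> where "\<theta> = 1 / (8 * \<rho>r)"
  have "0 < 1 / (1 - q)" using q by simp
  then have \<rho>: "0 < \<rho>" using Dt0 unfolding \<rho>_def
    by (intro mult_pos_pos add_nonneg_pos[OF Dt0] add_pos_pos) auto
  have \<rho>r: "1 \<le> \<rho>r" using Dr0 by (simp add: \<rho>r_def)
  have \<theta>: "0 < \<theta>" "\<theta> \<le> 1" "\<theta> * \<rho>r = 1/8" using \<rho>r by (auto simp: \<theta>_def divide_le_eq)
  define D where "D = 2 powr r"
  have D0: "0 \<le> D" by (simp add: D_def)
  \<comment> \<open>\<rho>, \<rho>r and \<theta> involve only the prescribed data and \<delta>, so T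
    is fixed before any frequency is selected.\<close>
  obtain T where T: "0 < T" "T \<le> 1"
    and small1: "2 * (29 + 12 / sqrt \<nu>) * sqrt T * (15 * (2 * (4 * \<rho>^2)) + 6 * 15 * (2^2 * (8 * \<rho>^3))) \<le> \<rho>"
    and small2: "2 * (29 + 12 / sqrt \<nu>) * sqrt T * (15 * (8 * D * \<rho>) + 6 * 15 * (16 * D^2 * \<rho>^2 + 8 * D * \<rho>^2)) \<le> \<theta>"
    by (rule small_time[of "15 * (2 * (4 * \<rho>^2)) + 6 * 15 * (2^2 * (8 * \<rho>^3))"
          "15 * (8 * D * \<rho>) + 6 * 15 * (16 * D^2 * \<rho>^2 + 8 * D * \<rho>^2)" \<rho> \<theta> "29 + 12 / sqrt \<nu>"])
       (use \<rho> \<theta> D0 c_nonneg in auto)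
  define t1 where "t1 = T / 2"
  have t1: "0 < t1" "t1 \<le> 1" "t1 \<in> {0<..<T}" "t1 \<in> {0..T}" using T by (auto simp: t1_def)
  obtain f :: "nat \<Rightarrow> nat" where f: "strict_mono f" "\<And>k. 2^k \<le> f k"
    "\<And>k. 1/2 \<le> \<bar>sin (dw_freq (axis_freq (f k)) * t1)\<bar>"
    by (rule good_frequencies[OF t1(1,2)]) (rule that, assumption, blast, blast)
  define g where "g k = axis_freq (f k)" for k
  have inj: "inj g"
    by (rule injI) (simp add: g_def inj_eq[OF inj_axis_freq] strict_mono_eq[OF f(1)])
  \<comment> \<open>Both signs of each frequency occur, so the function is real and its coefficients
    are even in n. Writing the two ranges as separate summands gives weighted values between 1 and 2
    on the range of g.\<close>
  define av where "av n = (if n \<in> range g then 1 / wt r n else 0) + (if n \<in> range (\<lambda>k. - g k) then 1 / wt r n else 0)" for n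
  have wt_minus: "wt s (- n) = wt s n" for s n by (simp add: wt_def)
  have av_minus: "av (- n) = av n" for n
  proof -
    have "- n \<in> range g \<longleftrightarrow> n \<in> range (\<lambda>k. - g k)" "- n \<in> range (\<lambda>k. - g k) \<longleftrightarrow> n \<in> range g"
      by (auto simp: image_iff) (metis minus_minus)+
    then show ?thesis by (simp add: av_def wt_minus)
  qed
  have fw: "wt 1 (g k) * (1 / wt r (g k)) \<le> q ^ k" for k
    unfolding g_def r_def q_def by (rule frequency_weight) (use f(2) \<delta> in auto)
  have av: "wsum_bd (wt 1) av (1 / (1 - q) + 1 / (1 - q))"
    unfolding av_def[abs_def]
    by (intro wsum_bd_add wsum_bd_range inj q) (use fw inj wp in \<open>auto simp: less_imp_le wt_minus inj_on_def\<close>)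
  note av0 = wsum_bd_nonneg[OF av]
  have avr: "wt r n * av n \<le> 2" for n using wp[of r n] by (auto simp: av_def distrib_left)
  have avg: "1 / wt r (g k) \<le> av (g k)" for k using wp[of r "g k"] by (auto simp: av_def)
  define E01 where "E01 = fourier_sum (\<lambda>n. complex_of_real (av n))"
  have av_sum: "(\<lambda>n. cmod (complex_of_real (av n))) summable_on UNIV"
    using sum_bd_summable[OF wsum_bd_imp_sum_bd[OF av wt_ge_1]] av0 by simp
  have fcE: "fc E01 n = complex_of_real (av n)" for n
    unfolding E01_def by (rule fc_fourier_sum[OF av_sum]) (simp add: av_minus)
  have E01: "in_X 1 E01"
    unfolding in_X_def
  proof (intro conjI)
    show "periodic3 E01" unfolding E01_def by (rule fourier_sum_periodic)
    show "continuous_on UNIV E01" unfolding E01_def by (rule fourier_sum_continuous[OF av_sum])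
    show "(\<lambda>n. wt 1 n * cmod (fc E01 n)) summable_on UNIV"
      using wsum_bd_summable[OF av] wp av0 by (simp add: fcE less_imp_le)
  qed
  have nE01: "\<not> in_X (1 + \<delta>/2) E01"
  proof -
    have "\<not> (\<lambda>n. wt r n * cmod (fc E01 n)) summable_on UNIV"
    proof (rule not_summable_of_frequent[OF inj, of _ 1 0])
      show "1 \<le> wt r (g k) * cmod (fc E01 (g k))" for k
        using mult_left_mono[OF avg[of k], of "wt r (g k)"] wp[of r "g k"] av0[of "g k"] by (simp add: fcE)
    qed (use wp in \<open>auto simp: less_imp_le\<close>)
    then show ?thesis by (simp add: in_X_def r_def)
  qed
  define E0 :: "R3 \<Rightarrow> R3" where "E0 = (\<lambda>x. vector [E01 x, E02 x, E03 x])"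
  have E0c: "fcv E0 n $ 1 = complex_of_real (av n)" "fcv E0 n $ 2 = fc E02 n" "fcv E0 n $ 3 = fc E03 n" for n
    by (simp_all add: fcv_def E0_def fcE)
  define l where "l n = 25 * (dat n + av n)" for n
  define L where "L = mhd_free \<nu> (fcv v0) (fcv B0) (fcv E0)"
  have Lb: "norm (L t n) \<le> l n" if "t \<in> {0..T}" for t n
  proof -
    have "norm (fcv E0 n) \<le> av n + cmod (fc E02 n) + cmod (fc E03 n)"
      using norm_vec_le_sum[of "fcv E0 n"] av0[of n] by (simp add: sum_3 E0c)
    then show ?thesis
      using mhd_free_bound[OF \<nu>, of t "fcv v0" "fcv B0" "fcv E0" n] that unfolding L_def l_def dat_def by auto
  qed
  have lb: "wsum_bd (wt 1) l \<rho>" unfolding l_def[abs_def] \<rho>_def by (intro wsum_bd_cmult wsum_bd_add dat av) simp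
  have lr: "wt r n * l n \<le> \<rho>r" for n
    using datr[of n] avr[of n] unfolding l_def \<rho>r_def by (simp add: algebra_simps)
  obtain u a where u: "\<And>n. continuous_on {0..T} (\<lambda>t. u t n)" "wsum_bd (wt 1) a (2 * \<rho>)"
    "\<And>t n. t \<in> {0..T} \<Longrightarrow> norm (u t n) \<le> a n"
    "\<And>t n. t \<in> {0..T} \<Longrightarrow> u t n = L t n + duhamel (\<lambda>s. forcing (u s)) t n"
    "\<And>t n. t \<in> {0..T} \<Longrightarrow> wt r n * norm (u t n - L t n) \<le> \<theta> * \<rho>r"
    by (rule mild_exists[of T "wt 1" 2 "wt r" D L l \<rho> \<rho>r \<theta>])
       (use T wt_ge_1[of 1] wt_submult wp wt_quasi_add[OF r(1)] D0 Lb lb lr \<theta> small1 small2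
        in \<open>auto simp: less_imp_le D_def L_def mhd_free_cont\<close>)
  note a1 = wsum_bd_imp_sum_bd[OF u(2) wt_ge_1[of 1, simplified]]
  have us: "(\<lambda>n. norm (u t n)) summable_on UNIV" if "t \<in> {0..T}" for t
    by (rule summable_on_comparison_test[OF sum_bd_summable[OF a1]]) (use u(3) that in auto)
  have ul: "((\<lambda>t. \<Sum>\<^sub>\<infinity>n. norm (u t n - u t0 n)) \<longlongrightarrow> 0) (at t0 within {0..T})" if t0: "t0 \<in> {0..T}" for t0
  proof -
    have "((\<lambda>t. \<Sum>\<^sub>\<infinity>n. norm (u t n - u t0 n)) \<longlongrightarrow> (\<Sum>\<^sub>\<infinity>n::Z3. 0)) (at t0 within {0..T})"
    proof (rule tendsto_infsum_dominated)
      have "((\<lambda>t. u t n) \<longlongrightarrow> u t0 n) (at t0 within {0..T})" for n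
        using u(1) t0 by (auto simp: continuous_on_def)
      then show "((\<lambda>t. norm (u t n - u t0 n)) \<longlongrightarrow> 0) (at t0 within {0..T})" for n
        using tendsto_norm_zero LIM_zero by blast
      show "(\<lambda>n. 2 * a n) summable_on UNIV" by (intro summable_on_cmult_right sum_bd_summable[OF a1])
      show "\<forall>\<^sub>F t in at t0 within {0..T}. \<forall>n. norm (norm (u t n - u t0 n)) \<le> 2 * a n"
        unfolding eventually_at_filter
      proof (rule always_eventually, intro allI impI)
        fix t n assume t: "t \<noteq> t0" "t \<in> {0..T}"
        have "norm (u t n - u t0 n) \<le> norm (u t n) + norm (u t0 n)" by (rule norm_triangle_ineq4)
        also have "\<dots> \<le> a n + a n" by (intro add_mono u(3) t t0)
        finally show "norm (norm (u t n - u t0 n)) \<le> 2 * a n" by simp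
      qed
    qed
    then show ?thesis by simp
  qed
  have fcv_minus: "fcv w (- n) = cnj_vec (fcv w n)" for w n
    by (simp add: fcv_def vec_eq_iff fc_minus)
  have T0: "0 \<le> T" using T by simp
  \<comment> \<open>Needed for the synthesis: only sequences with this symmetry are coefficients of
    real fields.\<close>
  have usym: "u t (- n) = cnj_state (u t n)" if "t \<in> {0..T}" for t n
    by (rule mild_equivariant[OF bounded_linear_cnj_state bounded_linear_cnj_force norm_cnj_state cnj_force_quad cnj_force_cub cnj_state_kernel _ T0 T(2) us ul u(4) that])
       (simp add: L_def cnj_state_free fcv_minus)
  define v B E where "v t = synthesis (\<lambda>n. fst (u t n))" and "B t = synthesis (\<lambda>n. fst (snd (u t n)))"
    and "E t = synthesis (\<lambda>n. snd (snd (u t n)))" for t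
  note pr = order_trans[OF norm_triple_ge(1) u(3)] order_trans[OF norm_triple_ge(2) u(3)] order_trans[OF norm_triple_ge(3) u(3)]
  have sy: "fst (u t (- n)) = cnj_vec (fst (u t n))" "fst (snd (u t (- n))) = cnj_vec (fst (snd (u t n)))"
    "snd (snd (u t (- n))) = cnj_vec (snd (snd (u t n)))" if "t \<in> {0..T}" for t n
    using usym[OF that, of n] by (simp_all add: cnj_state_def)
  have wa: "(\<lambda>n. wt 1 n * a n) summable_on UNIV" by (rule wsum_bd_summable[OF u(2)]) (simp add: less_imp_le wp)
  have ws: "(\<lambda>n. wt 1 n * norm (h n)) summable_on UNIV" if "\<And>n. norm (h n) \<le> a n" for h :: "Z3 \<Rightarrow> C3"
    by (rule summable_on_comparison_test[OF wa]) (use that wp in \<open>auto intro!: mult_left_mono simp: less_imp_le\<close>)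
  have X: "in_Xv 1 (v t) \<and> in_Xv 1 (B t) \<and> in_Xv 1 (E t)" if t: "t \<in> {0..T}" for t
    unfolding v_def B_def E_def by (intro conjI synthesis_coeffs(1) ws pr t sy)
  have uc: "coeffs (v t) (B t) (E t) = u t" if t: "t \<in> {0..T}" for t
    using synthesis_coeffs(2)[OF ws[OF pr(1)[OF t]] sy(1)[OF t]] synthesis_coeffs(2)[OF ws[OF pr(2)[OF t]] sy(2)[OF t]]
      synthesis_coeffs(2)[OF ws[OF pr(3)[OF t]] sy(3)[OF t]]
    by (simp add: coeffs_def v_def B_def E_def fun_eq_iff)
  have c: "((\<lambda>t. Xnormv 1 (\<lambda>x. v t x - v t0 x)) \<longlongrightarrow> 0) (at t0 within {0..T})"
    "((\<lambda>t. Xnormv 1 (\<lambda>x. B t x - B t0 x)) \<longlongrightarrow> 0) (at t0 within {0..T})"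
    "((\<lambda>t. Xnormv 1 (\<lambda>x. E t x - E t0 x)) \<longlongrightarrow> 0) (at t0 within {0..T})" if "t0 \<in> {0..T}" for t0
    unfolding v_def B_def E_def
    by (rule synthesis_cont[OF u(2)]; use pr sy that in \<open>auto intro!: continuous_intros u(1)\<close>)+
  have duhamel_cong: "duhamel F t n = duhamel F' t n" if "\<And>s. s \<in> {0..t} \<Longrightarrow> F s n = F' s n" for F F' t n
    unfolding duhamel_def by (rule integral_cong) (simp add: that)
  have sol: "mhd_mild \<nu> T v0 B0 E0 v B E"
  proof (rule iffD2[OF mhd_mild_iff[OF \<nu> T0 X c]], assumption+, intro ballI allI)
    fix t n assume t: "t \<in> {0..T}"
    have "duhamel (\<lambda>s. forcing (coeffs (v s) (B s) (E s))) t n = duhamel (\<lambda>s. forcing (u s)) t n"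
      by (rule duhamel_cong) (use uc t in auto)
    then show "coeffs (v t) (B t) (E t) n = mhd_free \<nu> (fcv v0) (fcv B0) (fcv E0) t n + duhamel (\<lambda>s. forcing (coeffs (v s) (B s) (E s))) t n"
      using u(4)[OF t, of n] by (simp add: uc[OF t] L_def)
  qed
  have irr: "\<not> in_Xv (5 + \<delta>) (B t1)"
  proof
    assume "in_Xv (5 + \<delta>) (B t1)"
    then have "(\<lambda>n. wt (5 + \<delta>) n * cmod (fcv (B t1) n $ 3)) summable_on UNIV"
      by (auto simp: in_Xv_def in_X_def fcv_def)
    then have "(\<lambda>n. wt r n * cmod (fcv (B t1) n $ 3)) summable_on UNIV"
      by (rule summable_on_comparison_test) (auto intro!: mult_right_mono wt_mono r simp: less_imp_le wp)
    moreover have "\<not> (\<lambda>n. wt r n * cmod (fcv (B t1) n $ 3)) summable_on UNIV"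
    \<comment> \<open>Beyond 64 * MB the weighted coefficient of B_0 is at most 1/64, and the factor
      4 of \<open>mhd_free_lower\<close> turns this into 1/16. The free part has at least 1/4 and
      Duhamel at most 1/8, which leaves 1/4 - 1/16 - 1/8 = 1/16.\<close>
    proof (rule not_summable_of_frequent[OF inj, of _ "1/16" "nat \<lceil>64 * MB\<rceil>"])
      show "1/16 \<le> wt r (g k) * cmod (fcv (B t1) (g k) $ 3)" if k: "nat \<lceil>64 * MB\<rceil> \<le> k" for k
      proof -
        let ?n = "g k"
        have fk: "k \<le> f k" "1 \<le> f k" using f(2)[of k] less_exp[of k] by (auto intro: order_trans[OF _ f(2)] less_imp_le le_less_trans)
        have "64 * MB \<le> real k" using k by linarith
        also have "\<dots> \<le> real (f k)" using fk by simp
        also have "\<dots> \<le> 1 + nsq ?n"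
        proof -
          have "real (f k) * 1 \<le> real (f k) * real (f k)" using fk(2) by (intro mult_left_mono) auto
          then show ?thesis by (simp add: g_def nsq_axis_freq power2_eq_square)
        qed
        finally have "64 * (wt r ?n * norm (fcv B0 ?n) * (1 + nsq ?n)) \<le> 1 + nsq ?n"
          using eB(2)[OF r(2), of ?n] by linarith
        then have "(64 * (wt r ?n * norm (fcv B0 ?n))) * (1 + nsq ?n) \<le> 1 * (1 + nsq ?n)" by simp
        then have b: "64 * (wt r ?n * norm (fcv B0 ?n)) \<le> 1"
          by (rule mult_right_le_imp_le) (use nsq_nonneg[of ?n] in simp)
        have low: "av ?n / 4 - 4 * norm (fcv B0 ?n) \<le> cmod (fst (snd (L t1 ?n)) $ 3)"
          using mhd_free_lower[of t1 "f k" "fcv E0" "fcv B0" \<nu> "fcv v0"] t1 fk f(3)[of k] av0[of ?n]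
          unfolding L_def g_def E0c by simp
        have fB: "fcv (B t1) ?n = fst (snd (u t1 ?n))"
          using fun_cong[OF uc[OF t1(4)], of ?n] by (simp add: coeffs_def prod_eq_iff)
        have "cmod (fst (snd (u t1 ?n)) $ 3 - fst (snd (L t1 ?n)) $ 3) \<le> norm (fst (snd (u t1 ?n - L t1 ?n)))"
          using Finite_Cartesian_Product.norm_nth_le[of "fst (snd (u t1 ?n - L t1 ?n))" 3] by simp
        also have "\<dots> \<le> norm (u t1 ?n - L t1 ?n)" by (rule norm_triple_ge)
        finally have "cmod (fst (snd (L t1 ?n)) $ 3) - norm (u t1 ?n - L t1 ?n) \<le> cmod (fcv (B t1) ?n $ 3)"
          unfolding fB using norm_triangle_sub[of "fst (snd (L t1 ?n)) $ 3" "fst (snd (u t1 ?n)) $ 3"]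
          by (simp add: norm_minus_commute)
        then have "av ?n / 4 - 4 * norm (fcv B0 ?n) - norm (u t1 ?n - L t1 ?n) \<le> cmod (fcv (B t1) ?n $ 3)"
          using low by linarith
        from mult_left_mono[OF this, of "wt r ?n"] wp[of r ?n]
        have "wt r ?n * av ?n / 4 - 4 * (wt r ?n * norm (fcv B0 ?n)) - wt r ?n * norm (u t1 ?n - L t1 ?n)
            \<le> wt r ?n * cmod (fcv (B t1) ?n $ 3)"
          by (simp add: right_diff_distrib mult_ac)
        moreover have "1 \<le> wt r ?n * av ?n"
          using mult_left_mono[OF avg[of k], of "wt r ?n"] wp[of r ?n] by simp
        ultimately show ?thesis using b u(5)[OF t1(4), of ?n] \<theta>(3) by linarith
      qed
    qed (use wp in \<open>auto simp: less_imp_le\<close>)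
    ultimately show False by blast
  qed
  show ?thesis
    using E01 nE01 T(1) sol mhd_mild_unique[OF \<nu> T0 T(2) sol] irr t1(3) unfolding E0_def by blast
qed

theorem theorem1p3:
  fixes \<nu> :: real
  assumes "\<nu> > 0"
  shows "\<exists>\<delta>0>0. \<forall>\<delta>. 0 < \<delta> \<and> \<delta> < \<delta>0 \<longrightarrow>
    (\<forall>E02 E03 v0 B0.
       smooth_torus E02 \<and> smooth_torus E03 \<and> smooth_torus_v v0 \<and> smooth_torus_v B0 \<and>
       (\<forall>x. divg v0 x = 0) \<and> (\<forall>x. divg B0 x = 0) \<and> fcv B0 0 = 0 \<longrightarrow>
       (\<exists>E01. in_X 1 E01 \<and> \<not> in_X (1 + \<delta>/2) E01 \<and>
          (\<exists>T>0. \<exists>v B E.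
             mhd_mild \<nu> T v0 B0 (\<lambda>x. vector [E01 x, E02 x, E03 x]) v B E \<and>
             (\<forall>v' B' E'. mhd_mild \<nu> T v0 B0 (\<lambda>x. vector [E01 x, E02 x, E03 x]) v' B' E' \<longrightarrow>
                (\<forall>t\<in>{0..T}. v' t = v t \<and> B' t = B t \<and> E' t = E t)) \<and>
             (\<exists>t\<in>{0<..<T}. \<not> in_Xv (5 + \<delta>) (v t) \<or> \<not> in_Xv (5 + \<delta>) (B t)))))"
proof (intro exI[of _ 1] conjI allI impI)
  \<comment> \<open>The threshold 1 keeps r = 1 + \<delta>/2 below 2, the range in which the decay
    of the smooth data was weighted.\<close>
  fix \<delta> :: real and E02 E03 :: "R3 \<Rightarrow> real" and v0 B0 :: "R3 \<Rightarrow> R3"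
  assume "0 < \<delta> \<and> \<delta> < 1"
    and "smooth_torus E02 \<and> smooth_torus E03 \<and> smooth_torus_v v0 \<and> smooth_torus_v B0 \<and>
       (\<forall>x. divg v0 x = 0) \<and> (\<forall>x. divg B0 x = 0) \<and> fcv B0 0 = 0"
  then show "\<exists>E01. in_X 1 E01 \<and> \<not> in_X (1 + \<delta>/2) E01 \<and>
          (\<exists>T>0. \<exists>v B E.
             mhd_mild \<nu> T v0 B0 (\<lambda>x. vector [E01 x, E02 x, E03 x]) v B E \<and>
             (\<forall>v' B' E'. mhd_mild \<nu> T v0 B0 (\<lambda>x. vector [E01 x, E02 x, E03 x]) v' B' E' \<longrightarrow>
                (\<forall>t\<in>{0..T}. v' t = v t \<and> B' t = B t \<and> E' t = E t)) \<and>
             (\<exists>t\<in>{0<..<T}. \<not> in_Xv (5 + \<delta>) (v t) \<or> \<not> in_Xv (5 + \<delta>) (B t)))"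
    using exists_irregular_solution[OF assms] by simp
qed simp

end
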